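(* Let $\phi$ be a Drinfeld $A$-module of rank $r\ge2$ over $L$ with period lattice $\Lambda$, provided with a successive minimum basis $\mathbf{B}=\{\lambda_1,\dots,\lambda_r\}$, split as $\mathbf{B}=\mathbf{B}_1\cup\dots\cup\mathbf{B}_t$ into packets as in the context, with $\#\mathbf{B}_\tau=r_\tau$ and $\sum_{1\le\tau\le t}r_\tau=r$. Then the residue class degree satisfies $$f(L(\Lambda)|L)\le\prod_{1\le\tau\le t}(q^{r_\tau}-1)\cdot p^{t-1}.$$
   Context: Let $\mathbb{F}=\mathbb{F}_q$ be the finite field with $q$ elements, of characteristic $p$, $A=\mathbb{F}[T]$, $K_\infty=\mathbb{F}((T^{-1}))$ with absolute value $|\cdot|$ normalized by $|T|=q$, and $C$ the completion of an algebraic closure of $K_\infty$ with the extended absolute value. $L\subset C$ is a finite extension of $K_\infty$. A Drinfeld $A$-module $\phi$ of rank $r$ over $L$ is given by $\phi_T(X)=TX+g_1X^q+\dots+g_rX^{q^r}$, $g_i\in L$, $g_r\ne0$; its period lattice $\Lambda\subset C$ is the discrete free $A$-submodule of rank $r$ with $e_\Lambda(Tz)=\phi_T(e_\Lambda(z))$ for all $z\in C$, where $e_\Lambda(z)=z\prod_{0\ne\lambda\in\Lambda}(1-z/\lambda)$; $L(\Lambda)|L$ is a finite Galois extension. A successive minimum basis of $\Lambda$ is an $A$-basis $\{\lambda_1,\dots,\lambda_r\}$ such that each $\lambda_i$ has minimal absolute value among the elements of $\Lambda\setminus\sum_{j<i}A\lambda_j$; then $|\lambda_1|\le\dots\le|\lambda_r|$.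 The packets $\mathbf{B}_1,\dots,\mathbf{B}_t$ are the maximal blocks of consecutive basis vectors of equal absolute value, ordered so that the absolute values strictly increase from $\mathbf{B}_1$ to $\mathbf{B}_t$. $f(\cdot|\cdot)$ denotes residue class degree. *)

theory Defs
  imports
    "HOL-Analysis.Analysis"
    "HOL-Algebra.Algebraic_Closure_Type"
    "HOL-Algebra.Generated_Fields"
    "HOL-Library.Extended_Nat"
begin

text \<open>
  \<^typ>\<open>'a fls\<close> with uniformizer \<^term>\<open>fls_X\<close> \<open>= T\<inverse>\<close> is the field \<open>K\<^sub>\<infinity> = \<bbbF>((T\<inverse>))\<close>; hence \<open>T\<close> is
  \<^term>\<open>fls_X_inv\<close>, and \<open>|f| = q^(- fls_subdegree f)\<close> is the absolute value with \<open>|T| = q\<close>.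
  The field \<open>C\<close> is a type \<open>'c\<close> with absolute value \<open>absv\<close> and an embedding \<open>\<iota>\<close> of \<open>K\<^sub>\<infinity>\<close>.
\<close>

definition absv :: "'c::{zero,metric_space} \<Rightarrow> real" where
  "absv x = dist x 0"

definition algebraic_elements :: "('a::field fls \<Rightarrow> 'c::field) \<Rightarrow> 'c set" where
  "algebraic_elements \<iota> = {x. \<exists>p. p \<noteq> 0 \<and> poly (map_poly \<iota> p) x = 0}"

text \<open>
  \<open>C\<close> is complete (class \<^class>\<open>complete_space\<close>), the elements of \<open>C\<close> that are algebraic over
  \<open>K\<^sub>\<infinity>\<close> form an algebraically closed field, i.e. an algebraic closure of \<open>K\<^sub>\<infinity>\<close>, and they are
  dense in \<open>C\<close>; the absolute value of \<open>C\<close> extends that of \<open>K\<^sub>\<infinity>\<close>.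
\<close>

locale completed_algebraic_closure =
  fixes \<iota> :: "'a::{field,finite} fls \<Rightarrow> 'c::{field,complete_space}"
  assumes \<iota>_one: "\<iota> 1 = 1"
    and \<iota>_add: "\<iota> (x + y) = \<iota> x + \<iota> y"
    and \<iota>_mult: "\<iota> (x * y) = \<iota> x * \<iota> y"
    and dist_absv: "dist u (v :: 'c) = absv (u - v)"
    and absv_mult: "absv (u * v :: 'c) = absv u * absv v"
    and absv_ultrametric: "absv (u + v :: 'c) \<le> max (absv u) (absv v)"
    and absv_\<iota>: "x \<noteq> 0 \<Longrightarrow> absv (\<iota> x) = real CARD('a) powi (- fls_subdegree x)"
    and algebraically_closed:
      "set (coeffs p) \<subseteq> algebraic_elements \<iota> \<Longrightarrow> Polynomial.degree p > 0 \<Longrightarrow>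
        \<exists>x \<in> algebraic_elements \<iota>. poly p x = 0"
    and algebraic_dense: "closure (algebraic_elements \<iota>) = UNIV"

definition finite_extension :: "('a::field fls \<Rightarrow> 'c::field) \<Rightarrow> 'c set \<Rightarrow> bool" where
  "finite_extension \<iota> L \<longleftrightarrow> subfield L ring_of_type_algebra \<and> range \<iota> \<subseteq> L \<and>
     ring.finite_dimension ring_of_type_algebra (range \<iota>) L"

text \<open>\<open>A = \<bbbF>[T]\<close> is \<^typ>\<open>'a poly\<close>, acting on \<open>C\<close> through \<open>A \<subseteq> K\<^sub>\<infinity> \<subseteq> C\<close>.\<close>

definition A_scale :: "('a::field fls \<Rightarrow> 'c::field) \<Rightarrow> 'a poly \<Rightarrow> 'c \<Rightarrow> 'c" where
  "A_scale \<iota> a z = \<iota> (poly (map_poly fls_const a) fls_X_inv) * z"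

definition A_basis :: "('a::field fls \<Rightarrow> 'c::field) \<Rightarrow> 'c set \<Rightarrow> nat \<Rightarrow> (nat \<Rightarrow> 'c) \<Rightarrow> bool" where
  "A_basis \<iota> \<Lambda> r lam \<longleftrightarrow> inj_on lam {1..r} \<and>
     \<not> Modules.module.dependent (A_scale \<iota>) (lam ` {1..r}) \<and>
     Modules.module.span (A_scale \<iota>) (lam ` {1..r}) = \<Lambda>"

text \<open>\<open>\<Phi>\<close> is the polynomial \<open>\<phi>\<^sub>T\<close>, which determines the Drinfeld module \<open>\<phi>\<close>.\<close>

definition drinfeld_module ::
    "('a::{field,finite} fls \<Rightarrow> 'c::field) \<Rightarrow> 'c set \<Rightarrow> nat \<Rightarrow> 'c poly \<Rightarrow> bool" where
  "drinfeld_module \<iota> L r \<Phi> \<longleftrightarrow> r \<ge> 1 \<and>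
     (\<exists>g. (\<forall>i\<in>{1..r}. g i \<in> L) \<and> g r \<noteq> 0 \<and>
        \<Phi> = Polynomial.monom (\<iota> fls_X_inv) 1 + (\<Sum>i=1..r. Polynomial.monom (g i) (CARD('a) ^ i)))"

text \<open>
  The infinite product \<open>e\<^sub>\<Lambda>(z)\<close> is the limit of its finite subproducts along the directed set of
  finite subsets of \<open>\<Lambda> \ {0}\<close>, so no enumeration of \<open>\<Lambda>\<close> is chosen.
\<close>

definition lattice_exp :: "'c::{field,metric_space} set \<Rightarrow> 'c \<Rightarrow> 'c" where
  "lattice_exp \<Lambda> z =
     Lim (finite_subsets_at_top (\<Lambda> - {0})) (\<lambda>F. z * (\<Prod>x\<in>F. 1 - z / x))"

definition period_lattice ::
    "('a::field fls \<Rightarrow> 'c::{field,metric_space}) \<Rightarrow> nat \<Rightarrow> 'c poly \<Rightarrow> 'c set \<Rightarrow> bool" where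
  "period_lattice \<iota> r \<Phi> \<Lambda> \<longleftrightarrow>
     Modules.module.subspace (A_scale \<iota>) \<Lambda> \<and> discrete \<Lambda> \<and> (\<exists>b. A_basis \<iota> \<Lambda> r b) \<and>
     (\<forall>z. lattice_exp \<Lambda> (\<iota> fls_X_inv * z) = poly \<Phi> (lattice_exp \<Lambda> z))"

definition successive_minimum_basis ::
    "('a::field fls \<Rightarrow> 'c::{field,metric_space}) \<Rightarrow> 'c set \<Rightarrow> nat \<Rightarrow> (nat \<Rightarrow> 'c) \<Rightarrow> bool" where
  "successive_minimum_basis \<iota> \<Lambda> r lam \<longleftrightarrow> A_basis \<iota> \<Lambda> r lam \<and>
     (\<forall>i\<in>{1..r}. \<forall>x \<in> \<Lambda> - Modules.module.span (A_scale \<iota>) (lam ` {1..<i}).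
        absv (lam i) \<le> absv x)"

definition packet :: "nat \<Rightarrow> (nat \<Rightarrow> 'c::{field,metric_space}) \<Rightarrow> 'c set \<Rightarrow> bool" where
  "packet r lam P \<longleftrightarrow> (\<exists>a b. 1 \<le> a \<and> a \<le> b \<and> b \<le> r \<and> P = lam ` {a..b} \<and>
     (\<forall>i\<in>{a..b}. absv (lam i) = absv (lam a)) \<and>
     (a = 1 \<or> absv (lam (a - 1)) \<noteq> absv (lam a)) \<and>
     (b = r \<or> absv (lam (b + 1)) \<noteq> absv (lam b)))"

definition packets :: "nat \<Rightarrow> (nat \<Rightarrow> 'c::{field,metric_space}) \<Rightarrow> nat \<Rightarrow> (nat \<Rightarrow> 'c set) \<Rightarrow> bool" where
  "packets r lam t B \<longleftrightarrow> bij_betw B {1..t} {P. packet r lam P} \<and>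
     (\<forall>\<sigma>\<in>{1..t}. \<forall>\<tau>\<in>{1..t}. \<sigma> < \<tau> \<longrightarrow> (\<forall>x\<in>B \<sigma>. \<forall>y\<in>B \<tau>. absv x < absv y))"

definition adjoin :: "'c::field set \<Rightarrow> 'c set \<Rightarrow> 'c set" where
  "adjoin L S = generate_field ring_of_type_algebra (L \<union> S)"

definition integers_of :: "'c::{field,metric_space} set \<Rightarrow> 'c set" where
  "integers_of M = {x \<in> M. absv x \<le> 1}"

definition integer_ring :: "'c::{field,metric_space} set \<Rightarrow> 'c ring" where
  "integer_ring M = ring_of_type_algebra\<lparr>carrier := integers_of M\<rparr>"

definition maximal_ideal_of :: "'c::{field,metric_space} set \<Rightarrow> 'c set" where
  "maximal_ideal_of M = {x \<in> M. absv x < 1}"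

definition residue_field :: "'c::{field,metric_space} set \<Rightarrow> 'c set ring" where
  "residue_field M = integer_ring M Quot maximal_ideal_of M"

text \<open>
  For \<open>L \<subseteq> M\<close>, the residue field of \<open>L\<close> is identified with its image in that of \<open>M\<close>,
  that is, with the classes of integers of \<open>L\<close>.
\<close>

definition residue_subfield :: "'c::{field,metric_space} set \<Rightarrow> 'c set \<Rightarrow> 'c set set" where
  "residue_subfield M L = (\<lambda>x. maximal_ideal_of M +>\<^bsub>integer_ring M\<^esub> x) ` integers_of L"

text \<open>
  The residue class degree \<open>f(M|L)\<close>; since \<^term>\<open>ring.dim\<close> is only meaningful
  in finite dimension, the infinite case is given the value \<open>\<infinity>\<close>.
\<close>

definition residue_degree :: "'c::{field,metric_space} set \<Rightarrow> 'c set \<Rightarrow> enat" where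
  "residue_degree M L =
     (let k = residue_field M; k' = residue_subfield M L in
      if ring.finite_dimension k k' (carrier k) then enat (ring.dim k k' (carrier k)) else \<infinity>)"

lemma (in completed_algebraic_closure) module_A_scale: "Modules.module (A_scale \<iota>)"
proof -
  let ?e = "\<lambda>a :: 'a poly. poly (map_poly fls_const a) (fls_X_inv :: 'a fls)"
  have add: "?e (a + b) = ?e a + ?e b" for a b
  proof -
    have "map_poly fls_const (a + b) = map_poly fls_const a + map_poly fls_const b"
      by (rule poly_eqI) (simp add: coeff_map_poly fls_plus_const)
    then show ?thesis
      by simp
  qed
  have smult: "?e (Polynomial.smult c b) = fls_const c * ?e b" for c b
  proof -
    have "map_poly fls_const (Polynomial.smult c b) =
        Polynomial.smult (fls_const c) (map_poly fls_const b)"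
      by (rule poly_eqI) (simp add: coeff_map_poly fls_const_mult_const)
    then show ?thesis
      by simp
  qed
  have mult: "?e (a * b) = ?e a * ?e b" for a b
    by (induction a) (simp_all add: add smult map_poly_pCons algebra_simps)
  show ?thesis
    by unfold_locales
      (simp_all add: A_scale_def add mult \<iota>_add \<iota>_mult \<iota>_one algebra_simps)
qed

end

theory Submission
  imports
    Defs
    "HOL-Number_Theory.Cong"
    "HOL-Algebra.Multiplicative_Group"
begin

text \<open>
  No Galois theory is needed. Let \<open>Q\<close> be the number of elements of the residue field of \<open>L\<close>. For each
  \<open>z\<close> in the algebraic closure of \<open>F\<close> inside \<open>C\<close>, Zorn's lemma and completion give an isometric
  endomorphism \<open>\<sigma>\<close> of \<open>C\<close> over \<open>L\<close> with \<open>\<sigma> z = z\<^sup>Q\<close>. Since \<open>e\<^sub>\<Lambda>\<close> is the limit of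
  \<open>\<phi>\<^sub>T\<^sup>n (z / T\<^sup>n)\<close>, such a \<open>\<sigma>\<close> maps \<open>\<Lambda>\<close> to itself. By orthogonality of successive minimum bases it is
  block triangular with respect to the packets, and the diagonal blocks have entries in \<open>F\<close>. The block
  of size \<open>d\<close> has order at most \<open>q\<^sup>d - 1\<close>, and a unipotent matrix with \<open>t\<close> blocks has order
  dividing \<open>p\<^sup>t\<^sup>-\<^sup>1\<close>, because \<open>t \<le> p\<^sup>t\<^sup>-\<^sup>1\<close>. So some \<open>\<sigma>\<^sup>m\<close> with \<open>m\<close> at most the claimed bound fixes
  \<open>L(\<Lambda>)\<close>, whence \<open>z\<close> is fixed by the \<open>m\<close>-th power of the \<open>Q\<close>-Frobenius whenever \<open>z\<close> represents a
  residue class of \<open>L(\<Lambda>)\<close>.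
\<close>

text \<open>Three points shape the argument. First, a homomorphism produced by Zorn's lemma is not
  continuous by construction. Continuity comes from the uniqueness of the absolute value over the
  complete field \<open>K\<^sub>\<infinity>\<close>, which is why closedness of finite-dimensional
  subspaces comes first. Second, a packet spans an infinite A-module, on which no orbit count is
  possible. The order of a diagonal block is therefore found on the finite F-space of constant
  combinations of the packet modulo the earlier packets, using modules over F[x] in place of
  matrices; A-linearity carries the result back. The exponents of the blocks are simply multiplied,
  which suffices for an upper bound. Third, equal characteristic allows all residue classes to be
  lifted to a field \<open>Fbar\<close> inside \<open>C\<close>. Residue fields are then counted as
  sets of roots of \<open>z ^ (Q ^ m) = z\<close>: there are at most \<open>Q ^ m\<close> of them,
  so the residue class degree is at most \<open>m\<close>.\<close>

hide_const (open) up_ring.coeff up_ring.monom module.smult Divisibility.prime Polynomials.degree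

section \<open>Absolute values and finite-dimensional subspaces\<close>

context completed_algebraic_closure
begin

lemma absv_nonneg [simp]: "0 \<le> absv (x::'c)"
  by (simp add: absv_def)

lemma absv_eq_0_iff [simp]: "absv (x::'c) = 0 \<longleftrightarrow> x = 0"
  by (simp add: absv_def)

lemma absv_pos_iff [simp]: "0 < absv (x::'c) \<longleftrightarrow> x \<noteq> 0"
  by (simp add: absv_def)

lemma absv_zero [simp]: "absv (0::'c) = 0"
  by simp

lemma absv_one [simp]: "absv (1::'c) = 1"
  using absv_mult[of 1 1] by simp

lemma absv_minus_commute: "absv (x - y :: 'c) = absv (y - x)"
  by (metis dist_absv dist_commute)

lemma absv_minus [simp]: "absv (- x :: 'c) = absv x"
  using absv_minus_commute[of 0 x] by simp

lemma absv_diff_le: "absv (x - y :: 'c) \<le> max (absv x) (absv y)"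
  using absv_ultrametric[of x "- y"] by simp

lemma absv_power: "absv (x ^ n :: 'c) = absv x ^ n"
  by (induction n) (simp_all add: absv_mult)

lemma absv_inverse: "absv (inverse x :: 'c) = inverse (absv x)"
proof (cases "x = 0")
  case False
  then have "absv x * absv (inverse x) = 1"
    by (simp flip: absv_mult)
  then show ?thesis
    using inverse_unique by metis
qed simp

lemma absv_divide: "absv (x / y :: 'c) = absv x / absv y"
  by (simp add: divide_inverse absv_mult absv_inverse)

lemma absv_add_le: "absv (x::'c) \<le> c \<Longrightarrow> absv y \<le> c \<Longrightarrow> absv (x + y) \<le> c"
  using absv_ultrametric[of x y] by simp

lemma absv_add_less: "absv (x::'c) < c \<Longrightarrow> absv y < c \<Longrightarrow> absv (x + y) < c"
  using absv_ultrametric[of x y] by simp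

lemma absv_diff_less: "absv (x::'c) < c \<Longrightarrow> absv y < c \<Longrightarrow> absv (x - y) < c"
  using absv_diff_le[of x y] by simp

lemma absv_sum_le:
  assumes "\<And>i. i \<in> S \<Longrightarrow> absv (f i :: 'c) \<le> c" "0 \<le> c"
  shows "absv (sum f S) \<le> c"
  using assms by (induction S rule: infinite_finite_induct) (auto intro: absv_add_le)

lemma absv_sum_less:
  assumes "\<And>i. i \<in> S \<Longrightarrow> absv (f i :: 'c) < c" "0 < c"
  shows "absv (sum f S) < c"
  using assms by (induction S rule: infinite_finite_induct) (auto intro: absv_add_less)

lemma absv_add_eq_left:
  assumes "absv (y::'c) < absv x"
  shows "absv (x + y) = absv x"
proof (rule antisym)
  show "absv (x + y) \<le> absv x"
    using assms by (intro absv_add_le) auto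
  show "absv x \<le> absv (x + y)"
    using absv_diff_le[of "x + y" y] assms by (auto simp: max_def split: if_splits)
qed

section \<open>The embedding of \<open>K\<^sub>\<infinity>\<close> into \<open>C\<close> and the
  coefficients of Laurent series\<close>

lemma \<iota>_zero [simp]: "\<iota> 0 = 0"
  by (metis \<iota>_add add_0 add_cancel_right_left)

lemma \<iota>_one' [simp]: "\<iota> 1 = 1"
  by (rule \<iota>_one)

lemma \<iota>_uminus: "\<iota> (- x) = - \<iota> x"
  using \<iota>_add[of x "- x"] by (simp add: eq_neg_iff_add_eq_0 add.commute)

lemma \<iota>_diff: "\<iota> (x - y) = \<iota> x - \<iota> y"
  using \<iota>_add[of x "- y"] by (simp add: \<iota>_uminus)

lemma \<iota>_of_nat: "\<iota> (of_nat n) = of_nat n"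
  by (induction n) (simp_all add: \<iota>_add)

lemma \<iota>_eq_0_iff [simp]: "\<iota> x = 0 \<longleftrightarrow> x = 0"
  using absv_\<iota>[of x] by (cases "x = 0") (auto simp: power_int_eq_0_iff)

lemma \<iota>_eq_iff [simp]: "\<iota> x = \<iota> y \<longleftrightarrow> x = y"
  using \<iota>_eq_0_iff[of "x - y"] by (simp only: \<iota>_diff right_minus_eq)

lemma \<iota>_inverse: "\<iota> (inverse x) = inverse (\<iota> x)"
proof (cases "x = 0")
  case False
  then have "\<iota> x * \<iota> (inverse x) = 1"
    by (simp flip: \<iota>_mult)
  then show ?thesis
    using inverse_unique by metis
qed simp

lemma card_a_ge2: "CARD('a) \<ge> 2"
proof -
  have "card {0, 1 :: 'a} \<le> CARD('a)"
    by (rule card_mono) auto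
  then show ?thesis
    by simp
qed

lemma card_a_gt1 [simp]: "1 < real CARD('a)"
  using card_a_ge2 by linarith

lemma prime_CHAR_a: "prime CHAR('a)"
  using finite_imp_CHAR_pos[where ?'a = 'a] prime_CHAR_semidom[where ?'a = 'a] by simp

lemma of_nat_fls_eq_0_iff: "(of_nat n :: 'a fls) = 0 \<longleftrightarrow> (of_nat n :: 'a) = 0"
  by (simp add: fls_of_nat)

lemma CHAR_c: "CHAR('c) = CHAR('a)"
proof -
  have "(of_nat n :: 'c) = 0 \<longleftrightarrow> (of_nat n :: 'a) = 0" for n
    using of_nat_fls_eq_0_iff[of n] \<iota>_eq_0_iff[of "of_nat n"] by (simp add: \<iota>_of_nat)
  then have "CHAR('a) dvd n \<longleftrightarrow> CHAR('c) dvd n" for n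
    by (simp add: of_nat_eq_0_iff_char_dvd)
  then show ?thesis
    by (metis dvd_antisym dvd_refl)
qed

lemma prime_CHAR_c: "prime CHAR('c)"
  using CHAR_c prime_CHAR_a by simp

lemma card_powi_le_iff: "real CARD('a) powi m \<le> real CARD('a) powi n \<longleftrightarrow> m \<le> n"
proof
  show "real CARD('a) powi m \<le> real CARD('a) powi n" if "m \<le> n"
    using that card_a_gt1 by (intro power_int_increasing) linarith+
  show "m \<le> n" if "real CARD('a) powi m \<le> real CARD('a) powi n"
  proof (rule ccontr)
    assume "\<not> m \<le> n"
    then have "real CARD('a) powi n < real CARD('a) powi m"
      using card_a_gt1 by (intro power_int_strict_increasing) linarith+
    with that show False
      by simp
  qed
qed

text \<open>Bounds by powers of q become the vanishing of low coefficients; estimates in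
  \<open>K\<^sub>\<infinity>\<close> are made in this form below.\<close>

lemma absv_\<iota>_le_iff:
  "absv (\<iota> f) \<le> real CARD('a) powi (- k) \<longleftrightarrow> (\<forall>i<k. fls_nth f i = 0)"
proof (cases "f = 0")
  case False
  have "absv (\<iota> f) \<le> real CARD('a) powi (- k) \<longleftrightarrow> k \<le> fls_subdegree f"
    unfolding absv_\<iota>[OF False] card_powi_le_iff by simp
  also have "\<dots> \<longleftrightarrow> (\<forall>i<k. fls_nth f i = 0)"
    using False fls_subdegree_geI[of f k]
    by (meson fls_eq0_below_subdegree less_le_trans linorder_not_less nth_fls_subdegree_nonzero)
  finally show ?thesis .
qed (simp add: zero_le_power_int)

lemma absv_\<iota>_le_one_iff: "absv (\<iota> f) \<le> 1 \<longleftrightarrow> (\<forall>i<0. fls_nth f i = 0)"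
  using absv_\<iota>_le_iff[of f 0] by simp

lemma absv_\<iota>_less_one_iff: "absv (\<iota> f) < 1 \<longleftrightarrow> (\<forall>i\<le>0. fls_nth f i = 0)"
proof -
  \<comment> \<open>The value group is discrete: the largest value below 1 is
    \<open>q^(-1)\<close>.\<close>
  have "absv (\<iota> f) < 1 \<longleftrightarrow> absv (\<iota> f) \<le> real CARD('a) powi (- 1)"
  proof (cases "f = 0")
    case False
    show ?thesis
      using card_powi_le_iff[of 0 "- fls_subdegree f"] card_powi_le_iff[of "- fls_subdegree f" "- 1"]
      unfolding absv_\<iota>[OF False] by (simp del: power_int_minus) linarith
  qed simp
  also have "\<dots> \<longleftrightarrow> (\<forall>i\<le>0. fls_nth f i = 0)"
    unfolding absv_\<iota>_le_iff by auto
  finally show ?thesis .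
qed

lemma absv_const: "c \<noteq> 0 \<Longrightarrow> absv (\<iota> (fls_const c)) = 1"
  by (simp add: absv_\<iota>)

lemma absv_const_le: "absv (\<iota> (fls_const c)) \<le> 1"
  using absv_const[of c] by (cases "c = 0") auto

lemma absv_T: "absv (\<iota> fls_X_inv) = real CARD('a)"
  by (simp add: absv_\<iota>)

text \<open>Reduction on the integers of \<open>K\<^sub>\<infinity>\<close> reads off the
  coefficient of index 0, so the residue field is F.\<close>

lemma absv_\<iota>_diff_const_less:
  assumes "absv (\<iota> f) \<le> 1"
  shows "absv (\<iota> f - \<iota> (fls_const (fls_nth f 0))) < 1"
proof -
  have "absv (\<iota> (f - fls_const (fls_nth f 0))) < 1"
    unfolding absv_\<iota>_less_one_iff using assms absv_\<iota>_le_one_iff[of f]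
    by (auto simp: order_le_less)
  then show ?thesis
    by (simp add: \<iota>_diff)
qed

section \<open>Limits in \<open>C\<close> and completeness of
  \<open>K\<^sub>\<infinity>\<close>\<close>

lemma tendsto_absv_iff: "(f \<longlongrightarrow> (l::'c)) F \<longleftrightarrow> ((\<lambda>x. absv (f x - l)) \<longlongrightarrow> 0) F"
  by (subst tendsto_dist_iff) (simp add: dist_absv)

lemma tendsto_absvI:
  assumes "(g \<longlongrightarrow> 0) F" "eventually (\<lambda>x. absv (f x - (l::'c)) \<le> g x) F"
  shows "(f \<longlongrightarrow> l) F"
  unfolding tendsto_absv_iff
  by (rule tendsto_sandwich[OF _ assms(2) tendsto_const assms(1)]) simp

text \<open>The type of \<open>C\<close> is merely a field with a complete metric, so continuity of
  the field operations is derived from the absolute value.\<close>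

lemma tendsto_addC:
  assumes "(f \<longlongrightarrow> (a::'c)) F" "(g \<longlongrightarrow> b) F"
  shows "((\<lambda>x. f x + g x) \<longlongrightarrow> a + b) F"
proof (rule tendsto_absvI)
  show "((\<lambda>x. absv (f x - a) + absv (g x - b)) \<longlongrightarrow> 0) F"
    using tendsto_add[OF assms[unfolded tendsto_absv_iff]] by simp
  have "absv ((f x - a) + (g x - b)) \<le> absv (f x - a) + absv (g x - b)" for x
    by (rule absv_add_le) auto
  then show "\<forall>\<^sub>F x in F. absv (f x + g x - (a + b)) \<le> absv (f x - a) + absv (g x - b)"
    by (simp add: algebra_simps)
qed

lemma tendsto_multC:
  assumes "(f \<longlongrightarrow> (a::'c)) F" "(g \<longlongrightarrow> b) F"
  shows "((\<lambda>x. f x * g x) \<longlongrightarrow> a * b) F"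
proof (rule tendsto_absvI)
  let ?h = "\<lambda>x. absv (f x - a) * absv (g x - b) + (absv (f x - a) * absv b + absv a * absv (g x - b))"
  have "(?h \<longlongrightarrow> 0 * 0 + (0 * absv b + absv a * 0)) F"
    using assms[unfolded tendsto_absv_iff] by (intro tendsto_intros)
  then show "(?h \<longlongrightarrow> 0) F"
    by simp
  have "absv (f x * g x - a * b) \<le> ?h x" for x
  proof -
    have "f x * g x - a * b = (f x - a) * (g x - b) + ((f x - a) * b + a * (g x - b))"
      by (simp add: algebra_simps)
    also have "absv \<dots> \<le> ?h x"
      by (intro absv_add_le) (simp_all add: absv_mult)
    finally show ?thesis .
  qed
  then show "\<forall>\<^sub>F x in F. absv (f x * g x - a * b) \<le> ?h x"
    by simp
qed

lemma tendsto_diffC: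
  assumes "(f \<longlongrightarrow> (a::'c)) F" "(g \<longlongrightarrow> b) F"
  shows "((\<lambda>x. f x - g x) \<longlongrightarrow> a - b) F"
  using tendsto_addC[OF assms(1) tendsto_multC[OF tendsto_const[of "-1"] assms(2)]] by simp

lemma closure_absvE:
  assumes "(x::'c) \<in> closure S" "0 < e"
  obtains y where "y \<in> S" "absv (y - x) < e"
  using assms unfolding closure_approachable dist_absv by blast

text \<open>Approximations of precision \<open>q^(-(k+1))\<close> share all coefficients of index at
  most \<open>k\<close>, and the diagonal series read off from them is the limit.\<close>

lemma closed_range_\<iota>: "closed (range \<iota>)"
proof -
  have "l \<in> range \<iota>" if l: "l \<in> closure (range \<iota>)" for l
  proof -
    have "\<exists>h. absv (\<iota> h - l) \<le> real CARD('a) powi (- (int k + 1))" for k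
    proof -
      have "0 < real CARD('a) powi (- (int k + 1))"
        using card_a_gt1 by (intro zero_less_power_int) linarith
      then show ?thesis
        using closure_absvE[OF l] by (metis less_imp_le rangeE)
    qed
    then obtain h where h: "\<And>k. absv (\<iota> (h k) - l) \<le> real CARD('a) powi (- (int k + 1))"
      by metis
    have agree: "fls_nth (h k) i = fls_nth (h m) i" if "k \<le> m" "i \<le> int k" for k m i
    proof -
      have "absv ((\<iota> (h k) - l) - (\<iota> (h m) - l)) \<le>
          max (absv (\<iota> (h k) - l)) (absv (\<iota> (h m) - l))"
        by (rule absv_diff_le)
      also have "\<dots> \<le> real CARD('a) powi (- (int k + 1))"
      proof -
        have "real CARD('a) powi (- (int m + 1)) \<le> real CARD('a) powi (- (int k + 1))"
          using that card_a_gt1 by (intro power_int_increasing) auto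
        then show ?thesis
          using h[of k] h[of m] by simp
      qed
      finally have "absv (\<iota> (h k - h m)) \<le> real CARD('a) powi (- (int k + 1))"
        by (simp add: \<iota>_diff)
      then show ?thesis
        using that unfolding absv_\<iota>_le_iff by (auto simp: less_le_not_le dest: spec[of _ i])
    qed
    \<comment> \<open>For \<open>i < 0\<close> the index \<open>nat i\<close> is 0: all negative
      coefficients come from \<open>h 0\<close>, so only finitely many are nonzero.\<close>
    define F where "F = Abs_fls (\<lambda>i. fls_nth (h (nat i)) i)"
    have F: "fls_nth F i = fls_nth (h (nat i)) i" for i
      unfolding F_def
    proof (rule nth_Abs_fls)
      have "\<forall>\<^sub>\<infinity>n. fls_nth (h 0) (- int n) = 0"
        by (rule MOST_fls_neg_nth_eq_0)
      then show "\<forall>\<^sub>\<infinity>n. fls_nth (h (nat (- int n))) (- int n) = 0"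
        by simp
    qed
    have "absv (\<iota> F - l) \<le> real CARD('a) powi (- (int k + 1))" for k
    proof -
      have "absv (\<iota> (F - h k)) \<le> real CARD('a) powi (- (int k + 1))"
        unfolding absv_\<iota>_le_iff
      proof (intro allI impI)
        fix i assume "i < int k + 1"
        then show "fls_nth (F - h k) i = 0"
          using agree[of "nat i" k i] by (simp add: F nat_le_iff)
      qed
      then have "absv (\<iota> (F - h k) + (\<iota> (h k) - l)) \<le> real CARD('a) powi (- (int k + 1))"
        using h by (intro absv_add_le)
      then show ?thesis
        by (simp add: \<iota>_diff)
    qed
    moreover have "(\<lambda>k. real CARD('a) powi (- (int k + 1))) \<longlonglongrightarrow> 0"
    proof -
      have "(\<lambda>k. inverse (real CARD('a)) ^ Suc k) \<longlonglongrightarrow> 0"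
        using card_a_gt1 LIMSEQ_Suc[OF LIMSEQ_realpow_zero[of "inverse (real CARD('a))"]]
        by (simp add: field_simps)
      moreover have "real CARD('a) powi (- (int k + 1)) = inverse (real CARD('a)) ^ Suc k" for k
        by (simp add: power_int_def nat_add_distrib)
      ultimately show ?thesis
        by simp
    qed
    ultimately have "absv (\<iota> F - l) \<le> 0"
      by (intro LIMSEQ_le_const) auto
    then show ?thesis
      using order_antisym[OF _ absv_nonneg[of "\<iota> F - l"]] by auto
  qed
  then show ?thesis
    by (metis closure_subset_eq subsetI)
qed

section \<open>Finite-dimensional subspaces over \<open>K\<^sub>\<infinity>\<close>\<close>

sublocale K: vector_space "\<lambda>a x. \<iota> a * x"
  by unfold_locales (simp_all add: algebra_simps \<iota>_add \<iota>_mult)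

declare K.scale_scale [simp del] \<comment> \<open>loops together with \<open>\<iota>_mult\<close> and \<open>mult.assoc\<close>\<close>

text \<open>A ball of radius \<open>d\<close> around \<open>e\<close> avoids \<open>W\<close>, and
  scaling by \<open>a\<close> gives the general case. The bound makes the coordinate along
  \<open>e\<close> continuous.\<close>

lemma dist_subspace_bound:
  assumes "closed W" "K.subspace W" "e \<notin> W"
  obtains d where "0 < d" "\<And>a w. w \<in> W \<Longrightarrow> absv (\<iota> a) * d \<le> absv (\<iota> a * e + w)"
proof -
  have "open (- W)" "e \<in> - W"
    using assms by auto
  then obtain d where d: "d > 0" "\<And>y. dist y e < d \<Longrightarrow> y \<notin> W"
    unfolding open_dist by auto
  have "absv (\<iota> a) * d \<le> absv (\<iota> a * e + w)" if w: "w \<in> W" for a w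
  proof (cases "a = 0")
    case False
    have "\<iota> (- inverse a) * w \<in> W"
      using K.subspace_scale[OF assms(2) w] .
    then have "d \<le> absv (\<iota> (- inverse a) * w - e)"
      using d(2)[of "\<iota> (- inverse a) * w"] unfolding dist_absv by (meson not_le)
    also have "\<dots> = absv (e + inverse (\<iota> a) * w)"
      by (subst absv_minus_commute) (simp add: \<iota>_uminus \<iota>_inverse)
    finally have "absv (\<iota> a) * d \<le> absv (\<iota> a) * absv (e + inverse (\<iota> a) * w)"
      by (intro mult_left_mono) auto
    also have "\<dots> = absv (\<iota> a * e + w)"
      using False by (simp flip: absv_mult add: algebra_simps)
    finally show ?thesis .
  qed simp
  with d(1) show ?thesis
    using that by blast
qed

text \<open>Along a convergent sequence the coordinates of the new generator are Cauchy by
  \<open>dist_subspace_bound\<close>; they converge inside \<open>K\<^sub>\<infinity>\<close>, and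
  the rest converges in the smaller span.\<close>

lemma closed_K_span: "finite S \<Longrightarrow> closed (K.span S)"
proof (induction S rule: finite_induct)
  case (insert e S)
  show ?case
  proof (cases "e \<in> K.span S")
    case True
    then show ?thesis
      using insert.IH by (simp add: K.span_redundant)
  next
    case False
    obtain d where d: "0 < d"
      "\<And>a w. w \<in> K.span S \<Longrightarrow> absv (\<iota> a) * d \<le> absv (\<iota> a * e + w)"
      using dist_subspace_bound[OF insert.IH K.subspace_span False] by blast
    show ?thesis
      unfolding closed_sequential_limits
    proof (intro allI impI, elim conjE)
      fix z l assume z: "\<forall>n. z n \<in> K.span (insert e S)" and lim: "z \<longlonglongrightarrow> l"
      then have "\<forall>n. \<exists>a. z n - \<iota> a * e \<in> K.span S"
        by (simp add: K.span_breakdown_eq)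
      then obtain a where a: "\<And>n. z n - \<iota> (a n) * e \<in> K.span S"
        by metis
      have bound: "absv (\<iota> (a n) - \<iota> (a m)) * d \<le> absv (z n - z m)" for n m
        using d(2)[OF K.span_diff[OF a[of n] a[of m]], of "a n - a m"]
        by (simp add: \<iota>_diff algebra_simps)
      have "Cauchy (\<lambda>n. \<iota> (a n))"
        unfolding Cauchy_def dist_absv
      proof (intro allI impI)
        fix \<epsilon> :: real assume "\<epsilon> > 0"
        then have "\<epsilon> * d > 0"
          using d(1) by simp
        then obtain M where M: "\<And>m n. m \<ge> M \<Longrightarrow> n \<ge> M \<Longrightarrow> absv (z m - z n) < \<epsilon> * d"
          using LIMSEQ_imp_Cauchy[OF lim] unfolding Cauchy_def dist_absv by blast
        have "absv (\<iota> (a m) - \<iota> (a n)) < \<epsilon>" if "m \<ge> M" "n \<ge> M" for m n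
          using M[OF that] bound[of m n] d(1) by (meson le_less_trans mult_less_cancel_right_pos)
        then show "\<exists>M. \<forall>m\<ge>M. \<forall>n\<ge>M. absv (\<iota> (a m) - \<iota> (a n)) < \<epsilon>"
          by blast
      qed
      then obtain l' where l': "(\<lambda>n. \<iota> (a n)) \<longlonglongrightarrow> l'"
        by (meson Cauchy_convergent convergent_def)
      have "l' \<in> range \<iota>"
        by (rule closed_sequentially[OF closed_range_\<iota> _ l']) simp
      then obtain a' where a': "l' = \<iota> a'"
        by blast
      have "(\<lambda>n. z n - \<iota> (a n) * e) \<longlonglongrightarrow> l - l' * e"
        by (intro tendsto_diffC tendsto_multC lim l' tendsto_const)
      then have "l - l' * e \<in> K.span S"
        by (rule closed_sequentially[OF insert.IH a])
      then show "l \<in> K.span (insert e S)"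
        unfolding K.span_breakdown_eq a' by blast
    qed
  qed
qed simp

text \<open>One half of the equivalence of norms on a finite-dimensional space: every basis vector
  has positive distance from the closed span of the others.\<close>

lemma coefficient_bound:
  assumes "finite B" "K.independent B"
  obtains C where "0 < C"
    "\<And>f b. b \<in> B \<Longrightarrow> absv (\<iota> (f b)) \<le> C * absv (\<Sum>b\<in>B. \<iota> (f b) * b)"
proof -
  have "\<exists>d. 0 < d \<and> (\<forall>f. absv (\<iota> (f b)) * d \<le> absv (\<Sum>b\<in>B. \<iota> (f b) * b))" if b: "b \<in> B" for b
  proof -
    have "b \<notin> K.span (B - {b})"
      using assms(2) b by (auto simp: K.dependent_def)
    then obtain d where d: "0 < d"
      "\<And>a w. w \<in> K.span (B - {b}) \<Longrightarrow> absv (\<iota> a) * d \<le> absv (\<iota> a * b + w)"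
      using dist_subspace_bound[OF closed_K_span K.subspace_span] assms(1)
      by (metis finite_Diff)
    have "absv (\<iota> (f b)) * d \<le> absv (\<Sum>b\<in>B. \<iota> (f b) * b)" for f
    proof -
      have "(\<Sum>c\<in>B - {b}. \<iota> (f c) * c) \<in> K.span (B - {b})"
        by (intro K.span_sum K.span_scale K.span_base)
      from d(2)[OF this, of "f b"] show ?thesis
        using assms(1) b by (simp add: sum.remove)
    qed
    with d(1) show ?thesis
      by blast
  qed
  then obtain d where d: "\<And>b. b \<in> B \<Longrightarrow> 0 < d b"
      "\<And>b f. b \<in> B \<Longrightarrow> absv (\<iota> (f b)) * d b \<le> absv (\<Sum>b\<in>B. \<iota> (f b) * b)"
    by metis
  \<comment> \<open>The sum dominates every \<open>1 / d b\<close>; the summand 1 keeps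
    \<open>C\<close> positive for empty \<open>B\<close>.\<close>
  define C where "C = 1 + (\<Sum>b\<in>B. 1 / d b)"
  have C: "C > 0"
    unfolding C_def using d(1) by (intro add_pos_nonneg sum_nonneg) (auto intro: less_imp_le)
  have "absv (\<iota> (f b)) \<le> C * absv (\<Sum>b\<in>B. \<iota> (f b) * b)" if b: "b \<in> B" for f b
  proof -
    have "absv (\<iota> (f b)) \<le> (1 / d b) * absv (\<Sum>b\<in>B. \<iota> (f b) * b)"
      using d[OF b] by (simp add: field_simps)
    also have "1 / d b \<le> C"
    proof -
      have "1 / d b \<le> (\<Sum>b\<in>B. 1 / d b)"
        using b assms(1) d(1) by (intro member_le_sum) (auto intro: less_imp_le)
      then show ?thesis
        by (simp add: C_def)
    qed
    finally show ?thesis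
      by (simp add: mult_right_mono)
  qed
  then show ?thesis
    using C by (intro that)
qed

section \<open>Algebraic elements\<close>

lemma poly_map_\<iota>_altdef:
  assumes "degree p \<le> n"
  shows "poly (map_poly \<iota> p) x = (\<Sum>i\<le>n. \<iota> (coeff p i) * x ^ i)"
proof -
  have "degree (map_poly \<iota> p) \<le> n"
    using assms by (intro degree_le) (auto simp: coeff_map_poly coeff_eq_0)
  then have "poly (map_poly \<iota> p) x = (\<Sum>i\<le>n. coeff (map_poly \<iota> p) i * x ^ i)"
    unfolding poly_altdef by (intro sum.mono_neutral_left) (auto simp: coeff_eq_0)
  then show ?thesis
    by (simp add: coeff_map_poly)
qed

lemma poly_map_\<iota>_pCons: "poly (map_poly \<iota> (pCons a p)) x = \<iota> a + x * poly (map_poly \<iota> p) x"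
  by (simp add: map_poly_pCons)

lemma poly_map_\<iota>_smult: "poly (map_poly \<iota> (smult c p)) x = \<iota> c * poly (map_poly \<iota> p) x"
  by (induction p) (simp_all add: poly_map_\<iota>_pCons \<iota>_mult algebra_simps)

text \<open>Being algebraic is recast as having all powers in one finite-dimensional subspace, a
  property that passes to sums and products by multiplying spanning sets.\<close>

lemma algebraic_imp_finite_span:
  assumes "x \<in> algebraic_elements \<iota>"
  obtains S where "finite S" "\<And>n. x ^ n \<in> K.span S"
proof -
  obtain p where p: "p \<noteq> 0" "poly (map_poly \<iota> p) x = 0"
    using assms by (auto simp: algebraic_elements_def)
  define d where "d = degree p"
  define c where "c = coeff p d"
  have c: "c \<noteq> 0"
    using p(1) by (simp add: c_def d_def)
  let ?S = "(\<lambda>i. x ^ i) ` {..<d}"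
  have "(\<Sum>i<d. \<iota> (coeff p i) * x ^ i) + \<iota> c * x ^ d = 0"
    using p(2) by (simp add: poly_map_\<iota>_altdef[of p d] d_def c_def flip: lessThan_Suc_atMost)
  then have "\<iota> c * x ^ d = - (\<Sum>i<d. \<iota> (coeff p i) * x ^ i)"
    by (simp only: add_eq_0_iff)
  then have "\<iota> (inverse c) * (\<iota> c * x ^ d) = \<iota> (inverse c) * - (\<Sum>i<d. \<iota> (coeff p i) * x ^ i)"
    by (simp only:)
  moreover have "\<iota> (inverse c) * (\<iota> c * x ^ d) = x ^ d"
    using c by (simp add: \<iota>_inverse)
  ultimately have "x ^ d = \<iota> (- inverse c) * (\<Sum>i<d. \<iota> (coeff p i) * x ^ i)"
    by (simp only: \<iota>_uminus mult_minus_right mult_minus_left)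
  also have "\<dots> = (\<Sum>i<d. \<iota> (- inverse c * coeff p i) * x ^ i)"
    unfolding sum_distrib_left by (simp only: \<iota>_mult mult.assoc)
  finally have xd: "x ^ d = (\<Sum>i<d. \<iota> (- inverse c * coeff p i) * x ^ i)" .
  have "x ^ n \<in> K.span ?S" for n
  proof (induction n rule: less_induct)
    case (less n)
    show ?case
    proof (cases "n < d")
      case True
      then show ?thesis
        by (intro K.span_base) auto
    next
      case False
      then have "x ^ n = x ^ (n - d) * x ^ d"
        by (simp flip: power_add)
      also have "\<dots> = (\<Sum>i<d. \<iota> (- inverse c * coeff p i) * x ^ (n - d + i))"
        unfolding xd by (simp add: sum_distrib_left power_add mult_ac)
      also have "\<dots> \<in> K.span ?S"
        using False by (intro K.span_sum K.span_scale less.IH) auto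
      finally show ?thesis .
    qed
  qed
  then show ?thesis
    by (intro that[of ?S]) auto
qed

lemma finite_span_imp_algebraic:
  assumes "finite S" and S: "\<And>n. x ^ n \<in> K.span S"
  shows "x \<in> algebraic_elements \<iota>"
proof -
  define N where "N = card S"
  have "\<exists>f. (\<exists>i\<le>N. f i \<noteq> 0) \<and> (\<Sum>i\<le>N. \<iota> (f i) * x ^ i) = 0"
  proof (cases "inj_on (\<lambda>i. x ^ i) {..N}")
    case True
    let ?B = "(\<lambda>i. x ^ i) ` {..N}"
    have "card ?B = Suc N"
      using card_image[OF True] by simp
    then have "K.dependent ?B"
      using K.independent_span_bound[OF assms(1), of ?B] S by (auto simp: N_def)
    then obtain u where u: "\<exists>v\<in>?B. u v \<noteq> 0" "(\<Sum>v\<in>?B. \<iota> (u v) * v) = 0"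
      by (subst (asm) K.dependent_finite) auto
    then show ?thesis
      using True by (intro exI[of _ "\<lambda>i. u (x ^ i)"]) (auto simp: sum.reindex)
  next
    case False
    then obtain i j where ij: "i \<le> N" "j \<le> N" "i \<noteq> j" "x ^ i = x ^ j"
      by (auto simp: inj_on_def)
    \<comment> \<open>A repeated power is itself a relation, namely
      \<open>x ^ i - x ^ j = 0\<close>.\<close>
    let ?f = "\<lambda>k. if k = i then 1 else if k = j then - 1 else 0 :: 'a fls"
    have "(\<Sum>k\<le>N. \<iota> (?f k) * x ^ k) = (\<Sum>k\<in>{i, j}. \<iota> (?f k) * x ^ k)"
      using ij by (intro sum.mono_neutral_right) auto
    also have "\<dots> = 0"
      using ij by (simp add: \<iota>_uminus)
    finally show ?thesis
      using ij by (intro exI[of _ ?f]) auto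
  qed
  then obtain f i where f: "i \<le> N" "f i \<noteq> 0" "(\<Sum>i\<le>N. \<iota> (f i) * x ^ i) = 0"
    by blast
  define p where "p = (\<Sum>i\<le>N. monom (f i) i)"
  have coeff_p: "coeff p i = (if i \<le> N then f i else 0)" for i
    by (simp add: p_def coeff_sum)
  have "p \<noteq> 0"
    using f(1,2) coeff_p[of i] by auto
  moreover have "poly (map_poly \<iota> p) x = 0"
    using f(3) by (subst poly_map_\<iota>_altdef[of _ N]) (auto simp: coeff_p degree_le)
  ultimately show ?thesis
    by (auto simp: algebraic_elements_def)
qed

lemma span_mult_span:
  assumes "x \<in> K.span S" "y \<in> K.span S'"
  shows "x * y \<in> K.span ((\<lambda>(a, b). a * b) ` (S \<times> S'))"
  using assms(1)
proof (induction rule: K.span_induct_alt)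
  case (step c a z)
  have "a * y \<in> K.span ((\<lambda>(a, b). a * b) ` (S \<times> S'))"
    using assms(2)
  proof (induction rule: K.span_induct_alt)
    case (step c' b w)
    have "a * b \<in> K.span ((\<lambda>(a, b). a * b) ` (S \<times> S'))"
      using \<open>a \<in> S\<close> step by (intro K.span_base) auto
    from K.span_add[OF K.span_scale[OF this, of c'] step.IH] show ?case
      by (simp add: algebra_simps)
  qed (simp add: K.span_zero)
  from K.span_add[OF K.span_scale[OF this, of c] step.IH] show ?case
    by (simp add: algebra_simps)
qed (simp add: K.span_zero)

lemma algebraic_\<iota>: "\<iota> a \<in> algebraic_elements \<iota>"
proof -
  have "poly (map_poly \<iota> [:- a, 1:]) (\<iota> a) = 0"
    by (simp add: map_poly_pCons \<iota>_uminus)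
  moreover have "[:- a, 1:] \<noteq> 0"
    by simp
  ultimately show ?thesis
    unfolding algebraic_elements_def by blast
qed

lemma algebraic_mult:
  assumes "x \<in> algebraic_elements \<iota>" "y \<in> algebraic_elements \<iota>"
  shows "x * y \<in> algebraic_elements \<iota>"
proof -
  obtain S S' where S: "finite S" "\<And>n. x ^ n \<in> K.span S" "finite S'" "\<And>n. y ^ n \<in> K.span S'"
    using assms algebraic_imp_finite_span by metis
  show ?thesis
    by (rule finite_span_imp_algebraic[of "(\<lambda>(a, b). a * b) ` (S \<times> S')"])
       (use S in \<open>auto simp: power_mult_distrib intro: span_mult_span\<close>)
qed

lemma algebraic_add:
  assumes "x \<in> algebraic_elements \<iota>" "y \<in> algebraic_elements \<iota>"
  shows "x + y \<in> algebraic_elements \<iota>"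
proof -
  obtain S S' where S: "finite S" "\<And>n. x ^ n \<in> K.span S" "finite S'" "\<And>n. y ^ n \<in> K.span S'"
    using assms algebraic_imp_finite_span by metis
  have "(x + y) ^ n \<in> K.span ((\<lambda>(a, b). a * b) ` (S \<times> S'))" for n
  proof -
    have "(x + y) ^ n = (\<Sum>k\<le>n. \<iota> (of_nat (n choose k)) * (x ^ k * y ^ (n - k)))"
      by (simp add: binomial_ring \<iota>_of_nat mult.assoc)
    also have "\<dots> \<in> K.span ((\<lambda>(a, b). a * b) ` (S \<times> S'))"
      using S by (intro K.span_sum K.span_scale span_mult_span)
    finally show ?thesis .
  qed
  then show ?thesis
    using S by (intro finite_span_imp_algebraic[of "(\<lambda>(a, b). a * b) ` (S \<times> S')"]) auto
qed

lemma algebraic_zero: "0 \<in> algebraic_elements \<iota>"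
  using algebraic_\<iota>[of 0] by simp

lemma algebraic_poly:
  "\<forall>i. coeff p i \<in> algebraic_elements \<iota> \<Longrightarrow> x \<in> algebraic_elements \<iota> \<Longrightarrow>
    poly p x \<in> algebraic_elements \<iota>"
proof (induction p)
  case (pCons a p)
  have "a \<in> algebraic_elements \<iota>" "\<forall>i. coeff p i \<in> algebraic_elements \<iota>"
    using pCons.prems(1) by (metis coeff_pCons_0, metis coeff_pCons_Suc)
  then show ?case
    using pCons by (auto intro: algebraic_add algebraic_mult)
qed (simp add: algebraic_zero)

lemma algebraic_synthetic_div:
  "\<forall>i. coeff p i \<in> algebraic_elements \<iota> \<Longrightarrow> x \<in> algebraic_elements \<iota> \<Longrightarrow>
    coeff (synthetic_div p x) i \<in> algebraic_elements \<iota>"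
proof (induction p arbitrary: i)
  case (pCons a p)
  have "a \<in> algebraic_elements \<iota>" "\<forall>i. coeff p i \<in> algebraic_elements \<iota>"
    using pCons.prems(1) by (metis coeff_pCons_0, metis coeff_pCons_Suc)
  then show ?case
    using pCons by (cases i) (auto intro: algebraic_poly)
qed (simp add: algebraic_zero)

lemma algebraic_root:
  assumes "\<forall>i. coeff p i \<in> algebraic_elements \<iota>" "degree p > 0"
  obtains x where "x \<in> algebraic_elements \<iota>" "poly p x = 0"
proof -
  have "set (coeffs p) \<subseteq> algebraic_elements \<iota>"
    using assms(1) by (auto simp: coeffs_def split: if_splits)
  then show ?thesis
    using algebraically_closed[OF _ assms(2)] that by blast
qed

text \<open>Algebraic closedness splits off one linear factor at a time, so properties of a
  polynomial can be followed through its roots.\<close>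

lemma algebraic_poly_induct [consumes 1, case_names const root]:
  assumes "\<forall>i. coeff p i \<in> algebraic_elements \<iota>"
    and const: "\<And>c. c \<in> algebraic_elements \<iota> \<Longrightarrow> P [:c:]"
    and root: "\<And>x p. x \<in> algebraic_elements \<iota> \<Longrightarrow> \<forall>i. coeff p i \<in> algebraic_elements \<iota> \<Longrightarrow>
      P p \<Longrightarrow> P ([:- x, 1:] * p)"
  shows "P p"
  using assms(1)
proof (induction "degree p" arbitrary: p)
  case 0
  then obtain c where "p = [:c:]"
    by (metis degree_eq_zeroE)
  then show ?case
    using const 0(2) by (metis coeff_pCons_0)
next
  case (Suc n)
  then obtain x where x: "x \<in> algebraic_elements \<iota>" "poly p x = 0"
    using algebraic_root by (metis zero_less_Suc)
  have "p = [:- x, 1:] * synthetic_div p x"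
    using synthetic_div_correct'[of x p] x(2) by simp
  moreover have "P (synthetic_div p x)"
    using Suc algebraic_synthetic_div[OF _ x(1)] by (intro Suc.hyps(1)) (auto simp: degree_synthetic_div)
  ultimately show ?case
    using root[OF x(1)] algebraic_synthetic_div[OF Suc.prems x(1)] by metis
qed

text \<open>Factors \<open>x\<close> are stripped from an annihilating polynomial until its constant
  term is nonzero; solving for that term yields the inverse. This is why rings of algebraic elements
  are fields.\<close>

lemma algebraic_inverse_poly:
  assumes "x \<in> algebraic_elements \<iota>" "x \<noteq> 0"
  obtains p where "poly (map_poly \<iota> p) x * x = 1"
proof -
  have "\<exists>a p. a \<noteq> 0 \<and> \<iota> a + x * poly (map_poly \<iota> p) x = 0"
    if "p \<noteq> 0" "poly (map_poly \<iota> p) x = 0" for p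
    using that
  proof (induction p)
    case (pCons a p)
    show ?case
    proof (cases "a = 0")
      case True
      then show ?thesis
        using pCons assms(2) by (auto simp: poly_map_\<iota>_pCons)
    next
      case False
      then show ?thesis
        using pCons.prems by (auto simp: poly_map_\<iota>_pCons)
    qed
  qed simp
  moreover obtain p where "p \<noteq> 0" "poly (map_poly \<iota> p) x = 0"
    using assms(1) by (auto simp: algebraic_elements_def)
  ultimately obtain a p where ap: "a \<noteq> 0" "\<iota> a + x * poly (map_poly \<iota> p) x = 0"
    by metis
  have "poly (map_poly \<iota> (smult (- inverse a) p)) x * x =
      \<iota> (- inverse a) * (x * poly (map_poly \<iota> p) x)"
    by (simp only: poly_map_\<iota>_smult mult_ac)
  also have "x * poly (map_poly \<iota> p) x = - \<iota> a"
    using ap(2) by (simp add: add_eq_0_iff)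
  also have "\<iota> (- inverse a) * - \<iota> a = 1"
    using ap(1) by (simp add: \<iota>_uminus \<iota>_inverse)
  finally show ?thesis
    by (rule that)
qed

section \<open>Extension of homomorphisms\<close>

text \<open>
  Homomorphisms of \<open>K\<^sub>\<infinity>\<close>-algebras from rings of algebraic elements to \<open>C\<close>, given by their graphs;
  the domain of such a homomorphism is automatically a field.
\<close>

definition hom_graph :: "('c \<times> 'c) set \<Rightarrow> bool" where
  "hom_graph G \<longleftrightarrow> fst ` G \<subseteq> algebraic_elements \<iota> \<and> (\<forall>a. (\<iota> a, \<iota> a) \<in> G) \<and>
    (\<forall>u v u' v'. (u, v) \<in> G \<longrightarrow> (u', v') \<in> G \<longrightarrow> (u + u', v + v') \<in> G \<and> (u * u', v * v') \<in> G) \<and>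
    (\<forall>v. (0, v) \<in> G \<longrightarrow> v = 0)"

lemma hom_graph_algebraic: "hom_graph G \<Longrightarrow> (u, v) \<in> G \<Longrightarrow> u \<in> algebraic_elements \<iota>"
  by (auto simp: hom_graph_def)

lemma hom_graph_\<iota>: "hom_graph G \<Longrightarrow> (\<iota> a, \<iota> a) \<in> G"
  by (auto simp: hom_graph_def)

lemma hom_graph_0: "hom_graph G \<Longrightarrow> (0, 0) \<in> G"
  using hom_graph_\<iota>[of G 0] by simp

lemma hom_graph_1: "hom_graph G \<Longrightarrow> (1, 1) \<in> G"
  using hom_graph_\<iota>[of G 1] by simp

lemma hom_graph_add: "hom_graph G \<Longrightarrow> (u, v) \<in> G \<Longrightarrow> (u', v') \<in> G \<Longrightarrow> (u + u', v + v') \<in> G"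
  by (auto simp: hom_graph_def)

lemma hom_graph_mult: "hom_graph G \<Longrightarrow> (u, v) \<in> G \<Longrightarrow> (u', v') \<in> G \<Longrightarrow> (u * u', v * v') \<in> G"
  by (auto simp: hom_graph_def)

lemma hom_graph_uminus: "hom_graph G \<Longrightarrow> (u, v) \<in> G \<Longrightarrow> (- u, - v) \<in> G"
  using hom_graph_mult[OF _ hom_graph_\<iota>[of G "- 1"]] by (fastforce simp: \<iota>_uminus)

lemma hom_graph_diff: "hom_graph G \<Longrightarrow> (u, v) \<in> G \<Longrightarrow> (u', v') \<in> G \<Longrightarrow> (u - u', v - v') \<in> G"
  using hom_graph_add[OF _ _ hom_graph_uminus] by fastforce

lemma hom_graph_sum:
  "hom_graph G \<Longrightarrow> (\<And>i. i \<in> S \<Longrightarrow> (f i, g i) \<in> G) \<Longrightarrow> (sum f S, sum g S) \<in> G"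
  by (induction S rule: infinite_finite_induct) (auto intro: hom_graph_0 hom_graph_add)

lemma hom_graph_poly_\<iota>:
  "hom_graph G \<Longrightarrow> (u, v) \<in> G \<Longrightarrow> (poly (map_poly \<iota> p) u, poly (map_poly \<iota> p) v) \<in> G"
  by (induction p)
     (auto simp: poly_map_\<iota>_pCons intro: hom_graph_0 hom_graph_add hom_graph_mult hom_graph_\<iota>)

lemma hom_graph_eq_0: "hom_graph G \<Longrightarrow> (0, v) \<in> G \<Longrightarrow> v = 0"
  by (auto simp: hom_graph_def)

lemma hom_graph_unique: "hom_graph G \<Longrightarrow> (u, v) \<in> G \<Longrightarrow> (u, v') \<in> G \<Longrightarrow> v = v'"
  using hom_graph_diff[of G u v u v'] hom_graph_eq_0[of G "v - v'"] by simp

lemma hom_graph_inverse: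
  assumes "hom_graph G" "(u, v) \<in> G" "u \<noteq> 0"
  obtains w where "(inverse u, w) \<in> G"
proof -
  obtain p where p: "poly (map_poly \<iota> p) u * u = 1"
    using algebraic_inverse_poly[OF hom_graph_algebraic[OF assms(1,2)] assms(3)] by blast
  then have "poly (map_poly \<iota> p) u = inverse u"
    using assms(3) by (simp add: field_simps)
  then show ?thesis
    using hom_graph_poly_\<iota>[OF assms(1,2), of p] that by metis
qed

lemma hom_graph_eq_0': 
  assumes "hom_graph G" "(u, 0) \<in> G"
  shows "u = 0"
proof (rule ccontr)
  assume u: "u \<noteq> 0"
  then obtain w where "(inverse u, w) \<in> G"
    using hom_graph_inverse[OF assms] by blast
  then have "(1, 0) \<in> G"
    using hom_graph_mult[OF assms(1) assms(2), of "inverse u" w] u by simp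
  then show False
    using hom_graph_unique[OF assms(1) hom_graph_1] assms(1) by force
qed

lemma hom_graph_range_algebraic:
  assumes "hom_graph G" "(u, v) \<in> G"
  shows "v \<in> algebraic_elements \<iota>"
proof -
  obtain p where p: "p \<noteq> 0" "poly (map_poly \<iota> p) u = 0"
    using hom_graph_algebraic[OF assms] by (auto simp: algebraic_elements_def)
  then have "poly (map_poly \<iota> p) v = 0"
    using hom_graph_poly_\<iota>[OF assms, of p] hom_graph_eq_0[OF assms(1)] by simp
  with p(1) show ?thesis
    by (auto simp: algebraic_elements_def)
qed

text \<open>A pair stands for a polynomial over the domain of \<open>G\<close> and its image under
  the homomorphism, so that one can stay with graphs.\<close>

definition poly_graph :: "('c \<times> 'c) set \<Rightarrow> 'c poly \<Rightarrow> 'c poly \<Rightarrow> bool" where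
  "poly_graph G p p' \<longleftrightarrow> (\<forall>i. (coeff p i, coeff p' i) \<in> G)"

lemma poly_graph_add:
  "hom_graph G \<Longrightarrow> poly_graph G p p' \<Longrightarrow> poly_graph G q q' \<Longrightarrow> poly_graph G (p + q) (p' + q')"
  by (auto simp: poly_graph_def intro: hom_graph_add)

lemma poly_graph_diff:
  "hom_graph G \<Longrightarrow> poly_graph G p p' \<Longrightarrow> poly_graph G q q' \<Longrightarrow> poly_graph G (p - q) (p' - q')"
  by (auto simp: poly_graph_def intro: hom_graph_diff)

lemma poly_graph_mult:
  "hom_graph G \<Longrightarrow> poly_graph G p p' \<Longrightarrow> poly_graph G q q' \<Longrightarrow> poly_graph G (p * q) (p' * q')"
  by (auto simp: poly_graph_def coeff_mult intro!: hom_graph_sum hom_graph_mult)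

lemma poly_graph_monom:
  "hom_graph G \<Longrightarrow> (c, c') \<in> G \<Longrightarrow> poly_graph G (monom c n) (monom c' n)"
  by (auto simp: poly_graph_def intro: hom_graph_0)

lemma poly_graph_const: "hom_graph G \<Longrightarrow> (c, c') \<in> G \<Longrightarrow> poly_graph G [:c:] [:c':]"
  using poly_graph_monom[of G c c' 0] by (simp add: monom_0)

lemma poly_graph_map_\<iota>: "hom_graph G \<Longrightarrow> poly_graph G (map_poly \<iota> p) (map_poly \<iota> p)"
  by (auto simp: poly_graph_def coeff_map_poly intro: hom_graph_\<iota>)

lemma poly_graph_degree:
  assumes "hom_graph G" "poly_graph G p p'"
  shows "degree p' = degree p"
proof -
  have "coeff p' i = 0 \<longleftrightarrow> coeff p i = 0" for i
    using assms by (metis hom_graph_eq_0 hom_graph_eq_0' poly_graph_def)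
  then show ?thesis
    by (simp add: degree_def)
qed

text \<open>Up to a scalar, \<open>m\<close> is the minimal polynomial of \<open>x\<close> over the
  domain of \<open>G\<close>, and \<open>m'\<close> is its conjugate.\<close>

lemma minimal_poly_exists:
  assumes "hom_graph G" "x \<in> algebraic_elements \<iota>"
  obtains m m' where "poly_graph G m m'" "m \<noteq> 0" "poly m x = 0"
    "\<And>p p'. poly_graph G p p' \<Longrightarrow> p \<noteq> 0 \<Longrightarrow> poly p x = 0 \<Longrightarrow>
      degree m \<le> degree p"
proof -
  let ?P = "\<lambda>(p, p'). poly_graph G p p' \<and> p \<noteq> 0 \<and> poly p x = 0"
  obtain p where p: "p \<noteq> 0" "poly (map_poly \<iota> p) x = 0"
    using assms(2) by (auto simp: algebraic_elements_def)
  then have "map_poly \<iota> p \<noteq> 0"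
    by (metis \<iota>_eq_0_iff leading_coeff_0_iff coeff_0 coeff_map_poly \<iota>_zero)
  then have "?P (map_poly \<iota> p, map_poly \<iota> p)"
    using p poly_graph_map_\<iota>[OF assms(1)] by simp
  from ex_has_least_nat[of ?P, OF this, of "\<lambda>(p, p'). degree p"]
  show ?thesis
    using that by (auto simp: split_beta)
qed

text \<open>
  A pair of polynomials of minimal degree divides every other pair with the root \<open>x\<close>: subtract
  multiples of it to lower the degree.
\<close>

lemma minimal_poly_root:
  assumes G: "hom_graph G" and m: "poly_graph G m m'" "m \<noteq> 0" "poly m x = 0"
    and min: "\<And>p p'. poly_graph G p p' \<Longrightarrow> p \<noteq> 0 \<Longrightarrow> poly p x = 0 \<Longrightarrow>
      degree m \<le> degree p"
    and y: "poly m' y = 0"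
    and p: "poly_graph G p p'" "poly p x = 0"
  shows "poly p' y = 0"
  using p
proof (induction "degree p" arbitrary: p p' rule: less_induct)
  case less
  show ?case
  proof (cases "p = 0")
    case True
    then have "p' = 0"
      using less.prems(1) hom_graph_eq_0[OF G] by (auto simp: poly_graph_def poly_eq_iff)
    then show ?thesis
      by simp
  next
    case False
    have "degree m \<noteq> 0"
      using m(2,3) by (metis degree_eq_zeroE pCons_0_0 poly_const_conv poly_pCons mult_zero_right add.right_neutral poly_0)
    define k where "k = degree p - degree m"
    define l where "l = coeff m (degree m)"
    have le: "degree m \<le> degree p"
      using min[OF less.prems(1) False less.prems(2)] .
    have l: "l \<noteq> 0" "(l, coeff m' (degree m)) \<in> G"
      using m by (auto simp: l_def poly_graph_def)
    obtain w where w: "(inverse l, w) \<in> G"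
      using hom_graph_inverse[OF G l(2,1)] by blast
    define c where "c = coeff p (degree p) * inverse l"
    define c' where "c' = coeff p' (degree p) * w"
    have c: "(c, c') \<in> G"
      using less.prems(1) w by (auto simp: c_def c'_def poly_graph_def intro: hom_graph_mult[OF G])
    have c0: "c \<noteq> 0"
      using False l by (simp add: c_def)
    define r where "r = p - monom c k * m"
    define r' where "r' = p' - monom c' k * m'"
    have r: "poly_graph G r r'"
      unfolding r_def r'_def
      by (intro poly_graph_diff poly_graph_mult poly_graph_monom G c m less.prems)
    have root: "poly r x = 0"
      using m(3) less.prems(2) by (simp add: r_def)
    have deg: "degree (monom c k * m) = degree p"
      using c0 m(2) le by (simp add: degree_mult_eq degree_monom_eq k_def)
    have "coeff (monom c k * m) (degree p) = c * l"
      using le by (simp add: coeff_monom_mult k_def l_def)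
    then have coeff: "coeff r (degree p) = 0"
      using l(1) by (simp add: r_def c_def)
    have "degree r < degree p"
    proof -
      have "degree r \<le> degree p"
        unfolding r_def by (intro degree_diff_le) (simp_all add: deg)
      moreover have "degree p > 0"
        using \<open>degree m \<noteq> 0\<close> le by simp
      ultimately show ?thesis
        using coeff by (metis degree_0 leading_coeff_0_iff le_neq_implies_less)
    qed
    from less.hyps[OF this r root] show ?thesis
      using y by (simp add: r'_def)
  qed
qed

text \<open>The extended graph evaluates pairs of polynomials at \<open>x\<close> and
  \<open>y\<close>; the hypothesis on roots is exactly what makes this single-valued.\<close>

lemma hom_graph_extend:
  assumes G: "hom_graph G" and x: "x \<in> algebraic_elements \<iota>"
    and xy: "\<And>p p'. poly_graph G p p' \<Longrightarrow> poly p x = 0 \<Longrightarrow> poly p' y = 0"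
  obtains G' where "hom_graph G'" "G \<subseteq> G'" "(x, y) \<in> G'"
proof -
  define G' where "G' = {(poly p x, poly p' y) | p p'. poly_graph G p p'}"
  have G'I: "(poly p x, poly p' y) \<in> G'" if "poly_graph G p p'" for p p'
    using that unfolding G'_def by blast
  have G'E: "\<exists>p p'. poly_graph G p p' \<and> u = poly p x \<and> v = poly p' y" if "(u, v) \<in> G'" for u v
    using that unfolding G'_def by blast
  have const: "(u, v) \<in> G'" if "(u, v) \<in> G" for u v
    using G'I[OF poly_graph_const[OF G that]] by simp
  have "hom_graph G'"
    unfolding hom_graph_def
  proof (intro conjI allI impI)
    show "fst ` G' \<subseteq> algebraic_elements \<iota>"
    proof
      fix u assume "u \<in> fst ` G'"
      then obtain p p' where p: "poly_graph G p p'" "u = poly p x"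
        using G'E by fastforce
      have "\<forall>i. coeff p i \<in> algebraic_elements \<iota>"
        using p(1) hom_graph_algebraic[OF G] unfolding poly_graph_def by blast
      then show "u \<in> algebraic_elements \<iota>"
        using algebraic_poly x p(2) by blast
    qed
    show "(\<iota> a, \<iota> a) \<in> G'" for a
      using const hom_graph_\<iota>[OF G] by blast
    show "v = 0" if "(0, v) \<in> G'" for v
      using G'E[OF that] xy by metis
    fix u v u' v' assume "(u, v) \<in> G'" "(u', v') \<in> G'"
    then obtain p p' q q' where *: "poly_graph G p p'" "poly_graph G q q'"
      "u = poly p x" "v = poly p' y" "u' = poly q x" "v' = poly q' y"
      using G'E by meson
    show "(u + u', v + v') \<in> G'"
      using G'I[OF poly_graph_add[OF G *(1,2)]] *(3-) by simp
    show "(u * u', v * v') \<in> G'"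
      using G'I[OF poly_graph_mult[OF G *(1,2)]] *(3-) by simp
  qed
  moreover have "G \<subseteq> G'"
    using const by auto
  moreover have "(x, y) \<in> G'"
    using G'I[OF poly_graph_monom[OF G hom_graph_1[OF G], of 1]] by (simp add: poly_monom)
  ultimately show ?thesis
    using that by blast
qed

text \<open>A maximal extension has full domain: any missing \<open>x\<close> could be sent to a
  root of the conjugate of its minimal polynomial.\<close>

lemma hom_graph_total:
  assumes "hom_graph G"
  obtains M where "hom_graph M" "G \<subseteq> M" "fst ` M = algebraic_elements \<iota>"
proof -
  define H where "H = {M. hom_graph M \<and> G \<subseteq> M}"
  have "\<exists>M\<in>H. \<forall>N\<in>H. M \<subseteq> N \<longrightarrow> N = M"
  proof (rule subset_Zorn_nonempty)
    show "H \<noteq> {}"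
      using assms by (auto simp: H_def)
    fix \<C> assume ne: "\<C> \<noteq> {}" and "subset.chain H \<C>"
    then have A: "\<And>N. N \<in> \<C> \<Longrightarrow> hom_graph N \<and> G \<subseteq> N"
      and chain: "\<And>N Z. N \<in> \<C> \<Longrightarrow> Z \<in> \<C> \<Longrightarrow> N \<subseteq> Z \<or> Z \<subseteq> N"
      by (auto simp: subset_chain_def H_def)
    have "hom_graph (\<Union>\<C>)"
      unfolding hom_graph_def
    proof (intro conjI allI impI)
      show "fst ` \<Union>\<C> \<subseteq> algebraic_elements \<iota>"
        using A hom_graph_algebraic by fastforce
      show "(\<iota> a, \<iota> a) \<in> \<Union>\<C>" for a
        using A ne hom_graph_\<iota> by blast
      show "v = 0" if "(0, v) \<in> \<Union>\<C>" for v
        using that A hom_graph_eq_0 by blast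
      fix u v u' v' assume "(u, v) \<in> \<Union>\<C>" "(u', v') \<in> \<Union>\<C>"
      then obtain N where N: "N \<in> \<C>" "(u, v) \<in> N" "(u', v') \<in> N"
        using chain by blast
      show "(u + u', v + v') \<in> \<Union>\<C>"
        using hom_graph_add[of N u v u' v'] A N by blast
      show "(u * u', v * v') \<in> \<Union>\<C>"
        using hom_graph_mult[of N u v u' v'] A N by blast
    qed
    then show "\<Union>\<C> \<in> H"
      using A ne by (auto simp: H_def)
  qed
  then obtain M where M: "hom_graph M" "G \<subseteq> M"
    and max: "\<And>N. hom_graph N \<Longrightarrow> M \<subseteq> N \<Longrightarrow> N = M"
    unfolding H_def by (smt (verit) mem_Collect_eq order_trans)
  have "x \<in> fst ` M" if x: "x \<in> algebraic_elements \<iota>" for x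
  proof -
    obtain m m' where m: "poly_graph M m m'" "m \<noteq> 0" "poly m x = 0"
      and min: "\<And>p p'. poly_graph M p p' \<Longrightarrow> p \<noteq> 0 \<Longrightarrow> poly p x = 0 \<Longrightarrow>
        degree m \<le> degree p"
      using minimal_poly_exists[OF M(1) x] by blast
    have "degree m \<noteq> 0"
      using m(2,3) by (metis degree_eq_zeroE pCons_0_0 poly_const_conv poly_pCons mult_zero_right add.right_neutral poly_0)
    then have "degree m' > 0"
      using poly_graph_degree[OF M(1) m(1)] by simp
    moreover have "\<forall>i. coeff m' i \<in> algebraic_elements \<iota>"
      using m(1) hom_graph_range_algebraic[OF M(1)] by (auto simp: poly_graph_def)
    \<comment> \<open>Images satisfy the same relations over \<open>K\<^sub>\<infinity>\<close> and
      are thus algebraic; hence \<open>m'\<close> has a root.\<close>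
    ultimately obtain y where y: "poly m' y = 0"
      using algebraic_root by blast
    have root: "poly p' y = 0" if "poly_graph M p p'" "poly p x = 0" for p p'
      by (rule minimal_poly_root[OF M(1) m _ y that]) (rule min)
    obtain G' where "hom_graph G'" "M \<subseteq> G'" "(x, y) \<in> G'"
      by (rule hom_graph_extend[OF M(1) x, of y]) (use root in blast)+
    then show ?thesis
      using max by force
  qed
  then have "fst ` M = algebraic_elements \<iota>"
    using hom_graph_algebraic[OF M(1)] by auto
  with M show ?thesis
    using that by blast
qed

end

section \<open>Finite fields and residues\<close>

text \<open>Fermat's argument: multiplication by \<open>x\<close> permutes the nonzero elements of
  \<open>S\<close> and leaves their product unchanged.\<close>

lemma power_card_eq_same:
  fixes S :: "'b::field set"
  assumes "finite S" "0 \<in> S" and mult: "\<And>x y. x \<in> S \<Longrightarrow> y \<in> S \<Longrightarrow> x * y \<in> S" and x: "x \<in> S"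
  shows "x ^ card S = x"
proof (cases "x = 0")
  case True
  have "card S > 0"
    using assms by (auto simp: card_gt_0_iff)
  with True show ?thesis
    by simp
next
  case False
  let ?T = "S - {0}"
  have inj: "inj_on ((*) x) ?T"
    using False by (auto intro!: inj_onI)
  have "(*) x ` ?T = ?T"
    by (rule endo_inj_surj[OF _ _ inj]) (use assms False in auto)
  then have "\<Prod>?T = (\<Prod>y\<in>?T. x * y)"
    using prod.reindex[OF inj, of "\<lambda>y. y"] by simp
  also have "\<dots> = x ^ card ?T * \<Prod>?T"
    by (simp add: prod.distrib)
  finally have "x ^ card ?T = 1"
    using assms(1) by (simp add: prod_zero_iff)
  moreover have "card S = Suc (card ?T)"
    using card_Suc_Diff1[OF assms(1,2)] by simp
  ultimately show ?thesis
    by simp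
qed

text \<open>Adjoining one element to a subgroup of an elementary abelian \<open>p\<close>-group multiplies its order by \<open>p\<close>.\<close>

lemma card_additive_subgroup:
  fixes S :: "'b::comm_ring_1 set"
  assumes p: "prime CHAR('b)" and "finite S" "0 \<in> S"
    and add: "\<And>x y. x \<in> S \<Longrightarrow> y \<in> S \<Longrightarrow> x + y \<in> S"
  shows "\<exists>n. card S = CHAR('b) ^ n"
proof -
  let ?p = "CHAR('b)"
  define subgp where "subgp = (\<lambda>H :: 'b set. 0 \<in> H \<and> (\<forall>x\<in>H. \<forall>y\<in>H. x + y \<in> H))"
  have subgp_add: "x + y \<in> H" if "subgp H" "x \<in> H" "y \<in> H" for H x y
    using that by (simp add: subgp_def)
  have multiple: "of_nat k * x \<in> H" if "subgp H" "x \<in> H" for H x k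
    using that by (induction k) (auto simp: subgp_def algebra_simps)
  \<comment> \<open>In characteristic p the negative is the (p-1)-fold multiple, so closure under
    addition suffices for a subgroup.\<close>
  have uminus: "- x \<in> H" if "subgp H" "x \<in> H" for H x
  proof -
    have "?p = Suc (?p - 1)"
      using p prime_gt_0_nat by simp
    then have "of_nat (Suc (?p - 1)) * x = 0"
      by (metis of_nat_CHAR mult_zero_left)
    then have "of_nat (?p - 1) * x = - x"
      by (simp add: algebra_simps eq_neg_iff_add_eq_0)
    then show ?thesis
      using multiple[OF that, of "?p - 1"] by simp
  qed
  let ?P = "\<lambda>H. H \<subseteq> S \<and> subgp H \<and> (\<exists>n. card H = ?p ^ n)"
  have P0: "?P {0}"
    using assms(3) by (auto simp: subgp_def intro: exI[of _ 0])
  have bound: "card H < Suc (card S)" if "?P H" for H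
    using that card_mono[OF assms(2)] by (simp add: le_imp_less_Suc)
  obtain H where H: "?P H" and max: "\<And>H'. ?P H' \<Longrightarrow> card H' \<le> card H"
    using ex_has_greatest_nat[of ?P, OF P0, of card "Suc (card S)"] bound less_imp_le by metis
  then obtain n where n: "H \<subseteq> S" "subgp H" "card H = ?p ^ n"
    by blast
  have "S \<subseteq> H"
  proof (rule ccontr)
    assume "\<not> S \<subseteq> H"
    then obtain x where x: "x \<in> S" "x \<notin> H"
      by blast
    have S: "subgp S"
      using assms by (auto simp: subgp_def)
    define f where "f = (\<lambda>(h, k). h + of_nat k * x)"
    have *: "False" if "h \<in> H" "h' \<in> H" "k < k'" "k' < ?p" "f (h, k) = f (h', k')" for h h' k k'
    proof -
      have "of_nat (k' - k) * x = h + - h'"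
        using that(3,5) by (simp add: f_def of_nat_diff algebra_simps)
      then have d: "of_nat (k' - k) * x \<in> H"
        by (simp only:) (rule subgp_add[OF n(2) that(1) uminus[OF n(2) that(2)]])
      \<comment> \<open>The multiple of \<open>x\<close> by \<open>k' - k\<close> lies in
        \<open>H\<close>; inverting \<open>k' - k\<close> modulo the characteristic would put
        \<open>x\<close> itself into \<open>H\<close>.\<close>
      have "coprime (k' - k) ?p"
      proof -
        have "\<not> ?p dvd k' - k"
          using that(3,4) by (intro nat_dvd_not_less) auto
        then show ?thesis
          using prime_imp_coprime[OF p] coprime_commute by blast
      qed
      then obtain l where "[(k' - k) * l = 1] (mod ?p)"
        using cong_solve_coprime_nat by auto
      then have "of_nat ((k' - k) * l) = (of_nat 1 :: 'b)"
        unfolding of_nat_eq_iff_cong_CHAR .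
      then have "of_nat l * of_nat (k' - k) = (1 :: 'b)"
        by (simp only: of_nat_mult of_nat_1 mult.commute)
      then have "x = of_nat l * (of_nat (k' - k) * x)"
        by (simp only: mult_1 flip: mult.assoc)
      then show False
        using multiple[OF n(2) d, of l] x(2) by simp
    qed
    have inj: "inj_on f (H \<times> {..<?p})"
    proof (rule inj_onI, clarify)
      fix h k h' k' assume h: "h \<in> H" "k < ?p" "h' \<in> H" "k' < ?p" "f (h, k) = f (h', k')"
      then have "k = k'"
        using *[of h h' k k'] *[of h' h k' k] by (metis linorder_neqE_nat)
      then show "h = h' \<and> k = k'"
        using h(5) by (simp add: f_def)
    qed
    let ?H' = "f ` (H \<times> {..<?p})"
    have "f (h, k) \<in> S" if "h \<in> H" for h k
      using that n(1) multiple[OF S x(1)] add by (auto simp: f_def)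
    moreover have "subgp ?H'"
      unfolding subgp_def
    proof (intro conjI ballI)
      show "0 \<in> ?H'"
        using n(2) p prime_gt_0_nat by (intro image_eqI[of _ _ "(0, 0)"]) (auto simp: f_def subgp_def)
      fix y y' assume "y \<in> ?H'" "y' \<in> ?H'"
      then obtain h k h' k' where y: "y = f (h, k)" "y' = f (h', k')" "h \<in> H" "h' \<in> H"
        by auto
      have "(of_nat (k + k') :: 'b) = of_nat ((k + k') mod ?p)"
        unfolding of_nat_eq_iff_cong_CHAR by (simp add: cong_def)
      then have "y + y' = f (h + h', (k + k') mod ?p)"
        unfolding y f_def by (simp add: algebra_simps flip: distrib_left)
      moreover have "h + h' \<in> H"
        using y n(2) by (simp add: subgp_def)
      ultimately show "y + y' \<in> ?H'"
        using p prime_gt_0_nat by (intro image_eqI[of _ _ "(h + h', (k + k') mod ?p)"]) auto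
    qed
    moreover have card: "card ?H' = ?p ^ Suc n"
      using card_image[OF inj] by (simp add: n(3) card_cartesian_product)
    ultimately have "card ?H' \<le> card H"
      by (intro max) (auto intro: exI[of _ "Suc n"])
    moreover have "card H < card ?H'"
      using prime_gt_1_nat[OF p] unfolding card n(3) by simp
    ultimately show False
      by simp
  qed
  then show ?thesis
    using n by auto
qed

lemma finite_polys_degree_le:
  "finite {p :: 'b::{zero,finite} poly. degree p \<le> n}"
proof (rule finite_subset)
  show "{p :: 'b poly. degree p \<le> n} \<subseteq> Poly ` {xs. set xs \<subseteq> UNIV \<and> length xs \<le> Suc n}"
  proof
    fix p :: "'b poly" assume "p \<in> {p. degree p \<le> n}"
    then have "length (coeffs p) \<le> Suc n"
      by (cases "p = 0") (simp_all add: length_coeffs_degree)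
    then show "p \<in> Poly ` {xs. set xs \<subseteq> UNIV \<and> length xs \<le> Suc n}"
      by (intro image_eqI[of _ _ "coeffs p"]) auto
  qed
  have "finite {xs :: 'b list. set xs \<subseteq> UNIV \<and> length xs \<le> Suc n}"
    by (rule finite_lists_length_le) simp
  then show "finite (Poly ` {xs :: 'b list. set xs \<subseteq> UNIV \<and> length xs \<le> Suc n})"
    by (rule finite_imageI)
qed

context completed_algebraic_closure
begin

lemma card_a_CHAR_power: "\<exists>e. CARD('a) = CHAR('c) ^ e"
  using card_additive_subgroup[OF prime_CHAR_a, of UNIV] by (simp add: CHAR_c)

lemma CHAR_power_card_power:
  obtains e where "CARD('a) ^ n = CHAR('c) ^ e"
  using card_a_CHAR_power by (metis power_mult)

lemma frobenius_add: "((x::'c) + y) ^ (CARD('a) ^ n) = x ^ (CARD('a) ^ n) + y ^ (CARD('a) ^ n)"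
  using CHAR_power_card_power[of n] freshmans_dream'[OF prime_CHAR_c] by metis

lemma frobenius_diff: "((x::'c) - y) ^ (CARD('a) ^ n) = x ^ (CARD('a) ^ n) - y ^ (CARD('a) ^ n)"
  using frobenius_add[of "x - y" y n] by simp

lemma frobenius_inj: "(x::'c) ^ (CARD('a) ^ n) = y ^ (CARD('a) ^ n) \<Longrightarrow> x = y"
  using frobenius_diff[of x y n] by simp

section \<open>The algebraic closure of F inside \<open>C\<close> as a system of residue
  representatives\<close>

definition \<kappa> :: "'a \<Rightarrow> 'c" where
  "\<kappa> c = \<iota> (fls_const c)"

lemma \<kappa>_0 [simp]: "\<kappa> 0 = 0"
  by (simp add: \<kappa>_def)

lemma \<kappa>_1 [simp]: "\<kappa> 1 = 1"
  by (simp add: \<kappa>_def)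

lemma \<kappa>_add: "\<kappa> (a + b) = \<kappa> a + \<kappa> b"
  by (simp add: \<kappa>_def fls_plus_const flip: \<iota>_add)

lemma \<kappa>_mult: "\<kappa> (a * b) = \<kappa> a * \<kappa> b"
  by (simp add: \<kappa>_def fls_const_mult_const flip: \<iota>_mult)

lemma \<kappa>_eq_0_iff [simp]: "\<kappa> a = 0 \<longleftrightarrow> a = 0"
  by (simp add: \<kappa>_def)

lemma absv_\<kappa>: "a \<noteq> 0 \<Longrightarrow> absv (\<kappa> a) = 1"
  by (simp add: \<kappa>_def absv_const)

lemma absv_\<kappa>_le: "absv (\<kappa> a) \<le> 1"
  by (simp add: \<kappa>_def absv_const_le)

text \<open>The algebraic closure of F in \<open>C\<close>, written as the union of the fields with
  \<open>q^n\<close> elements; closure under addition is then just additivity of Frobenius.\<close>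

definition Fbar :: "'c set" where
  "Fbar = {z. \<exists>n\<ge>1. z ^ (CARD('a) ^ n) = z}"

lemma power_iterate_fixed:
  fixes z :: "'c"
  shows "z ^ (N ^ n) = z \<Longrightarrow> z ^ (N ^ (n * k)) = z"
  by (induction k) (simp_all add: power_add power_mult)

lemma Fbar_common:
  assumes "z \<in> Fbar" "w \<in> Fbar"
  obtains n where "n \<ge> 1" "z ^ (CARD('a) ^ n) = z" "w ^ (CARD('a) ^ n) = w"
proof -
  obtain n m where nm: "n \<ge> 1" "z ^ (CARD('a) ^ n) = z" "m \<ge> 1" "w ^ (CARD('a) ^ m) = w"
    using assms by (auto simp: Fbar_def)
  show ?thesis
  proof (rule that)
    show "n * m \<ge> 1"
      using nm by simp
    show "z ^ (CARD('a) ^ (n * m)) = z"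
      using power_iterate_fixed nm(2) by blast
    show "w ^ (CARD('a) ^ (n * m)) = w"
      using power_iterate_fixed[OF nm(4), of n] by (simp add: mult.commute)
  qed
qed

lemma Fbar_add: "z \<in> Fbar \<Longrightarrow> w \<in> Fbar \<Longrightarrow> z + w \<in> Fbar"
  by (rule Fbar_common[of z w]) (auto simp: Fbar_def frobenius_add)

lemma Fbar_diff: "z \<in> Fbar \<Longrightarrow> w \<in> Fbar \<Longrightarrow> z - w \<in> Fbar"
  by (rule Fbar_common[of z w]) (auto simp: Fbar_def frobenius_diff)

lemma Fbar_mult: "z \<in> Fbar \<Longrightarrow> w \<in> Fbar \<Longrightarrow> z * w \<in> Fbar"
  by (rule Fbar_common[of z w]) (auto simp: Fbar_def power_mult_distrib)

lemma Fbar_0: "0 \<in> Fbar"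
  by (auto simp: Fbar_def intro!: exI[of _ 1])

lemma Fbar_1: "1 \<in> Fbar"
  by (auto simp: Fbar_def)

lemma Fbar_power: "z \<in> Fbar \<Longrightarrow> z ^ n \<in> Fbar"
  by (induction n) (auto intro: Fbar_1 Fbar_mult)

lemma absv_Fbar:
  assumes "z \<in> Fbar" "z \<noteq> 0"
  shows "absv z = 1"
proof -
  obtain n where n: "n \<ge> 1" "z ^ (CARD('a) ^ n) = z"
    using assms by (auto simp: Fbar_def)
  have "CARD('a) ^ n > 1"
    using n(1) card_a_ge2 by (intro one_less_power) auto
  then obtain k where k: "CARD('a) ^ n = Suc k" "k > 0"
    by (metis One_nat_def Suc_lessE zero_less_Suc)
  then have "absv z ^ k = 1"
    using n(2) assms(2) by (simp flip: absv_power)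
  then show ?thesis
    using k(2) power_eq_iff_eq_base[of k "absv z" 1] by simp
qed

lemma absv_Fbar_le: "z \<in> Fbar \<Longrightarrow> absv z \<le> 1"
  using absv_Fbar[of z] by (cases "z = 0") auto

text \<open>Differences stay in \<open>Fbar\<close>, where nonzero elements are roots of unity of
  absolute value 1. So a residue class has at most one representative.\<close>

lemma Fbar_eqI: "z \<in> Fbar \<Longrightarrow> w \<in> Fbar \<Longrightarrow> absv (z - w) < 1 \<Longrightarrow> z = w"
  using absv_Fbar[OF Fbar_diff[of z w]] by fastforce

lemma poly_map_\<kappa>_pCons: "poly (map_poly \<kappa> (pCons a p)) x = \<kappa> a + x * poly (map_poly \<kappa> p) x"
  by (simp add: map_poly_pCons)

lemma poly_map_\<kappa>_add:
  "poly (map_poly \<kappa> (p + q)) x = poly (map_poly \<kappa> p) x + poly (map_poly \<kappa> q) x"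
proof -
  have "map_poly \<kappa> (p + q) = map_poly \<kappa> p + map_poly \<kappa> q"
    by (rule poly_eqI) (simp add: coeff_map_poly \<kappa>_add)
  then show ?thesis
    by simp
qed

lemma poly_map_\<kappa>_smult: "poly (map_poly \<kappa> (smult c p)) x = \<kappa> c * poly (map_poly \<kappa> p) x"
  by (induction p) (simp_all add: poly_map_\<kappa>_pCons \<kappa>_mult algebra_simps)

lemma poly_map_\<kappa>_mult:
  "poly (map_poly \<kappa> (p * q)) x = poly (map_poly \<kappa> p) x * poly (map_poly \<kappa> q) x"
  by (induction p)
     (simp_all add: poly_map_\<kappa>_pCons poly_map_\<kappa>_add poly_map_\<kappa>_smult algebra_simps)

text \<open>Modulo \<open>g\<close> there are only finitely many remainders, so two of the monomials
  of exponent \<open>q^i\<close> agree. Evaluating at \<open>z\<close> and cancelling an injective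
  Frobenius power gives the fixed point equation.\<close>

lemma Fbar_root:
  assumes "g \<noteq> 0" "poly (map_poly \<kappa> g) z = 0"
  shows "z \<in> Fbar"
proof -
  define N where "N = (\<lambda>i::nat. CARD('a) ^ i)"
  define f where "f = (\<lambda>i. monom 1 (N i) mod g)"
  have "range f \<subseteq> {p. degree p \<le> degree g}"
    unfolding f_def using assms(1) by (auto intro: degree_mod_less' less_imp_le)
      (metis degree_0 degree_mod_less le0 less_imp_le)
  then have "\<not> inj f"
    using finite_polys_degree_le finite_subset finite_imageD infinite_UNIV_nat by metis
  then obtain i j where ij: "i < j" "f i = f j"
    unfolding inj_def by (metis linorder_neqE_nat)
  have "poly (map_poly \<kappa> (f i)) z = z ^ N i" for i
  proof -
    have "poly (map_poly \<kappa> (monom 1 (N i) div g * g + f i)) z = z ^ N i"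
      unfolding f_def by (simp only: div_mult_mod_eq) (simp add: map_poly_monom poly_monom)
    then show ?thesis
      using assms(2) by (simp add: poly_map_\<kappa>_add poly_map_\<kappa>_mult)
  qed
  then have "z ^ N i = z ^ N j"
    using ij(2) by metis
  also have "\<dots> = (z ^ N (j - i)) ^ N i"
    using ij(1) by (simp add: N_def flip: power_mult power_add)
  finally have "z = z ^ N (j - i)"
    unfolding N_def by (rule frobenius_inj)
  then show ?thesis
    using ij(1) unfolding Fbar_def N_def by (intro CollectI exI[of _ "j - i"]) auto
qed

text \<open>Up to the leading coefficient, the value at \<open>y\<close> is the product of the
  distances from \<open>y\<close> to the roots; if it is small, some factor is below 1.\<close>

lemma close_root:
  assumes "\<forall>i. coeff p i \<in> algebraic_elements \<iota>"
    and "absv (poly p y) < absv (coeff p (degree p))"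
  shows "\<exists>z. poly p z = 0 \<and> absv (y - z) < 1"
  using assms
proof (induction rule: algebraic_poly_induct)
  case (root x p)
  show ?case
  proof (cases "absv (y - x) < 1")
    case True
    then show ?thesis
      by (intro exI[of _ x]) simp
  next
    case False
    have "p \<noteq> 0"
      using root.prems by auto
    then have "coeff ([:- x, 1:] * p) (degree ([:- x, 1:] * p)) =
        coeff p (degree p)"
      using lead_coeff_mult[of "[:- x, 1:]" p] by simp
    moreover have "poly ([:- x, 1:] * p) y = (y - x) * poly p y"
      by (simp add: algebra_simps)
    ultimately have "absv (y - x) * absv (poly p y) < absv (coeff p (degree p))"
      using root.prems by (simp only: absv_mult)
    moreover have "1 * absv (poly p y) \<le> absv (y - x) * absv (poly p y)"
      using False by (intro mult_right_mono) auto
    ultimately obtain z where "poly p z = 0" "absv (y - z) < 1"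
      using root.IH by auto
    then show ?thesis
      by (intro exI[of _ z]) simp
  qed
qed simp

text \<open>An annihilating polynomial of Gauss norm 1 is reduced to a polynomial over F. Its value
  at \<open>y\<close> is small while its leading coefficient is a unit, so \<open>close_root\<close>
  finds a root near \<open>y\<close>, and \<open>Fbar_root\<close> places it in
  \<open>Fbar\<close>.\<close>

lemma residue_exists_algebraic:
  assumes y: "y \<in> algebraic_elements \<iota>" "absv y \<le> 1"
  obtains z where "z \<in> Fbar" "absv (y - z) < 1"
proof -
  obtain p where p: "p \<noteq> 0" "poly (map_poly \<iota> p) y = 0"
    using y(1) by (auto simp: algebraic_elements_def)
  define d where "d = degree p"
  \<comment> \<open>\<open>M\<close> is the Gauss norm of \<open>p\<close>. Dividing by a
    coefficient that attains it makes all coefficients integral and one of them 1, so the reduction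
    \<open>g\<close> is nonzero.\<close>
  define M where "M = Max ((\<lambda>i. absv (\<iota> (coeff p i))) ` {..d})"
  have "M \<in> (\<lambda>i. absv (\<iota> (coeff p i))) ` {..d}"
    unfolding M_def by (intro Max_in) auto
  then obtain k where k: "k \<le> d" "M = absv (\<iota> (coeff p k))"
    by auto
  have M: "absv (\<iota> (coeff p i)) \<le> absv (\<iota> (coeff p k))" if "i \<le> d" for i
    unfolding k(2)[symmetric] M_def using that by (intro Max_ge) auto
  have "coeff p k \<noteq> 0"
    using M[of d] p(1) absv_nonneg[of "\<iota> (coeff p d)"] by (auto simp: d_def simp del: absv_nonneg)
  define r where "r = smult (inverse (coeff p k)) p"
  have r0: "poly (map_poly \<iota> r) y = 0"
    using p(2) by (simp add: r_def poly_map_\<iota>_smult)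
  have r_le: "absv (\<iota> (coeff r i)) \<le> 1" for i
  proof (cases "i \<le> d")
    case True
    then show ?thesis
      using M[OF True] \<open>coeff p k \<noteq> 0\<close>
      unfolding r_def coeff_smult \<iota>_mult \<iota>_inverse absv_mult absv_inverse
      by (subst mult.commute) (simp add: divide_le_eq flip: divide_inverse)
  next
    case False
    then show ?thesis
      by (simp add: r_def coeff_eq_0 d_def)
  qed
  have rk: "coeff r k = 1"
    using \<open>coeff p k \<noteq> 0\<close> by (simp add: r_def)
  have deg_r: "degree r \<le> d"
    by (simp add: r_def d_def degree_smult_le)
  define g where "g = map_poly (\<lambda>f. fls_nth f 0) r"
  have coeff_g: "coeff g i = fls_nth (coeff r i) 0" for i
    by (simp add: g_def coeff_map_poly)
  have "coeff g k \<noteq> 0"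
    by (simp add: coeff_g rk)
  then have "g \<noteq> 0"
    by auto
  have deg_g: "degree g \<le> d"
    using deg_r by (intro degree_le) (simp add: coeff_g coeff_eq_0)
  have "poly (map_poly \<kappa> g) y = (\<Sum>i\<le>d. \<kappa> (coeff g i) * y ^ i)"
  proof -
    have "degree (map_poly \<kappa> g) \<le> d"
      using deg_g by (intro degree_le) (simp add: coeff_map_poly coeff_eq_0)
    then have "poly (map_poly \<kappa> g) y = (\<Sum>i\<le>d. coeff (map_poly \<kappa> g) i * y ^ i)"
      unfolding poly_altdef by (intro sum.mono_neutral_left) (auto simp: coeff_eq_0)
    then show ?thesis
      by (simp add: coeff_map_poly)
  qed
  then have "poly (map_poly \<kappa> g) y = - (\<Sum>i\<le>d. (\<iota> (coeff r i) - \<kappa> (coeff g i)) * y ^ i)"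
    using r0 by (simp add: poly_map_\<iota>_altdef[OF deg_r] left_diff_distrib sum_subtractf)
  also have "absv \<dots> < 1"
  proof -
    have "absv ((\<iota> (coeff r i) - \<kappa> (coeff g i)) * y ^ i) < 1" for i
    proof -
      have "absv (\<iota> (coeff r i) - \<kappa> (coeff g i)) < 1"
        using absv_\<iota>_diff_const_less[OF r_le] by (simp add: \<kappa>_def coeff_g)
      moreover have "absv (y ^ i) \<le> 1"
        using y(2) by (simp add: absv_power power_le_one)
      ultimately show ?thesis
        unfolding absv_mult by (meson absv_nonneg le_less_trans mult_left_le)
    qed
    then show ?thesis
      unfolding absv_minus by (intro absv_sum_less) auto
  qed
  also have "1 = absv (coeff (map_poly \<kappa> g) (degree (map_poly \<kappa> g)))"
  proof -
    have "degree (map_poly \<kappa> g) = degree g"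
      by (rule degree_map_poly) simp
    then show ?thesis
      using \<open>g \<noteq> 0\<close> by (simp add: coeff_map_poly absv_\<kappa>)
  qed
  finally obtain z where z: "poly (map_poly \<kappa> g) z = 0" "absv (y - z) < 1"
    using close_root[of "map_poly \<kappa> g" y] algebraic_\<iota> by (auto simp: coeff_map_poly \<kappa>_def)
  show ?thesis
    using that[OF Fbar_root[OF \<open>g \<noteq> 0\<close> z(1)] z(2)] .
qed

lemma residue_exists:
  assumes "absv x \<le> 1"
  obtains z where "z \<in> Fbar" "absv (x - z) < 1"
proof -
  have "x \<in> closure (algebraic_elements \<iota>)"
    by (simp add: algebraic_dense)
  then obtain y where y: "y \<in> algebraic_elements \<iota>" "absv (y - x) < 1"
    using closure_absvE by (metis zero_less_one)
  then have "absv (y - x + x) \<le> 1"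
    using assms absv_add_le[of "y - x" 1 x] by simp
  then obtain z where z: "z \<in> Fbar" "absv (y - z) < 1"
    using residue_exists_algebraic[OF y(1)] by auto
  have "absv ((y - z) - (y - x)) < 1"
    by (rule absv_diff_less[OF z(2) y(2)])
  then show ?thesis
    using that[OF z(1)] by simp
qed

section \<open>Isometric homomorphisms inducing Frobenius\<close>

text \<open>All powers of \<open>u\<close> lie in one finite-dimensional space, on which the
  homomorphism is bounded by some \<open>D\<close>. Comparing \<open>|v|^n\<close> with
  \<open>D * |u|^n\<close> for large \<open>n\<close> removes the constant.\<close>

lemma hom_graph_isometry_le:
  assumes G: "hom_graph G" and uv: "(u, v) \<in> G"
  shows "absv v \<le> absv u"
proof (rule ccontr)
  assume less: "\<not> absv v \<le> absv u"
  obtain S where S: "finite S" "\<And>n. u ^ n \<in> K.span S"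
    using algebraic_imp_finite_span[OF hom_graph_algebraic[OF G uv]] by blast
  \<comment> \<open>The basis is chosen among the powers of \<open>u\<close>, because their images
    under \<open>G\<close> are known to exist.\<close>
  obtain B where B: "B \<subseteq> range (\<lambda>n. u ^ n)" "K.independent B" "range (\<lambda>n. u ^ n) \<subseteq> K.span B"
    using K.maximal_independent_subset by metis
  have "finite B"
    using K.independent_span_bound[OF S(1) B(2)] B(1) S(2) by blast
  obtain C where C: "0 < C" "\<And>f b. b \<in> B \<Longrightarrow> absv (\<iota> (f b)) \<le> C * absv (\<Sum>b\<in>B. \<iota> (f b) * b)"
    using coefficient_bound[OF \<open>finite B\<close> B(2)] by blast
  have pow: "(u ^ n, v ^ n) \<in> G" for n
    by (induction n) (auto intro: hom_graph_1[OF G] hom_graph_mult[OF G uv])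
  have "\<exists>w. (b, w) \<in> G" if "b \<in> B" for b
    using that B(1) pow by blast
  then obtain w where w: "\<And>b. b \<in> B \<Longrightarrow> (b, w b) \<in> G"
    by metis
  define D where "D = C * Max (insert 1 ((\<lambda>b. absv (w b)) ` B))"
  have bound: "absv (v ^ n) \<le> D * absv (u ^ n)" for n
  proof -
    have "u ^ n \<in> K.span B"
      using B(3) by blast
    then obtain f where f: "u ^ n = (\<Sum>b\<in>B. \<iota> (f b) * b)"
      unfolding K.span_finite[OF \<open>finite B\<close>] by blast
    have "((\<Sum>b\<in>B. \<iota> (f b) * b), (\<Sum>b\<in>B. \<iota> (f b) * w b)) \<in> G"
      by (intro hom_graph_sum[OF G] hom_graph_mult[OF G] hom_graph_\<iota>[OF G] w)
    then have "v ^ n = (\<Sum>b\<in>B. \<iota> (f b) * w b)"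
      using pow[of n] f hom_graph_unique[OF G] by metis
    also have "absv \<dots> \<le> D * absv (u ^ n)"
    proof (rule absv_sum_le)
      fix b assume b: "b \<in> B"
      have "absv (\<iota> (f b) * w b) \<le> (C * absv (u ^ n)) * Max (insert 1 ((\<lambda>b. absv (w b)) ` B))"
        unfolding absv_mult f using C b \<open>finite B\<close>
        by (intro mult_mono C(2)) (auto intro!: Max_ge mult_nonneg_nonneg less_imp_le)
      then show "absv (\<iota> (f b) * w b) \<le> D * absv (u ^ n)"
        by (simp add: D_def mult_ac)
    next
      have "1 \<le> Max (insert 1 ((\<lambda>b. absv (w b)) ` B))"
        using \<open>finite B\<close> by (intro Max_ge) auto
      then show "0 \<le> D * absv (u ^ n)"
        using C(1) by (simp add: D_def)
    qed
    finally show ?thesis .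
  qed
  show False
  proof (cases "u = 0")
    case True
    then show ?thesis
      using uv less hom_graph_eq_0[OF G, of v] by simp
  next
    case False
    then have "1 < absv v / absv u"
      using less by (simp add: field_simps)
    then obtain n where "D < (absv v / absv u) ^ n"
      using real_arch_pow by blast
    then show ?thesis
      using bound[of n] False by (simp add: absv_power power_divide field_simps)
  qed
qed

text \<open>The reverse inequality is the same bound for \<open>inverse u\<close>, whose image is
  the inverse of \<open>v\<close>.\<close>

lemma hom_graph_isometry:
  assumes G: "hom_graph G" and uv: "(u, v) \<in> G"
  shows "absv v = absv u"
proof (cases "u = 0")
  case True
  then show ?thesis
    using uv hom_graph_eq_0[OF G] by simp
next
  case False
  obtain w where w: "(inverse u, w) \<in> G"
    using hom_graph_inverse[OF G uv False] by blast
  then have "(1, v * w) \<in> G"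
    using hom_graph_mult[OF G uv w] False by simp
  then have vw: "v * w = 1"
    using hom_graph_unique[OF G hom_graph_1[OF G]] by simp
  then have "absv v * absv w = 1"
    by (simp flip: absv_mult)
  moreover have "absv w \<le> inverse (absv u)"
    using hom_graph_isometry_le[OF G w] by (simp add: absv_inverse)
  moreover have "absv v > 0"
    using vw by auto
  ultimately have "1 \<le> absv v * inverse (absv u)"
    by (metis less_imp_le mult_left_mono)
  then have "absv u \<le> absv v"
    using False by (simp add: field_simps)
  then show ?thesis
    using hom_graph_isometry_le[OF G uv] by simp
qed

text \<open>Preservation of 1 follows, since an isometry cannot send 1 to 0. Surjectivity is not
  demanded; on the lattice it is recovered from the finiteness of balls.\<close>

definition isometric_hom :: "('c \<Rightarrow> 'c) \<Rightarrow> bool" where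
  "isometric_hom \<sigma> \<longleftrightarrow> (\<forall>x y. \<sigma> (x + y) = \<sigma> x + \<sigma> y \<and> \<sigma> (x * y) = \<sigma> x * \<sigma> y) \<and> (\<forall>x. absv (\<sigma> x) = absv x)"

text \<open>A total extension on the algebraic elements is isometric, hence uniformly continuous,
  and so extends to their closure, which is all of \<open>C\<close>. The algebraic identities pass
  to limits.\<close>

lemma hom_graph_extends_to_isometric_hom:
  assumes "hom_graph G"
  obtains \<sigma> where "isometric_hom \<sigma>" "\<And>u v. (u, v) \<in> G \<Longrightarrow> \<sigma> u = v"
proof -
  obtain M where M: "hom_graph M" "G \<subseteq> M" "fst ` M = algebraic_elements \<iota>"
    using hom_graph_total[OF assms] by blast
  let ?A = "algebraic_elements \<iota>"
  define s where "s = (\<lambda>u. THE v. (u, v) \<in> M)"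
  have s_eq: "s u = v" if "(u, v) \<in> M" for u v
    unfolding s_def using that hom_graph_unique[OF M(1)] by (intro the_equality) auto
  have s: "(u, s u) \<in> M" if "u \<in> ?A" for u
    using that M(3) s_eq by (metis imageE prod.collapse)
  have "uniformly_continuous_on ?A s"
    unfolding uniformly_continuous_on_def dist_absv
  proof (intro allI impI)
    fix e :: real assume "e > 0"
    have "absv (s x' - s x) = absv (x' - x)" if "x \<in> ?A" "x' \<in> ?A" for x x'
      using hom_graph_isometry[OF M(1) hom_graph_diff[OF M(1) s s]] that by simp
    then show "\<exists>d>0. \<forall>x\<in>?A. \<forall>x'\<in>?A. absv (x' - x) < d \<longrightarrow> absv (s x' - s x) < e"
      using \<open>e > 0\<close> by auto
  qed
  then obtain g where g: "uniformly_continuous_on UNIV g" "\<And>x. x \<in> ?A \<Longrightarrow> s x = g x"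
    using uniformly_continuous_on_extension_on_closure[of ?A s] unfolding algebraic_dense by metis
  have cont: "(\<lambda>n. g (f n)) \<longlonglongrightarrow> g l" if "f \<longlonglongrightarrow> l" for f l
    using uniformly_continuous_imp_continuous[OF g(1)] that
    by (auto simp: continuous_on_eq_continuous_at intro: isCont_tendsto_compose)
  have approx: "\<exists>f. (\<forall>n. f n \<in> ?A) \<and> f \<longlonglongrightarrow> x" for x
    using closure_sequential[of x ?A] by (simp add: algebraic_dense)
  have "isometric_hom g"
    unfolding isometric_hom_def
  proof (intro conjI allI)
    fix x y
    obtain a b where a: "\<And>n. a n \<in> ?A" "a \<longlonglongrightarrow> x" and b: "\<And>n. b n \<in> ?A" "b \<longlonglongrightarrow> y"
      using approx[of x] approx[of y] by blast
    have M_ab: "(a n + b n, g (a n) + g (b n)) \<in> M" "(a n * b n, g (a n) * g (b n)) \<in> M" for n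
      using hom_graph_add[OF M(1) s[OF a(1)] s[OF b(1)]] hom_graph_mult[OF M(1) s[OF a(1)] s[OF b(1)]]
      by (simp_all add: g(2)[OF a(1)] g(2)[OF b(1)])
    have "g (a n + b n) = g (a n) + g (b n)" "g (a n * b n) = g (a n) * g (b n)" for n
      using s_eq[OF M_ab(1)[of n]] s_eq[OF M_ab(2)[of n]]
        g(2)[OF algebraic_add[OF a(1) b(1)]] g(2)[OF algebraic_mult[OF a(1) b(1)]] by simp_all
    moreover have "(\<lambda>n. g (a n + b n)) \<longlonglongrightarrow> g (x + y)" "(\<lambda>n. g (a n * b n)) \<longlonglongrightarrow> g (x * y)"
      using a b by (auto intro!: cont tendsto_addC tendsto_multC)
    moreover have "(\<lambda>n. g (a n) + g (b n)) \<longlonglongrightarrow> g x + g y" "(\<lambda>n. g (a n) * g (b n)) \<longlonglongrightarrow> g x * g y"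
      using a b by (auto intro!: cont tendsto_addC tendsto_multC)
    ultimately show "g (x + y) = g x + g y" "g (x * y) = g x * g y"
      by (simp_all add: LIMSEQ_unique)
    have "absv (g (a n)) = absv (a n)" for n
      using hom_graph_isometry[OF M(1) s[OF a(1)]] g(2)[OF a(1)] by simp
    moreover have "(\<lambda>n. absv (g (a n))) \<longlonglongrightarrow> absv (g x)" "(\<lambda>n. absv (a n)) \<longlonglongrightarrow> absv x"
      unfolding absv_def using a(2) by (auto intro!: cont tendsto_intros)
    ultimately show "absv (g x) = absv x"
      by (simp add: LIMSEQ_unique)
  qed
  moreover have "g u = v" if "(u, v) \<in> G" for u v
    using that M s_eq g(2) hom_graph_algebraic[OF assms] by (metis subsetD)
  ultimately show ?thesis
    using that by blast
qed

lemma isometric_homD: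
  assumes "isometric_hom \<sigma>"
  shows "\<sigma> (x + y) = \<sigma> x + \<sigma> y" "\<sigma> (x * y) = \<sigma> x * \<sigma> y" "absv (\<sigma> x) = absv x"
  using assms by (auto simp: isometric_hom_def)

lemma isometric_hom_simps:
  assumes "isometric_hom \<sigma>"
  shows "\<sigma> 0 = 0" "\<sigma> 1 = 1" "\<sigma> (- x) = - \<sigma> x" "\<sigma> (x - y) = \<sigma> x - \<sigma> y" "\<sigma> (x ^ n) = \<sigma> x ^ n"
    "\<sigma> x = \<sigma> y \<longleftrightarrow> x = y" "\<sigma> (inverse x) = inverse (\<sigma> x)"
proof -
  note \<sigma> = isometric_homD[OF assms]
  show 0: "\<sigma> 0 = 0"
    using \<sigma>(3)[of 0] by simp
  have "\<sigma> 1 \<noteq> 0"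
    using \<sigma>(3)[of 1] by auto
  moreover have "\<sigma> 1 * \<sigma> 1 = \<sigma> 1"
    using \<sigma>(2)[of 1 1] by simp
  ultimately show 1: "\<sigma> 1 = 1"
    by simp
  show m: "\<sigma> (- x) = - \<sigma> x" for x
    using \<sigma>(1)[of x "- x"] 0 by (simp add: eq_neg_iff_add_eq_0 add.commute)
  show d: "\<sigma> (x - y) = \<sigma> x - \<sigma> y" for x y
    using \<sigma>(1)[of x "- y"] m by simp
  show "\<sigma> (x ^ n) = \<sigma> x ^ n"
    by (induction n) (simp_all add: 1 \<sigma>(2))
  show "\<sigma> x = \<sigma> y \<longleftrightarrow> x = y"
    using \<sigma>(3)[of "x - y"] d[of x y] by (metis absv_eq_0_iff eq_iff_diff_eq_0)
  show "\<sigma> (inverse x) = inverse (\<sigma> x)"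
  proof (cases "x = 0")
    case False
    then have "\<sigma> x * \<sigma> (inverse x) = 1"
      using 1 by (simp flip: \<sigma>(2))
    then show ?thesis
      using inverse_unique by metis
  qed (simp add: 0)
qed

lemma isometric_hom_tendsto:
  assumes "isometric_hom \<sigma>" "(f \<longlongrightarrow> l) F"
  shows "((\<lambda>x. \<sigma> (f x)) \<longlongrightarrow> \<sigma> l) F"
  using assms unfolding tendsto_absv_iff
  by (simp add: isometric_homD isometric_hom_simps flip: isometric_hom_simps(4))

end

section \<open>The finite extension \<open>L\<close>, its residue field and lifts of
  Frobenius\<close>

locale finite_extension_field = completed_algebraic_closure \<iota>
  for \<iota> :: "'a::{field,finite} fls \<Rightarrow> 'c::{field,complete_space}" +
  fixes L :: "'c set"
  assumes finite_extension: "finite_extension \<iota> L"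
begin

lemma subfield_L: "subfield L ring_of_type_algebra"
  using finite_extension by (simp add: finite_extension_def)

interpretation C: field "ring_of_type_algebra :: 'c ring"
  by (rule field_from_type_algebra)

lemma L_\<iota>: "\<iota> a \<in> L"
  using finite_extension by (auto simp: finite_extension_def)

lemma L_add: "x \<in> L \<Longrightarrow> y \<in> L \<Longrightarrow> x + y \<in> L"
  using subringE(7)[OF subfieldE(1)[OF subfield_L], of x y] by (simp add: ring_of_type_algebra_def)

lemma L_mult: "x \<in> L \<Longrightarrow> y \<in> L \<Longrightarrow> x * y \<in> L"
  using subringE(6)[OF subfieldE(1)[OF subfield_L], of x y] by (simp add: ring_of_type_algebra_def)

lemma L_0: "0 \<in> L"
  using L_\<iota>[of 0] by simp

lemma L_1: "1 \<in> L"
  using L_\<iota>[of 1] by simp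

lemma L_uminus: "x \<in> L \<Longrightarrow> - x \<in> L"
  using L_mult[OF L_\<iota>[of "- 1"]] by (simp add: \<iota>_uminus)

lemma L_power: "x \<in> L \<Longrightarrow> x ^ n \<in> L"
  by (induction n) (auto intro: L_1 L_mult)

text \<open>Translates the dimension over a record-based field into \<open>K.span\<close>; each
  \<open>line_extension\<close> contributes one spanning vector.\<close>

lemma L_finite_span:
  obtains S where "finite S" "L = K.span S"
proof -
  let ?R = "ring_of_type_algebra :: 'c ring"
  obtain n where "C.dimension n (range \<iota>) L"
    using finite_extension by (auto simp: finite_extension_def C.finite_dimension_def)
  then have "\<exists>S. finite S \<and> L = K.span S"
  proof (induction n "range \<iota>" L rule: C.dimension.induct)
    case zero_dim
    show ?case
      by (intro exI[of _ "{}"]) (simp add: ring_of_type_algebra_def)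
  next
    case (Suc_dim v E n)
    then obtain S where S: "finite S" "E = K.span S"
      by blast
    have "C.line_extension (range \<iota>) v E = K.span (insert v S)"
    proof (intro Set.set_eqI iffI)
      fix u assume "u \<in> C.line_extension (range \<iota>) v E"
      then obtain k e where "e \<in> E" "u = \<iota> k * v + e"
        unfolding C.line_extension_mem_iff by (auto simp: ring_of_type_algebra_def)
      then show "u \<in> K.span (insert v S)"
        unfolding S(2) K.span_breakdown_eq by (intro exI[of _ k]) simp
    next
      fix u assume "u \<in> K.span (insert v S)"
      then obtain k where "u - \<iota> k * v \<in> E"
        unfolding S(2) K.span_breakdown_eq by blast
      then show "u \<in> C.line_extension (range \<iota>) v E"
        unfolding C.line_extension_mem_iff
        by (intro bexI[of _ "\<iota> k"] bexI[of _ "u - \<iota> k * v"]) (auto simp: ring_of_type_algebra_def)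
    qed
    then show ?case
      using S(1) by (intro exI[of _ "insert v S"]) simp
  qed
  then show ?thesis
    using that by blast
qed

lemma L_algebraic: "L \<subseteq> algebraic_elements \<iota>"
proof
  fix x assume x: "x \<in> L"
  obtain S where "finite S" "L = K.span S"
    by (rule L_finite_span)
  with L_power[OF x] show "x \<in> algebraic_elements \<iota>"
    by (intro finite_span_imp_algebraic) auto
qed

text \<open>Every residue class of \<open>C\<close> has a unique lift to \<open>Fbar\<close>, which stands for the class.\<close>

definition residues :: "'c set \<Rightarrow> 'c set" where
  "residues M = {z \<in> Fbar. \<exists>c\<in>M. absv (c - z) < 1}"

text \<open>In basis coordinates, integrality bounds the pole orders, and the coefficients up to
  some index determine the residue. A residue is thus encoded by finitely many elements of
  F.\<close>

lemma finite_residues_L: "finite (residues L)"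
proof -
  obtain S where S: "finite S" "L = K.span S"
    by (rule L_finite_span)
  obtain B where B: "B \<subseteq> L" "K.independent B" "L \<subseteq> K.span B"
    using K.maximal_independent_subset by metis
  have "finite B"
    using K.independent_span_bound[OF S(1) B(2)] B(1) S(2) by blast
  obtain C where C: "0 < C" "\<And>f b. b \<in> B \<Longrightarrow> absv (\<iota> (f b)) \<le> C * absv (\<Sum>b\<in>B. \<iota> (f b) * b)"
    using coefficient_bound[OF \<open>finite B\<close> B(2)] by blast
  \<comment> \<open>Coordinates of an integral element have absolute value at most
    \<open>C < q^n\<close>, so their coefficients start at index \<open>- n\<close>.\<close>
  obtain n where n: "C < real CARD('a) ^ n"
    using real_arch_pow[OF card_a_gt1] by blast
  define D where "D = Max (insert 1 (absv ` B))"
  have D: "absv b \<le> D" if "b \<in> B" for b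
    unfolding D_def using that \<open>finite B\<close> by (intro Max_ge) auto
  \<comment> \<open>Coordinates that agree up to index \<open>m\<close> differ by at most
    \<open>q^(-(m+1))\<close>; times a basis vector of size at most \<open>D\<close> this is below
    1.\<close>
  obtain m where m: "D < real CARD('a) ^ m"
    using real_arch_pow[OF card_a_gt1] by blast
  have "\<exists>f. absv ((\<Sum>b\<in>B. \<iota> (f b) * b) - z) < 1" if z: "z \<in> residues L" for z
  proof -
    obtain c where "c \<in> L" "absv (c - z) < 1"
      using z by (auto simp: residues_def)
    moreover have "c \<in> range (\<lambda>f. \<Sum>b\<in>B. \<iota> (f b) * b)"
      using \<open>c \<in> L\<close> B(3) K.span_finite[OF \<open>finite B\<close>] by blast
    ultimately show ?thesis
      by auto
  qed
  then obtain f where f: "\<And>z. z \<in> residues L \<Longrightarrow> absv ((\<Sum>b\<in>B. \<iota> (f z b) * b) - z) < 1"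
    by metis
  have low: "fls_nth (f z b) i = 0" if "z \<in> residues L" "b \<in> B" "i < - int n" for z b i
  proof -
    let ?c = "\<Sum>b\<in>B. \<iota> (f z b) * b"
    have "absv ((?c - z) + z) \<le> 1"
      using f[OF that(1)] absv_Fbar_le[of z] that(1) by (intro absv_add_le) (auto simp: residues_def)
    then have "C * absv ?c \<le> C * 1"
      using C(1) by (intro mult_left_mono) auto
    then have "absv (\<iota> (f z b)) \<le> real CARD('a) powi (- (- int n))"
      using C(2)[OF that(2), of "f z"] n by simp
    then show ?thesis
      unfolding absv_\<iota>_le_iff using that(3) by blast
  qed
  define g where "g = (\<lambda>z. \<lambda>(b, i)\<in>B \<times> {- int n..int m}. fls_nth (f z b) i)"
  have "inj_on g (residues L)"
  proof (rule inj_onI)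
    fix z w assume zw: "z \<in> residues L" "w \<in> residues L" "g z = g w"
    have eq: "fls_nth (f z b) i = fls_nth (f w b) i" if "b \<in> B" "i < int m + 1" for b i
    proof (cases "i < - int n")
      case True
      then show ?thesis
        using low zw(1,2) that by simp
    next
      case False
      then show ?thesis
        using fun_cong[OF zw(3), of "(b, i)"] that by (simp add: g_def)
    qed
    have "absv (\<Sum>b\<in>B. \<iota> (f z b - f w b) * b) < 1"
    proof (rule absv_sum_less)
      fix b assume b: "b \<in> B"
      have le: "absv (\<iota> (f z b - f w b)) \<le> real CARD('a) powi (- (int m + 1))"
        unfolding absv_\<iota>_le_iff using eq[OF b] by simp
      have "real CARD('a) powi (- (int m + 1)) = inverse (real CARD('a) ^ Suc m)"
        by (simp add: power_int_def nat_add_distrib power_inverse)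
      have "absv (\<iota> (f z b - f w b) * b) \<le> inverse (real CARD('a) ^ Suc m) * D"
        unfolding absv_mult using le D[OF b] \<open>real CARD('a) powi _ = _\<close>
        by (intro mult_mono) auto
      also have "\<dots> < inverse (real CARD('a) ^ Suc m) * real CARD('a) ^ Suc m"
      proof (rule mult_strict_left_mono)
        have "real CARD('a) ^ m \<le> real CARD('a) ^ Suc m"
          using card_a_gt1 by (intro power_increasing) linarith+
        with m show "D < real CARD('a) ^ Suc m"
          by linarith
      qed simp
      also have "\<dots> = 1"
        by (rule left_inverse) simp
      finally show "absv (\<iota> (f z b - f w b) * b) < 1" .
    qed simp
    then have "absv ((\<Sum>b\<in>B. \<iota> (f z b) * b) - (\<Sum>b\<in>B. \<iota> (f w b) * b)) < 1"
      by (simp add: \<iota>_diff left_diff_distrib sum_subtractf)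
    from absv_diff_less[OF absv_add_less[OF this f[OF zw(2)]] f[OF zw(1)]]
    have "absv (- (w - z)) < 1"
      by (simp add: algebra_simps)
    then show "z = w"
      using zw by (intro Fbar_eqI) (auto simp: residues_def)
  qed
  moreover have "g ` residues L \<subseteq> (B \<times> {- int n..int m}) \<rightarrow>\<^sub>E UNIV"
    by (intro image_subsetI PiE_I UNIV_I) (simp only: g_def restrict_def if_False)
  moreover have "finite ((B \<times> {- int n..int m}) \<rightarrow>\<^sub>E (UNIV :: 'a set))"
    using \<open>finite B\<close> by (intro finite_PiE) auto
  ultimately show ?thesis
    by (metis finite_imageD finite_subset)
qed

lemma residues_add: "z \<in> residues L \<Longrightarrow> w \<in> residues L \<Longrightarrow> z + w \<in> residues L"
proof -
  assume "z \<in> residues L" "w \<in> residues L"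
  then obtain c d where *: "z \<in> Fbar" "w \<in> Fbar" "c \<in> L" "absv (c - z) < 1" "d \<in> L" "absv (d - w) < 1"
    by (auto simp: residues_def)
  have "absv ((c - z) + (d - w)) < 1"
    by (rule absv_add_less[OF *(4,6)])
  then have "absv ((c + d) - (z + w)) < 1"
    by (simp add: algebra_simps)
  then show ?thesis
    using * by (auto simp: residues_def intro: Fbar_add L_add intro!: bexI[of _ "c + d"])
qed

lemma residues_mult: "z \<in> residues L \<Longrightarrow> w \<in> residues L \<Longrightarrow> z * w \<in> residues L"
proof -
  assume "z \<in> residues L" "w \<in> residues L"
  then obtain c d where *: "z \<in> Fbar" "w \<in> Fbar" "c \<in> L" "absv (c - z) < 1" "d \<in> L" "absv (d - w) < 1"
    by (auto simp: residues_def)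
  have "absv (c - z + z) \<le> 1"
    using *(4) absv_Fbar_le[OF *(1)] absv_add_le[of "c - z" 1 z] by simp
  then have "absv (c * (d - w)) < 1" "absv ((c - z) * w) < 1"
    using *(4,6) absv_Fbar_le[OF *(2)] unfolding absv_mult
    by (auto intro: le_less_trans[OF mult_left_le_one_le] le_less_trans[OF mult_right_le_one_le])
  from absv_add_less[OF this] have "absv (c * d - z * w) < 1"
    by (simp add: algebra_simps)
  then show ?thesis
    using * by (auto simp: residues_def intro: Fbar_mult L_mult intro!: bexI[of _ "c * d"])
qed

lemma residues_0: "0 \<in> residues L"
  by (auto simp: residues_def Fbar_0 intro: bexI[of _ 0] L_0)

definition Q :: nat where
  "Q = card (residues L)"

text \<open>Makes the \<open>Q\<close>-power map additive on \<open>C\<close>, so that it commutes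
  with polynomials whose coefficients it fixes.\<close>

lemma Q_CHAR_power:
  obtains e where "Q = CHAR('c) ^ e"
  using card_additive_subgroup[OF prime_CHAR_c finite_residues_L residues_0] residues_add
  by (auto simp: Q_def)

lemma Q_pos: "Q > 0"
  using finite_residues_L residues_0 by (auto simp: Q_def card_gt_0_iff)

lemma residues_L_power: "z \<in> residues L \<Longrightarrow> z ^ Q = z"
  unfolding Q_def by (rule power_card_eq_same[OF finite_residues_L residues_0 residues_mult])

lemma Q_power_sum: "(\<Sum>i\<in>S. f i :: 'c) ^ Q = (\<Sum>i\<in>S. f i ^ Q)"
  using Q_CHAR_power freshmans_dream_sum'[OF prime_CHAR_c] by metis

lemma Q_power_poly:
  fixes p :: "'c poly"
  assumes "\<And>i. coeff p i ^ Q = coeff p i"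
  shows "poly p (x ^ Q) = poly p x ^ Q"
  by (simp add: poly_altdef Q_power_sum power_mult_distrib assms mult.commute flip: power_mult)

lemma hom_graph_Id_on_L: "hom_graph (Id_on L)"
  using L_algebraic L_\<iota> L_add L_mult by (auto simp: hom_graph_def Id_on_iff)

text \<open>
  The minimal polynomial over \<open>L\<close> of \<open>\<zeta> \<in> Fbar\<close> divides \<open>x^N - x\<close>, so its coefficients lie in the
  residue field of \<open>L\<close> and it also annihilates \<open>\<zeta>^Q\<close>.
\<close>

lemma frobenius_hom_exists:
  assumes \<zeta>: "\<zeta> \<in> Fbar"
  obtains \<sigma> where "isometric_hom \<sigma>" "\<And>x. x \<in> L \<Longrightarrow> \<sigma> x = x" "\<sigma> \<zeta> = \<zeta> ^ Q"
proof -
  let ?G = "Id_on L"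
  note G = hom_graph_Id_on_L
  obtain n where n: "n \<ge> 1" "\<zeta> ^ (CARD('a) ^ n) = \<zeta>"
    using \<zeta> by (auto simp: Fbar_def)
  define N where "N = CARD('a) ^ n"
  have N: "N > 1"
    unfolding N_def using n(1) card_a_ge2 by (intro one_less_power) auto
  define h where "h = monom (1::'c) N - monom 1 1"
  have h_root: "poly h z = 0 \<longleftrightarrow> z ^ N = z" for z
    by (simp add: h_def poly_monom)
  have h_G: "poly_graph ?G h h"
    unfolding h_def by (intro poly_graph_diff poly_graph_monom G hom_graph_1)
  have alg: "\<zeta> \<in> algebraic_elements \<iota>"
  proof -
    let ?q = "monom 1 N - monom 1 1 :: 'a fls poly"
    have "coeff ?q N = 1"
      using N by simp
    then have "?q \<noteq> 0"
      by (metis coeff_0 zero_neq_one)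
    moreover have "map_poly \<iota> ?q = h"
      unfolding h_def by (rule poly_eqI) (simp add: coeff_map_poly \<iota>_diff)
    ultimately show ?thesis
      using h_root[of \<zeta>] n(2) unfolding algebraic_elements_def N_def by (metis (mono_tags, lifting) mem_Collect_eq)
  qed
  obtain m0 m0' where m0: "poly_graph ?G m0 m0'" "m0 \<noteq> 0" "poly m0 \<zeta> = 0"
    and min0: "\<And>p p'. poly_graph ?G p p' \<Longrightarrow> p \<noteq> 0 \<Longrightarrow> poly p \<zeta> = 0 \<Longrightarrow>
      degree m0 \<le> degree p"
    using minimal_poly_exists[OF G alg] by blast
  define l where "l = coeff m0 (degree m0)"
  have coeff_m0: "coeff m0 i \<in> L" for i
    using m0(1) by (auto simp: poly_graph_def)
  have l: "l \<in> L" "l \<noteq> 0"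
    using m0(2) coeff_m0 by (simp_all add: l_def)
  obtain l' where "(inverse l, l') \<in> ?G"
    using hom_graph_inverse[OF G, of l l] l by (auto simp: Id_on_iff)
  then have "inverse l \<in> L"
    by auto
  define m where "m = smult (inverse l) m0"
  have m: "poly_graph ?G m m" "m \<noteq> 0" "poly m \<zeta> = 0" "coeff m (degree m) = 1"
    using m0(2,3) l L_mult[OF \<open>inverse l \<in> L\<close> coeff_m0]
    by (simp_all add: m_def poly_graph_def Id_on_iff) (simp add: l_def)
  have min: "degree m \<le> degree p"
    if "poly_graph ?G p p'" "p \<noteq> 0" "poly p \<zeta> = 0" for p p'
    using min0[OF that] l by (simp add: m_def)
  have root: "z ^ N = z" if "poly m z = 0" for z
  proof -
    have "poly h z = 0"
      by (rule minimal_poly_root[OF G m(1-3) _ that h_G]) (use min h_root n(2) in \<open>auto simp: N_def\<close>)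
    then show ?thesis
      by (simp add: h_root)
  qed
  \<comment> \<open>A monic polynomial whose roots are all fixed by the \<open>N\<close>-power map
    has coefficients fixed by it; shown by multiplying up the linear factors.\<close>
  have "(\<forall>z. poly p z = 0 \<longrightarrow> z ^ N = z) \<longrightarrow> coeff p (degree p) = 1 \<longrightarrow>
      (\<forall>i. coeff p i ^ N = coeff p i)" if "\<forall>i. coeff p i \<in> algebraic_elements \<iota>" for p
    using that
  proof (induction rule: algebraic_poly_induct)
    case (const c)
    then show ?case
      using N by (auto simp: coeff_pCons split: nat.splits)
  next
    case (root x p)
    show ?case
    proof (intro impI allI)
      fix i
      assume r: "\<forall>z. poly ([:- x, 1:] * p) z = 0 \<longrightarrow> z ^ N = z"
        and lc: "coeff ([:- x, 1:] * p) (degree ([:- x, 1:] * p)) = 1"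
      have "coeff p (degree p) = 1"
        using lc lead_coeff_mult[of "[:- x, 1:]" p] by simp
      moreover have "\<forall>z. poly p z = 0 \<longrightarrow> z ^ N = z"
        using r by simp
      ultimately have p: "coeff p i ^ N = coeff p i" for i
        using root.IH by blast
      have x: "x ^ N = x"
        using r by simp
      have "coeff ([:- x, 1:] * p) i = (case i of 0 \<Rightarrow> 0 | Suc k \<Rightarrow> coeff p k) - x * coeff p i"
        by (simp add: coeff_pCons split: nat.splits)
      then show "coeff ([:- x, 1:] * p) i ^ N = coeff ([:- x, 1:] * p) i"
        using p x N frobenius_diff[of _ _ n]
        by (auto simp: power_mult_distrib N_def[symmetric] split: nat.splits)
    qed
  qed
  then have "coeff m i ^ N = coeff m i" for i
    using m(1,4) root L_algebraic by (auto simp: poly_graph_def)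
  \<comment> \<open>The coefficients lie both in \<open>L\<close> and in \<open>Fbar\<close>, so
    each represents its own residue class.\<close>
  then have "coeff m i \<in> residues L" for i
    using m(1) n(1) by (auto simp: residues_def Fbar_def N_def poly_graph_def intro!: bexI[of _ "coeff m i"])
  then have root_Q: "poly m (\<zeta> ^ Q) = 0"
    using m(3) Q_pos by (simp add: Q_power_poly residues_L_power)
  have "poly p' (\<zeta> ^ Q) = 0" if "poly_graph ?G p p'" "poly p \<zeta> = 0" for p p'
    by (rule minimal_poly_root[OF G m(1-3) _ root_Q that]) (use min in auto)
  then obtain G' where G': "hom_graph G'" "?G \<subseteq> G'" "(\<zeta>, \<zeta> ^ Q) \<in> G'"
    using hom_graph_extend[OF G alg] by metis
  obtain \<sigma> where \<sigma>: "isometric_hom \<sigma>" "\<And>u v. (u, v) \<in> G' \<Longrightarrow> \<sigma> u = v"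
    using hom_graph_extends_to_isometric_hom[OF G'(1)] by blast
  show ?thesis
    by (rule that[OF \<sigma>(1)]) (use G' \<sigma>(2) in auto)
qed

end

section \<open>Orders of automorphisms of finite modules\<close>

text \<open>Division with remainder by a nonzero element of least degree: ideals of polynomials over
  a field are principal.\<close>

lemma poly_ideal_generator:
  fixes P :: "'b::field poly \<Rightarrow> bool"
  assumes diff: "\<And>a b. P a \<Longrightarrow> P b \<Longrightarrow> P (a - b)"
    and mult: "\<And>a b. P a \<Longrightarrow> P (b * a)"
    and nonzero: "P c" "c \<noteq> 0"
  obtains n where "n \<noteq> 0" "\<And>a. P a \<longleftrightarrow> n dvd a"
proof -
  obtain n where n: "P n \<and> n \<noteq> 0"
    and min: "\<And>a. P a \<and> a \<noteq> 0 \<Longrightarrow> degree n \<le> degree a"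
    using ex_has_least_nat[of "\<lambda>a. P a \<and> a \<noteq> 0" c degree] nonzero by blast
  have "P a \<longleftrightarrow> n dvd a" for a
  proof
    assume a: "P a"
    have "P (a mod n)"
      using diff[OF a mult[of n "a div n"]] n by (simp add: minus_div_mult_eq_mod)
    show "n dvd a"
    proof (rule ccontr)
      assume "\<not> n dvd a"
      then have "a mod n \<noteq> 0"
        by (simp add: dvd_eq_mod_eq_0)
      then show False
        using min[of "a mod n"] \<open>P (a mod n)\<close> n degree_mod_less[of n a] by auto
    qed
  next
    assume "n dvd a"
    then show "P a"
      using n mult by (metis dvdE mult.commute)
  qed
  with n show ?thesis
    using that by blast
qed

text \<open>\<open>d\<close> is a greatest common divisor with its Bezout coefficients, found as the
  generator of the ideal of all \<open>a * m + b * n\<close>.\<close>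

lemma coprime_witness:
  fixes m n :: "'b::field poly"
  assumes "m \<noteq> 0"
  obtains d a b where "d dvd m" "d dvd n" "d = a * m + b * n" "d \<noteq> 0"
proof -
  let ?P = "\<lambda>c. \<exists>a b. c = a * m + b * n"
  have diff: "?P (c - c')" if "?P c" "?P c'" for c c'
  proof -
    obtain a b a' b' where "c = a * m + b * n" "c' = a' * m + b' * n"
      using \<open>?P c\<close> \<open>?P c'\<close> by blast
    then have "c - c' = (a - a') * m + (b - b') * n"
      by (simp add: algebra_simps)
    then show ?thesis
      by blast
  qed
  have mult: "?P (e * c)" if "?P c" for c e
  proof -
    obtain a b where "c = a * m + b * n"
      using \<open>?P c\<close> by blast
    then have "e * c = (e * a) * m + (e * b) * n"
      by (simp add: algebra_simps)
    then show ?thesis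
      by blast
  qed
  have m: "?P m" and n: "?P n"
    by (rule exI[of _ 1], rule exI[of _ 0], simp) (rule exI[of _ 0], rule exI[of _ 1], simp)
  obtain d where d: "d \<noteq> 0" "\<And>c. ?P c \<longleftrightarrow> d dvd c"
    using poly_ideal_generator[of ?P m, OF diff mult m assms] by metis
  have "?P d"
    using d(2) by simp
  then obtain a b where "d = a * m + b * n"
    by blast
  with d m n show ?thesis
    using that by metis
qed

text \<open>
  Take \<open>u\<close> whose annihilator \<open>(m)\<close> has maximal degree and, among
  the elements not killed by \<open>m\<close>, \<open>w\<close> whose annihilator \<open>(n)\<close> has minimal degree; with
  \<open>d = gcd(m, n)\<close> the element \<open>d u + w\<close> would have the annihilator \<open>(m n / d)\<close>.
\<close>

lemma dominating_annihilator:
  fixes scale :: "'b::field poly \<Rightarrow> 'd::ab_group_add \<Rightarrow> 'd"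
  assumes "Modules.module scale"
    and U: "Modules.module.subspace scale U" and W: "Modules.module.subspace scale W"
    and bounded: "\<And>u. u \<in> U \<Longrightarrow> \<exists>a. a \<noteq> 0 \<and> degree a \<le> N \<and> scale a u \<in> W"
  obtains u where "u \<in> U" "\<And>a w. scale a u \<in> W \<Longrightarrow> w \<in> U \<Longrightarrow> scale a w \<in> W"
proof -
  interpret M: Modules.module scale
    by fact
  define ann where "ann = (\<lambda>v n. n \<noteq> 0 \<and> (\<forall>a. scale a v \<in> W \<longleftrightarrow> n dvd a))"
  have ann_exists: "\<exists>n. ann u n \<and> degree n \<le> N" if u: "u \<in> U" for u
  proof -
    obtain a where a: "a \<noteq> 0" "degree a \<le> N" "scale a u \<in> W"
      using bounded[OF u] by blast
    obtain n where n: "n \<noteq> 0" "\<And>a. scale a u \<in> W \<longleftrightarrow> n dvd a"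
    proof (rule poly_ideal_generator[of "\<lambda>a. scale a u \<in> W"])
      show "scale (a - b) u \<in> W" if "scale a u \<in> W" "scale b u \<in> W" for a b
        using that M.subspace_diff[OF W] by (simp add: M.scale_left_diff_distrib)
      show "scale (b * a) u \<in> W" if "scale a u \<in> W" for a b
        using M.subspace_scale[OF W that, of b] by simp
    qed (use a in auto)
    moreover have "degree n \<le> N"
      using n a dvd_imp_degree_le[of n a] by fastforce
    ultimately show ?thesis
      by (auto simp: ann_def)
  qed
  have annD: "scale a v \<in> W \<longleftrightarrow> n dvd a" "n \<noteq> 0" if "ann v n" for a v n
    using that by (auto simp: ann_def)
  have "0 \<in> U"
    by (rule M.subspace_0[OF U])
  then obtain n0 where n0: "0 \<in> U \<and> ann 0 n0"
    using ann_exists by blast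
  let ?T = "\<lambda>y. fst y \<in> U \<and> ann (fst y) (snd y)"
  have "degree (snd y) < Suc N" if y: "?T y" for y
  proof -
    have "\<exists>n. ann (fst y) n \<and> degree n \<le> N"
      by (rule ann_exists) (use y in simp)
    then obtain n where n: "ann (fst y) n" "degree n \<le> N"
      by blast
    then have "snd y dvd n"
      using annD(1)[of "fst y" "snd y" n] annD(1)[of "fst y" n n] y by simp
    then show ?thesis
      using dvd_imp_degree_le[of "snd y" n] n annD(2)[OF n(1)] by simp
  qed
  then obtain y where y: "?T y"
    and y_max: "\<And>z. ?T z \<Longrightarrow> degree (snd z) \<le> degree (snd y)"
    using ex_has_greatest_nat[of ?T "(0, n0)" "\<lambda>y. degree (snd y)" "Suc N"] n0 by auto
  define u m where "u = fst y" and "m = snd y"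
  have u: "u \<in> U" "ann u m"
    using y by (simp_all add: u_def m_def)
  have max: "degree m' \<le> degree m" if "u' \<in> U" "ann u' m'" for u' m'
    using y_max[of "(u', m')"] that by (simp add: m_def)
  have "scale m w \<in> W" if wU: "w \<in> U" for w
  proof (rule ccontr)
    assume "scale m w \<notin> W"
    let ?Q = "\<lambda>(w, n). w \<in> U \<and> ann w n \<and> scale m w \<notin> W"
    obtain n' where "?Q (w, n')"
      using ann_exists[OF wU] wU \<open>scale m w \<notin> W\<close> by auto
    then obtain w n where w: "w \<in> U" "ann w n" "scale m w \<notin> W"
      and min: "\<And>w' n'. w' \<in> U \<Longrightarrow> ann w' n' \<Longrightarrow> scale m w' \<notin> W \<Longrightarrow>
        degree n \<le> degree n'"
      using ex_has_least_nat[of ?Q "(w, n')" "\<lambda>y. degree (snd y)"] by auto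
    have not_dvd: "\<not> n dvd m"
      using w(2,3) annD(1) by blast
    have m0: "m \<noteq> 0" and n0: "n \<noteq> 0"
      using annD(2) u(2) w(2) by auto
    obtain d a b where d: "d dvd m" "d dvd n" "d = a * m + b * n" "d \<noteq> 0"
      using coprime_witness[OF m0] by blast
    obtain m' where m': "m = d * m'"
      using d(1) by blast
    obtain \<pi> where \<pi>: "n = d * \<pi>"
      using d(2) by blast
    \<comment> \<open>\<open>scale e w\<close> has the annihilator \<open>f\<close> of smaller
      degree than \<open>n\<close>, so by minimality \<open>m\<close> already kills it.\<close>
    have proper: "f dvd m" if "n = e * f" "degree e > 0" for e f
    proof -
      have ef: "e \<noteq> 0" "f \<noteq> 0"
        using that n0 by auto
      have "scale c (scale e w) \<in> W \<longleftrightarrow> f dvd c" for c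
        using annD(1)[OF w(2), of "c * e"] ef that(1) by (simp add: mult.commute[of c e])
      then have "ann (scale e w) f"
        using ef by (auto simp: ann_def)
      moreover have "degree f < degree n"
        using that ef by (simp add: degree_mult_eq)
      ultimately have "scale m (scale e w) \<in> W"
        using min[of "scale e w" f] M.subspace_scale[OF U w(1)] by (auto simp: not_le)
      then show ?thesis
        using \<open>ann (scale e w) f\<close> annD(1) by blast
    qed
    \<comment> \<open>\<open>e\<close> is the gcd of \<open>m'\<close> and \<open>n\<close>, and it
      must be constant. Otherwise \<open>f = n / e\<close> divides \<open>m\<close>, hence
      \<open>d\<close>; then \<open>\<pi> = n / d\<close> divides \<open>e\<close> and thus
      \<open>m'\<close>, which would make \<open>n\<close> divide \<open>m\<close>.\<close>
    obtain e x y where e: "e dvd m'" "e dvd n" "e = x * m' + y * n" "e \<noteq> 0"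
      using coprime_witness[of m' n] m0 m' by auto
    have "degree e = 0"
    proof (rule ccontr)
      assume "degree e \<noteq> 0"
      obtain f where f: "n = e * f"
        using e(2) by blast
      have "f dvd m"
        using proper[OF f] \<open>degree e \<noteq> 0\<close> by simp
      moreover have "f dvd n"
        using f by simp
      ultimately have "f dvd d"
        unfolding d(3) by simp
      then obtain g where g: "d = f * g"
        by blast
      have "e * f = d * \<pi>"
        using f \<pi> by (rule trans[OF sym])
      also have "\<dots> = (g * \<pi>) * f"
        unfolding g by (simp only: mult_ac)
      finally have eq: "e * f = (g * \<pi>) * f" .
      have "f \<noteq> 0"
        using f n0 by auto
      then have "e = g * \<pi>"
        by (rule mult_right_cancel[THEN iffD1, OF _ eq])
      then have "\<pi> dvd m'"
        using e(1) dvd_trans[OF dvd_triv_right] by simp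
      then have "n dvd m"
        unfolding m' \<pi> by simp
      then show False
        using not_dvd by contradiction
    qed
    then obtain \<epsilon> where "e = [:\<epsilon>:]"
      by (rule degree_eq_zeroE)
    with e(4) have \<epsilon>: "e = [:\<epsilon>:]" "\<epsilon> \<noteq> 0"
      by auto
    have "smult (inverse \<epsilon>) e = 1"
      using \<epsilon> by (simp add: one_pCons)
    then have bezout: "1 = smult (inverse \<epsilon>) x * m' + smult (inverse \<epsilon>) y * n"
      unfolding e(3) by (simp add: smult_add_right)
    define x' where "x' = smult (inverse \<epsilon>) x"
    define y' where "y' = smult (inverse \<epsilon>) y"
    have bezout: "c = x' * m' * c + y' * n * c" for c
      using arg_cong[OF bezout, of "\<lambda>p. p * c"] by (simp add: x'_def y'_def algebra_simps)
    \<comment> \<open>\<open>scale d u\<close> has the annihilator \<open>m'\<close>, coprime to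
      \<open>n\<close>. So the annihilator of \<open>v\<close> is a multiple of
      \<open>m' * n = m * \<pi>\<close>, and the maximality of \<open>degree m\<close> forces
      \<open>\<pi>\<close> to be constant.\<close>
    define v where "v = scale d u + w"
    have v: "v \<in> U"
      unfolding v_def by (intro M.subspace_add[OF U] M.subspace_scale[OF U] u w)
    have du: "scale c (scale d u) \<in> W \<longleftrightarrow> m' dvd c" for c
      using annD(1)[OF u(2), of "c * d"] d(4) by (simp add: m' mult.commute[of c d])
    have lcm: "m' * n dvd c" if c: "scale c v \<in> W" for c
    proof -
      \<comment> \<open>Multiplication by \<open>m'\<close> removes the contribution of
        \<open>u\<close>, multiplication by \<open>n\<close> that of \<open>w\<close>.\<close>
      have "scale (m' * c) v \<in> W" "scale (n * c) v \<in> W"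
        using M.subspace_scale[OF W c, of m'] M.subspace_scale[OF W c, of n] by simp_all
      moreover have "scale (m' * c) (scale d u) \<in> W"
        unfolding du by simp
      moreover have "scale (n * c) w \<in> W"
        using annD(1)[OF w(2)] by simp
      moreover have "scale (m' * c) w = scale (m' * c) v - scale (m' * c) (scale d u)"
        "scale (n * c) (scale d u) = scale (n * c) v - scale (n * c) w"
        by (simp_all add: v_def M.scale_right_distrib)
      ultimately have "scale (m' * c) w \<in> W" "scale (n * c) (scale d u) \<in> W"
        using M.subspace_diff[OF W] by metis+
      then have "n dvd m' * c" "m' dvd n * c"
        unfolding du annD(1)[OF w(2)] .
      then have "n dvd x' * (m' * c) + y' * n * c" "m' dvd x' * m' * c + y' * (n * c)"
        by (auto intro!: dvd_add)
      then have nc: "n dvd c" and mc: "m' dvd c"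
        using bezout[of c] by (simp_all add: mult.assoc)
      then have "m' * n dvd x' * (m' * c)" "m' * n dvd y' * (n * c)"
        by (auto intro: dvd_mult mult_dvd_mono simp: mult.commute[of n])
      then show ?thesis
        using bezout[of c] by (metis dvd_add mult.assoc)
    qed
    obtain k where k: "ann v k"
      using ann_exists[OF v] by blast
    have "m' * n dvd k"
      using lcm annD(1)[OF k] by simp
    then have "degree (m' * n) \<le> degree k"
      using annD(2)[OF k] by (intro dvd_imp_degree_le)
    also have "\<dots> \<le> degree m"
      using max[OF v k] .
    finally have "degree (m * \<pi>) \<le> degree m"
      unfolding m' \<pi> by (simp add: mult_ac)
    moreover have "\<pi> \<noteq> 0"
      using \<pi> n0 by auto
    ultimately have "degree \<pi> = 0"
      using m0 by (simp add: degree_mult_eq)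
    then have "\<pi> dvd 1"
      using \<open>\<pi> \<noteq> 0\<close> by (simp add: is_unit_iff_degree)
    then have "n dvd d"
      unfolding \<pi> using mult_dvd_mono[of d d \<pi> 1] by simp
    then show False
      using not_dvd d(1) dvd_trans by blast
  qed
  then have "scale a w \<in> W" if "scale a u \<in> W" "w \<in> U" for a w
  proof -
    obtain k where "a = m * k"
      using \<open>scale a u \<in> W\<close> annD(1)[OF u(2)] by blast
    then show ?thesis
      using M.subspace_scale[OF W, of "scale m w" k] \<open>\<And>w. w \<in> U \<Longrightarrow> scale m w \<in> W\<close>[OF \<open>w \<in> U\<close>]
      by (simp add: mult.commute)
  qed
  with u(1) show ?thesis
    using that by blast
qed

text \<open>
  The analogue for a quotient module of the fact that an element of \<open>GL_d(F_q)\<close> has order at most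
  \<open>q^d - 1\<close>: a dominating element returns to itself within its orbit of nonzero classes.
\<close>

lemma quotient_order_bound:
  fixes scale :: "'b::field poly \<Rightarrow> 'd::ab_group_add \<Rightarrow> 'd"
  assumes "Modules.module scale"
    and U: "Modules.module.subspace scale U" and W: "Modules.module.subspace scale W"
    and reps: "finite R" "card R = N" "2 \<le> N" "0 \<in> R" "\<And>u. u \<in> U \<Longrightarrow> \<exists>r\<in>R. u - r \<in> W"
    and inj: "\<And>u. u \<in> U \<Longrightarrow> scale [:0, 1:] u \<in> W \<Longrightarrow> u \<in> W"
  obtains n where "1 \<le> n" "n \<le> N - 1"
    "\<And>u. u \<in> U \<Longrightarrow> scale (monom 1 n - 1) u \<in> W"
proof -
  interpret M: Modules.module scale
    by fact
  let ?x = "\<lambda>n. monom (1::'b) n"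
  have inj_power: "u \<in> W" if "u \<in> U" "scale (?x n) u \<in> W" for u n
    using that(2)
  proof (induction n)
    case 0
    then show ?case
      by (simp add: monom_0 one_pCons[symmetric])
  next
    case (Suc n)
    have "scale [:0, 1:] (scale (?x n) u) \<in> W"
      using Suc.prems by (simp add: monom_Suc)
    then show ?case
      using inj[of "scale (?x n) u"] M.subspace_scale[OF U that(1)] Suc.IH by blast
  qed
  have orbit: "\<exists>n. 1 \<le> n \<and> n \<le> N - 1 \<and> scale (?x n - 1) u \<in> W" if u: "u \<in> U" for u
  proof (cases "u \<in> W")
    case True
    then show ?thesis
      using reps(3) M.subspace_scale[OF W True] by (intro exI[of _ 1]) auto
  next
    case False
    have "\<exists>r. r \<in> R \<and> scale (?x i) u - r \<in> W" for i
      using reps(5) M.subspace_scale[OF U u] by blast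
    then obtain r where r: "\<And>i. r i \<in> R" "\<And>i. scale (?x i) u - r i \<in> W"
      by metis
    \<comment> \<open>The \<open>N\<close> exponents from 0 to \<open>N - 1\<close> never use the
      representative 0 and so share \<open>N - 1\<close> values: the source of the bound
      \<open>N - 1\<close>.\<close>
    have "r i \<noteq> 0" for i
      using r(2)[of i] inj_power[OF u, of i] False by auto
    then have "r ` {0..N - 1} \<subseteq> R - {0}"
      using r(1) by auto
    then have "card (r ` {0..N - 1}) \<le> card (R - {0})"
      using reps(1) by (intro card_mono) auto
    also have "\<dots> < card {0..N - 1}"
      using reps by (simp add: card_Diff_singleton)
    finally have "\<not> inj_on r {0..N - 1}"
      by (rule pigeonhole)
    then obtain i j where ij: "i < j" "j \<le> N - 1" "r i = r j"
      unfolding inj_on_def by (metis atLeastAtMost_iff linorder_neqE_nat)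
    have "(scale (?x j) u - r j) - (scale (?x i) u - r i) \<in> W"
      by (intro M.subspace_diff[OF W] r)
    moreover have "scale (?x i) (scale (?x (j - i) - 1) u) = scale (?x j) u - scale (?x i) u"
    proof -
      have "?x i * (?x (j - i) - 1) = ?x j - ?x i"
        using ij(1) by (simp add: algebra_simps mult_monom)
      then have "scale (?x i) (scale (?x (j - i) - 1) u) = scale (?x j - ?x i) u"
        by (simp only: M.scale_scale)
      then show ?thesis
        by (simp only: M.scale_left_diff_distrib)
    qed
    ultimately have "scale (?x i) (scale (?x (j - i) - 1) u) \<in> W"
      using ij(3) by simp
    then have "scale (?x (j - i) - 1) u \<in> W"
      using inj_power M.subspace_scale[OF U u] by blast
    then show ?thesis
      using ij by (intro exI[of _ "j - i"]) auto
  qed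
  have bounded: "\<exists>a. a \<noteq> 0 \<and> degree a \<le> N \<and> scale a u \<in> W" if u: "u \<in> U" for u
  proof -
    obtain n where n: "1 \<le> n" "n \<le> N - 1" "scale (?x n - 1) u \<in> W"
      using orbit[OF u] by blast
    have "coeff (?x n - 1) n = 1"
      using n(1) by simp
    then have "?x n - 1 \<noteq> 0"
      by (metis coeff_0 zero_neq_one)
    moreover have "degree (?x n - 1) \<le> N"
      using n(2) by (intro degree_diff_le) (auto intro: order_trans[OF degree_monom_le])
    ultimately show ?thesis
      using n(3) by blast
  qed
  obtain u where u: "u \<in> U" "\<And>a w. scale a u \<in> W \<Longrightarrow> w \<in> U \<Longrightarrow> scale a w \<in> W"
    using dominating_annihilator[OF assms(1) U W bounded] by blast
  show ?thesis
    using orbit[OF u(1)] u(2) that by blast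
qed

lemma CHAR_poly: "CHAR('b::comm_ring_1 poly) = CHAR('b)"
proof -
  have "(of_nat n :: 'b poly) = 0 \<longleftrightarrow> (of_nat n :: 'b) = 0" for n
    by (simp add: of_nat_poly)
  then have "CHAR('b) dvd n \<longleftrightarrow> CHAR('b poly) dvd n" for n
    by (simp add: of_nat_eq_0_iff_char_dvd)
  then show ?thesis
    by (metis dvd_antisym dvd_refl)
qed

section \<open>The F[x]-module structure defined by an endomorphism\<close>

context completed_algebraic_closure
begin

text \<open>\<open>C\<close> as a module over F[x], with the variable acting as
  \<open>\<sigma>\<close>. The type \<open>'a poly\<close> thus serves both as this ring and,
  through \<open>A_scale\<close>, as A.\<close>

definition act :: "('c \<Rightarrow> 'c) \<Rightarrow> 'a poly \<Rightarrow> 'c \<Rightarrow> 'c" where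
  "act \<sigma> p v = (\<Sum>i\<le>degree p. \<kappa> (coeff p i) * (\<sigma> ^^ i) v)"

lemma act_bound:
  "degree p \<le> n \<Longrightarrow> act \<sigma> p v = (\<Sum>i\<le>n. \<kappa> (coeff p i) * (\<sigma> ^^ i) v)"
  unfolding act_def by (rule sum.mono_neutral_left) (auto simp: coeff_eq_0)

lemma act_pCons:
  assumes "isometric_hom \<sigma>" "\<And>c. \<sigma> (\<kappa> c) = \<kappa> c"
  shows "act \<sigma> (pCons c p) v = \<kappa> c * v + \<sigma> (act \<sigma> p v)"
proof -
  have sum: "\<sigma> (\<Sum>i\<in>S. f i) = (\<Sum>i\<in>S. \<sigma> (f i))" for S and f :: "nat \<Rightarrow> 'c"
    by (induction S rule: infinite_finite_induct)
       (simp_all add: isometric_homD[OF assms(1)] isometric_hom_simps[OF assms(1)])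
  have "act \<sigma> (pCons c p) v = (\<Sum>i\<le>Suc (degree p). \<kappa> (coeff (pCons c p) i) * (\<sigma> ^^ i) v)"
    by (rule act_bound) (simp add: degree_pCons_le)
  also have "\<dots> = \<kappa> c * v + \<sigma> (act \<sigma> p v)"
    unfolding sum.atMost_Suc_shift act_def sum by (simp add: isometric_homD[OF assms(1)] assms(2))
  finally show ?thesis .
qed

lemma act_module:
  assumes \<sigma>: "isometric_hom \<sigma>" "\<And>c. \<sigma> (\<kappa> c) = \<kappa> c"
  shows "Modules.module (act \<sigma>)"
proof -
  note s = isometric_homD[OF \<sigma>(1)] isometric_hom_simps[OF \<sigma>(1)]
  have zero: "act \<sigma> 0 v = 0" for v
    by (simp add: act_def)
  have add_right: "act \<sigma> p (v + w) = act \<sigma> p v + act \<sigma> p w" for p v w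
    by (induction p) (simp_all add: zero act_pCons[OF \<sigma>] s algebra_simps)
  have add_left: "act \<sigma> (p + p') v = act \<sigma> p v + act \<sigma> p' v" for p p' v
    by (induction p p' rule: poly_induct2) (simp_all add: zero act_pCons[OF \<sigma>] s \<kappa>_add algebra_simps)
  have smult: "act \<sigma> (smult c p) v = \<kappa> c * act \<sigma> p v" for c p v
    by (induction p) (simp_all add: zero act_pCons[OF \<sigma>] s \<kappa>_mult \<sigma>(2) algebra_simps)
  have mult: "act \<sigma> p (act \<sigma> p' v) = act \<sigma> (p * p') v" for p p' v
    by (induction p) (simp_all add: zero act_pCons[OF \<sigma>] s add_left smult)
  show ?thesis
    by unfold_locales (simp_all add: add_right add_left mult, simp add: one_pCons act_pCons[OF \<sigma>] zero s)
qed

lemma act_monom: "act \<sigma> (monom 1 n) v = (\<sigma> ^^ n) v"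
proof -
  have "act \<sigma> (monom 1 n) v = (\<Sum>i\<le>n. \<kappa> (coeff (monom 1 n) i) * (\<sigma> ^^ i) v)"
    by (rule act_bound) (rule degree_monom_le)
  also have "\<dots> = (\<Sum>i\<le>n. if i = n then (\<sigma> ^^ i) v else 0)"
    by (intro sum.cong) auto
  finally show ?thesis
    by simp
qed

lemma act_in:
  assumes "\<And>v. v \<in> W \<Longrightarrow> \<sigma> v \<in> W" "\<And>v c. v \<in> W \<Longrightarrow> \<kappa> c * v \<in> W"
    "\<And>v w. v \<in> W \<Longrightarrow> w \<in> W \<Longrightarrow> v + w \<in> W" "0 \<in> W" "v \<in> W"
  shows "act \<sigma> p v \<in> W"
proof -
  have "(\<sigma> ^^ i) v \<in> W" for i
    by (induction i) (auto intro: assms)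
  moreover have "sum f S \<in> W" if "\<And>i. f i \<in> W" for f and S :: "nat set"
    by (induction S rule: infinite_finite_induct) (auto intro: assms that)
  ultimately show ?thesis
    unfolding act_def by (simp add: assms(2))
qed

lemma act_subspace:
  assumes \<sigma>: "isometric_hom \<sigma>" "\<And>c. \<sigma> (\<kappa> c) = \<kappa> c"
    and "\<And>v. v \<in> W \<Longrightarrow> \<sigma> v \<in> W" "\<And>v c. v \<in> W \<Longrightarrow> \<kappa> c * v \<in> W"
    "\<And>v w. v \<in> W \<Longrightarrow> w \<in> W \<Longrightarrow> v + w \<in> W" "0 \<in> W"
  shows "Modules.module.subspace (act \<sigma>) W"
proof -
  interpret M: Modules.module "act \<sigma>"
    by (rule act_module[OF \<sigma>])
  show ?thesis
  proof (rule M.subspaceI)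
    show "act \<sigma> p v \<in> W" if "v \<in> W" for p v
      by (rule act_in[of W \<sigma>, OF assms(3-6) that])
    show "v + w \<in> W" if "v \<in> W" "w \<in> W" for v w
      by (rule assms(5)[OF that])
  qed (rule assms(6))
qed

section \<open>Successive minima\<close>

sublocale A: Modules.module "A_scale \<iota>"
  by (rule module_A_scale)

definition ev :: "'a poly \<Rightarrow> 'c" where
  "ev a = \<iota> (poly (map_poly fls_const a) fls_X_inv)"

lemma A_scale_ev: "A_scale \<iota> a z = ev a * z"
  by (simp add: A_scale_def ev_def)

lemma ev_0 [simp]: "ev 0 = 0"
  by (simp add: ev_def)

lemma ev_pCons: "ev (pCons c a) = \<kappa> c + \<iota> fls_X_inv * ev a"
  by (simp add: ev_def \<kappa>_def map_poly_pCons \<iota>_add \<iota>_mult)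

lemma ev_const: "ev [:c:] = \<kappa> c"
  by (simp add: ev_pCons)

lemma ev_add: "ev (a + b) = ev a + ev b"
  using A.scale_left_distrib[of a b 1] by (simp add: A_scale_ev)

lemma ev_diff: "ev (a - b) = ev a - ev b"
  using A.scale_left_diff_distrib[of a b 1] by (simp add: A_scale_ev)

lemma ev_mult: "ev (a * b) = ev a * ev b"
  using A.scale_scale[of a b 1] by (simp add: A_scale_ev)

text \<open>As \<open>|T| > 1\<close> and constants have absolute value at most 1, the leading term
  dominates.\<close>

lemma absv_ev: "a \<noteq> 0 \<Longrightarrow> absv (ev a) = real CARD('a) ^ degree a"
proof (induction a)
  case (pCons c a)
  show ?case
  proof (cases "a = 0")
    case True
    then show ?thesis
      using pCons.hyps by (simp add: ev_const absv_\<kappa>)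
  next
    case False
    then have *: "absv (\<iota> fls_X_inv * ev a) = real CARD('a) ^ Suc (degree a)"
      using pCons.IH by (simp add: absv_mult absv_T)
    have "1 < real CARD('a) ^ Suc (degree a)"
      by (rule one_less_power[OF card_a_gt1]) simp
    then have "absv (\<kappa> c) < absv (\<iota> fls_X_inv * ev a)"
      unfolding * using absv_\<kappa>_le[of c] by linarith
    then have "absv (ev (pCons c a)) = absv (\<iota> fls_X_inv * ev a)"
      unfolding ev_pCons by (subst add.commute) (rule absv_add_eq_left)
    then show ?thesis
      using * False by simp
  qed
qed simp

lemma absv_ev_ge: "a \<noteq> 0 \<Longrightarrow> 1 \<le> absv (ev a)"
  using absv_ev by (simp add: one_le_power)

lemma span_ev: "x \<in> A.span S \<Longrightarrow> ev a * x \<in> A.span S"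
  using A.span_scale[of x S a] by (simp add: A_scale_ev)

end

locale successive_minima = completed_algebraic_closure \<iota>
  for \<iota> :: "'a::{field,finite} fls \<Rightarrow> 'c::{field,complete_space}" +
  fixes \<Lambda> :: "'c set" and r :: nat and lam :: "nat \<Rightarrow> 'c"
  assumes smb: "successive_minimum_basis \<iota> \<Lambda> r lam"
begin

definition comb :: "(nat \<Rightarrow> 'a poly) \<Rightarrow> 'c" where
  "comb f = (\<Sum>i=1..r. ev (f i) * lam i)"

lemma inj_lam: "inj_on lam {1..r}"
  and independent_lam: "A.independent (lam ` {1..r})"
  and span_lam: "A.span (lam ` {1..r}) = \<Lambda>"
  using smb by (auto simp: successive_minimum_basis_def A_basis_def)

lemma lam_minimal:
  "i \<in> {1..r} \<Longrightarrow> x \<in> \<Lambda> \<Longrightarrow> x \<notin> A.span (lam ` {1..<i}) \<Longrightarrow> absv (lam i) \<le> absv x"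
  using smb by (auto simp: successive_minimum_basis_def)

lemma \<Lambda>_eq_comb: "\<Lambda> = range comb"
proof -
  have "\<Lambda> = range (\<lambda>u. \<Sum>v\<in>lam ` {1..r}. A_scale \<iota> (u v) v)"
    unfolding span_lam[symmetric] by (rule A.span_finite) simp
  also have "\<dots> = range comb"
  proof (intro antisym image_subsetI)
    show "(\<Sum>v\<in>lam ` {1..r}. A_scale \<iota> (u v) v) \<in> range comb" for u
      using inj_lam by (intro image_eqI[of _ _ "u \<circ> lam"]) (simp_all add: sum.reindex comb_def A_scale_ev)
    show "comb f \<in> range (\<lambda>u. \<Sum>v\<in>lam ` {1..r}. A_scale \<iota> (u v) v)" for f
      using inj_lam
      by (intro image_eqI[of _ _ "f \<circ> inv_into {1..r} lam"])
         (auto simp: sum.reindex comb_def A_scale_ev intro!: sum.cong)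
  qed
  finally show ?thesis .
qed

lemma lam_notin_span:
  assumes i: "i \<in> {1..r}"
  shows "lam i \<notin> A.span (lam ` {1..<i})"
proof
  assume "lam i \<in> A.span (lam ` {1..<i})"
  then obtain u where u: "lam i = (\<Sum>v\<in>lam ` {1..<i}. A_scale \<iota> (u v) v)"
    by (subst (asm) A.span_finite) auto
  define u' where "u' = u(lam i := - 1)"
  have notin: "lam i \<notin> lam ` {1..<i}"
    using inj_lam i by (auto dest: inj_onD)
  have "(\<Sum>v\<in>insert (lam i) (lam ` {1..<i}). A_scale \<iota> (u' v) v) =
      A_scale \<iota> (- 1) (lam i) + (\<Sum>v\<in>lam ` {1..<i}. A_scale \<iota> (u v) v)"
  proof -
    have "(\<Sum>v\<in>lam ` {1..<i}. A_scale \<iota> (u' v) v) = (\<Sum>v\<in>lam ` {1..<i}. A_scale \<iota> (u v) v)"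
    proof (rule sum.cong)
      fix v assume "v \<in> lam ` {1..<i}"
      then have "v \<noteq> lam i"
        using notin by blast
      then show "A_scale \<iota> (u' v) v = A_scale \<iota> (u v) v"
        by (simp add: u'_def)
    qed simp
    then show ?thesis
      using notin by (simp add: u'_def)
  qed
  also have "\<dots> = 0"
    using u by (simp flip: u)
  finally have *: "(\<Sum>v\<in>insert (lam i) (lam ` {1..<i}). A_scale \<iota> (u' v) v) = 0" .
  have "u' (lam i) = 0"
    by (rule A.independentD[OF independent_lam _ _ *]) (use i in auto)
  then show False
    by (simp add: u'_def)
qed

lemma lam_in: "i \<in> {1..r} \<Longrightarrow> lam i \<in> \<Lambda>"
  unfolding span_lam[symmetric] by (intro A.span_base) auto

lemma absv_lam_mono:
  assumes "i \<in> {1..r}" "j \<in> {1..r}" "i \<le> j"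
  shows "absv (lam i) \<le> absv (lam j)"
proof (rule lam_minimal)
  have "A.span (lam ` {1..<i}) \<subseteq> A.span (lam ` {1..<j})"
    using assms by (intro A.span_mono) auto
  then show "lam j \<notin> A.span (lam ` {1..<i})"
    using lam_notin_span[OF assms(2)] by blast
qed (use assms lam_in in auto)

lemma lam_nonzero: "i \<in> {1..r} \<Longrightarrow> lam i \<noteq> 0"
  using lam_notin_span A.span_zero by metis

text \<open>
  Cancellation among leading terms would give a vector outside the span of
  \<open>lam 1, ..., lam (k - 1)\<close> that is shorter than \<open>lam k\<close>.
\<close>

lemma orthogonal:
  assumes j: "j \<in> {1..r}"
  shows "absv (ev (f j) * lam j) \<le> absv (comb f)"
proof (rule ccontr)
  assume "\<not> absv (ev (f j) * lam j) \<le> absv (comb f)"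
  define \<mu> where "\<mu> = Max ((\<lambda>i. absv (ev (f i) * lam i)) ` {1..r})"
  have le: "absv (ev (f i) * lam i) \<le> \<mu>" if "i \<in> {1..r}" for i
    unfolding \<mu>_def using that by (intro Max_ge) auto
  have less: "absv (comb f) < \<mu>"
    using le[OF j] \<open>\<not> _\<close> by simp
  then have \<mu>_pos: "\<mu> > 0"
    using absv_nonneg[of "comb f"] by linarith
  define S where "S = {i\<in>{1..r}. absv (ev (f i) * lam i) = \<mu>}"
  have "\<mu> \<in> (\<lambda>i. absv (ev (f i) * lam i)) ` {1..r}"
    unfolding \<mu>_def using j by (intro Max_in) auto
  then have "S \<noteq> {}" "finite S"
    by (auto simp: S_def)
  define k where "k = Max S"
  have kS: "k \<in> S"
    unfolding k_def using \<open>S \<noteq> {}\<close> \<open>finite S\<close> by (intro Max_in)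
  then have k: "k \<in> {1..r}"
    by (simp add: S_def)
  have S_le: "i \<le> k" if "i \<in> S" for i
    unfolding k_def using that \<open>finite S\<close> by (intro Max_ge)
  have f0: "f i \<noteq> 0" if "i \<in> S" for i
    using that \<mu>_pos by (auto simp: S_def)
  let ?d = "\<lambda>i. degree (f i)"
  let ?c = "\<lambda>i. coeff (f i) (?d i)"
  let ?q = "real CARD('a)"
  have S_eq: "?q ^ ?d i * absv (lam i) = \<mu>" if "i \<in> S" for i
    using that f0[OF that] by (simp add: S_def absv_mult absv_ev)
  \<comment> \<open>\<open>k\<close> is the last index in \<open>S\<close>, so \<open>lam k\<close>
    is longest among the vectors there and carries the polynomial of least degree. Hence all leading
    monomials can be divided by that of \<open>f k\<close>.\<close>
  have d_le: "?d k \<le> ?d i" if "i \<in> S" for i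
  proof (rule ccontr)
    assume "\<not> ?d k \<le> ?d i"
    then have "?q ^ ?d i < ?q ^ ?d k"
      by (intro power_strict_increasing card_a_gt1) auto
    moreover have "absv (lam i) \<le> absv (lam k)"
      using absv_lam_mono[OF _ k S_le[OF that]] that by (simp add: S_def)
    moreover have "0 < absv (lam i)"
      using that lam_nonzero by (simp add: S_def)
    ultimately have "?q ^ ?d i * absv (lam i) < ?q ^ ?d k * absv (lam k)"
      by (intro mult_less_le_imp_less) auto
    then show False
      using S_eq[OF that] S_eq[OF kS] by simp
  qed
  have lead: "absv (ev (f i - monom (?c i) (?d i)) * lam i) < \<mu>" if "i \<in> S" for i
  proof (cases "f i - monom (?c i) (?d i) = 0")
    case True
    then show ?thesis
      using \<mu>_pos by simp
  next
    case False
    have "degree (f i - monom (?c i) (?d i)) \<le> ?d i"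
      by (intro degree_diff_le) (auto intro: degree_monom_le)
    moreover have "coeff (f i - monom (?c i) (?d i)) (?d i) = 0"
      by simp
    ultimately have "degree (f i - monom (?c i) (?d i)) < ?d i"
      using False by (metis le_neq_implies_less leading_coeff_0_iff)
    then have "?q ^ degree (f i - monom (?c i) (?d i)) < ?q ^ ?d i"
      by (intro power_strict_increasing card_a_gt1)
    then have "absv (ev (f i - monom (?c i) (?d i))) * absv (lam i) < ?q ^ ?d i * absv (lam i)"
      unfolding absv_ev[OF False] using that lam_nonzero
      by (intro mult_strict_right_mono) (auto simp: S_def)
    then show ?thesis
      using S_eq[OF that] by (simp add: absv_mult)
  qed
  \<comment> \<open>\<open>x\<close> collects the leading terms of maximal size, divided by the
    leading monomial of \<open>f k\<close>; thus \<open>lam k\<close> enters it with coefficient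
    1.\<close>
  define g where "g = (\<lambda>i. monom (?c i / ?c k) (?d i - ?d k))"
  define x where "x = (\<Sum>i\<in>S. ev (g i) * lam i)"
  have ck: "?c k \<noteq> 0"
    using f0[OF kS] by simp
  have "ev (monom (?c k) (?d k)) * x = (\<Sum>i\<in>S. ev (monom (?c i) (?d i)) * lam i)"
    unfolding x_def sum_distrib_left
  proof (rule sum.cong)
    fix i assume i: "i \<in> S"
    have "monom (?c k) (?d k) * g i = monom (?c i) (?d i)"
      using d_le[OF i] ck by (simp add: g_def mult_monom)
    then show "ev (monom (?c k) (?d k)) * (ev (g i) * lam i) = ev (monom (?c i) (?d i)) * lam i"
      by (simp flip: ev_mult mult.assoc)
  qed simp
  \<comment> \<open>The leading terms differ from \<open>comb f\<close> by summands smaller than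
    \<open>\<mu>\<close>, and \<open>comb f\<close> is smaller than \<open>\<mu>\<close> by
    cancellation.\<close>
  also have "\<dots> = comb f - (\<Sum>i\<in>{1..r} - S. ev (f i) * lam i)
      - (\<Sum>i\<in>S. ev (f i - monom (?c i) (?d i)) * lam i)"
  proof -
    have "comb f = (\<Sum>i\<in>{1..r} - S. ev (f i) * lam i) + (\<Sum>i\<in>S. ev (f i) * lam i)"
      unfolding comb_def by (rule sum.subset_diff) (auto simp: S_def)
    then show ?thesis
      by (simp add: ev_diff left_diff_distrib sum_subtractf)
  qed
  also have "absv \<dots> < \<mu>"
  proof (intro absv_diff_less absv_sum_less less \<mu>_pos lead)
    fix i assume "i \<in> {1..r} - S"
    then show "absv (ev (f i) * lam i) < \<mu>"
      using le[of i] by (auto simp: S_def)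
  qed
  also have "\<mu> = ?q ^ ?d k * absv (lam k)"
    using S_eq[OF kS] by simp
  finally have "?q ^ ?d k * absv x < ?q ^ ?d k * absv (lam k)"
    using ck by (simp add: absv_mult absv_ev degree_monom_eq)
  then have "absv x < absv (lam k)"
    by simp
  moreover have "x \<in> \<Lambda>"
    unfolding x_def span_lam[symmetric] using kS
    by (intro A.span_sum span_ev A.span_base) (auto simp: S_def)
  moreover have "x \<notin> A.span (lam ` {1..<k})"
  proof
    assume x: "x \<in> A.span (lam ` {1..<k})"
    have "g k = 1"
      using ck by (simp add: g_def monom_0 one_pCons)
    then have "lam k = x - (\<Sum>i\<in>S - {k}. ev (g i) * lam i)"
      unfolding x_def using kS \<open>finite S\<close> by (simp add: sum.remove ev_const one_pCons)
    also have "\<dots> \<in> A.span (lam ` {1..<k})"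
    proof (intro A.span_diff x A.span_sum span_ev A.span_base)
      fix i assume "i \<in> S - {k}"
      then show "lam i \<in> lam ` {1..<k}"
        using S_le[of i] by (auto simp: S_def)
    qed
    finally show False
      using lam_notin_span[OF k] by contradiction
  qed
  ultimately show False
    using lam_minimal[OF k] by (meson not_le)
qed

text \<open>By \<open>orthogonal\<close>, a bounded lattice element has coordinates of bounded
  degree, and over the finite field F there are finitely many of these.\<close>

lemma finite_ball: "finite {x \<in> \<Lambda>. absv x \<le> R}"
proof -
  define \<epsilon> where "\<epsilon> = Min (insert 1 ((\<lambda>i. absv (lam i)) ` {1..r}))"
  have \<epsilon>: "\<epsilon> > 0"
    unfolding \<epsilon>_def using lam_nonzero by (subst Min_gr_iff) auto
  have \<epsilon>_le: "\<epsilon> \<le> absv (lam i)" if "i \<in> {1..r}" for i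
    unfolding \<epsilon>_def using that by (intro Min_le) auto
  obtain D where D: "R / \<epsilon> < real CARD('a) ^ D"
    using real_arch_pow[OF card_a_gt1] by blast
  let ?P = "{1..r} \<rightarrow>\<^sub>E {p :: 'a poly. degree p \<le> D}"
  have "{x \<in> \<Lambda>. absv x \<le> R} \<subseteq> comb ` ?P"
  proof
    fix x assume "x \<in> {x \<in> \<Lambda>. absv x \<le> R}"
    then obtain f where f: "x = comb f" "absv (comb f) \<le> R"
      by (auto simp: \<Lambda>_eq_comb)
    have "degree (f i) \<le> D" if i: "i \<in> {1..r}" for i
    proof (rule ccontr)
      assume D': "\<not> degree (f i) \<le> D"
      then have "f i \<noteq> 0"
        by auto
      have "real CARD('a) ^ D \<le> real CARD('a) ^ degree (f i)"
        using D' card_a_gt1 by (intro power_increasing) linarith+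
      then have "R / \<epsilon> < absv (ev (f i))"
        using D \<open>f i \<noteq> 0\<close> by (simp add: absv_ev)
      then have "R < absv (ev (f i)) * \<epsilon>"
        using \<epsilon> by (simp add: field_simps)
      also have "\<dots> \<le> absv (ev (f i) * lam i)"
        unfolding absv_mult using \<epsilon>_le[OF i] by (intro mult_left_mono) auto
      also have "\<dots> \<le> R"
        using orthogonal[OF i, of f] f(2) by linarith
      finally show False
        by simp
    qed
    then have "restrict f {1..r} \<in> ?P"
      by auto
    moreover have "x = comb (restrict f {1..r})"
      unfolding f(1) comb_def by (intro sum.cong) auto
    ultimately show "x \<in> comb ` ?P"
      by blast
  qed
  moreover have "finite ?P"
    by (intro finite_PiE finite_polys_degree_le) simp
  ultimately show ?thesis
    by (meson finite_imageI finite_subset)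
qed

end

section \<open>Automorphisms of the lattice\<close>

context successive_minima
begin

lemma comb_add: "comb f + comb g = comb (\<lambda>i. f i + g i)"
  by (simp add: comb_def ev_add distrib_right sum.distrib)

lemma comb_ev: "ev a * comb f = comb (\<lambda>i. a * f i)"
  by (simp add: comb_def ev_mult sum_distrib_left mult.assoc)

lemma comb_0: "comb (\<lambda>i. 0) = 0"
  by (simp add: comb_def)

lemma comb_lam: "i \<in> {1..r} \<Longrightarrow> comb (\<lambda>j. if j = i then 1 else 0) = lam i"
proof -
  assume "i \<in> {1..r}"
  have "comb (\<lambda>j. if j = i then 1 else 0) = (\<Sum>j=1..r. if j = i then lam j else 0)"
    unfolding comb_def using ev_const[of 1] by (intro sum.cong) (auto simp: one_pCons)
  then show ?thesis
    using \<open>i \<in> {1..r}\<close> by simp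
qed

text \<open>\<open>lev i\<close> abstracts the number of the packet containing \<open>lam i\<close>:
  levels are compared as absolute values are.\<close>

context
  fixes \<sigma> :: "'c \<Rightarrow> 'c" and lev :: "nat \<Rightarrow> nat" and t :: nat
  assumes \<sigma>: "isometric_hom \<sigma>" "\<And>a. \<sigma> (\<iota> a) = \<iota> a"
    and \<sigma>_\<Lambda>: "\<And>x. x \<in> \<Lambda> \<Longrightarrow> \<sigma> x \<in> \<Lambda>"
    and lev: "\<And>i. i \<in> {1..r} \<Longrightarrow> lev i \<in> {1..t}"
    and lev_less: "\<And>i j. i \<in> {1..r} \<Longrightarrow> j \<in> {1..r} \<Longrightarrow>
      lev i < lev j \<longleftrightarrow> absv (lam i) < absv (lam j)"
begin

lemma \<kappa>_diff: "\<kappa> (a - b) = \<kappa> a - \<kappa> b"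
  using \<kappa>_add[of "a - b" b] by simp

lemma \<sigma>_\<kappa>: "\<sigma> (\<kappa> c) = \<kappa> c"
  by (simp add: \<kappa>_def \<sigma>(2))

lemma \<sigma>_ev: "\<sigma> (ev a) = ev a"
  by (simp add: ev_def \<sigma>(2))

lemmas \<sigma>_simps = isometric_homD[OF \<sigma>(1)] isometric_hom_simps[OF \<sigma>(1)] \<sigma>_\<kappa> \<sigma>_ev

lemma \<sigma>_sum: "\<sigma> (\<Sum>i\<in>S. f i) = (\<Sum>i\<in>S. \<sigma> (f i))"
  by (induction S rule: infinite_finite_induct) (simp_all add: \<sigma>_simps)

text \<open>The A-span of the first \<open>k\<close> packets; a filtration from 0 to the whole
  lattice.\<close>

definition V :: "nat \<Rightarrow> 'c set" where
  "V k = {comb f | f. \<forall>i\<in>{1..r}. f i \<noteq> 0 \<longrightarrow> lev i \<le> k}"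

text \<open>For \<open>k \<ge> 1\<close> this is \<open>V (k - 1)\<close> plus the F-span of packet
  \<open>k\<close>. Modulo \<open>V (k - 1)\<close> it is finite, unlike \<open>V k\<close>, so
  orbits of \<open>\<sigma>\<close> can be counted there.\<close>

definition U :: "nat \<Rightarrow> 'c set" where
  "U k = {comb f | f. \<forall>i\<in>{1..r}. f i \<noteq> 0 \<longrightarrow> lev i < k \<or> lev i = k \<and> degree (f i) = 0}"

lemma VI: "(\<And>i. i \<in> {1..r} \<Longrightarrow> f i \<noteq> 0 \<Longrightarrow> lev i \<le> k) \<Longrightarrow> comb f \<in> V k"
  by (auto simp: V_def)

lemma VE:
  assumes "x \<in> V k"
  obtains f where "x = comb f" "\<And>i. i \<in> {1..r} \<Longrightarrow> f i \<noteq> 0 \<Longrightarrow> lev i \<le> k"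
  using assms by (auto simp: V_def)

lemma UI:
  "(\<And>i. i \<in> {1..r} \<Longrightarrow> f i \<noteq> 0 \<Longrightarrow> lev i < k \<or> lev i = k \<and> degree (f i) = 0) \<Longrightarrow>
    comb f \<in> U k"
  unfolding U_def by blast

lemma UE:
  assumes "x \<in> U k"
  obtains f where "x = comb f"
    "\<And>i. i \<in> {1..r} \<Longrightarrow> f i \<noteq> 0 \<Longrightarrow> lev i < k \<or> lev i = k \<and> degree (f i) = 0"
  using assms unfolding U_def by blast

lemma V_0: "0 \<in> V k"
  using VI[of "\<lambda>_. 0"] by (simp add: comb_0)

lemma V_add: "x \<in> V k \<Longrightarrow> y \<in> V k \<Longrightarrow> x + y \<in> V k"
proof (elim VE)
  fix f g assume x: "x = comb f" and y: "y = comb g"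
    and f: "\<And>i. i \<in> {1..r} \<Longrightarrow> f i \<noteq> 0 \<Longrightarrow> lev i \<le> k"
    and g: "\<And>i. i \<in> {1..r} \<Longrightarrow> g i \<noteq> 0 \<Longrightarrow> lev i \<le> k"
  show "x + y \<in> V k"
    unfolding x y comb_add
  proof (rule VI)
    fix i assume i: "i \<in> {1..r}" "f i + g i \<noteq> 0"
    then show "lev i \<le> k"
      using f[OF i(1)] g[OF i(1)] by (cases "f i = 0") auto
  qed
qed

lemma V_ev: "x \<in> V k \<Longrightarrow> ev a * x \<in> V k"
  by (elim VE) (auto simp: comb_ev intro!: VI)

lemma V_\<kappa>: "x \<in> V k \<Longrightarrow> \<kappa> c * x \<in> V k"
  using V_ev[of x k "[:c:]"] by (simp add: ev_const)

lemma V_sum: "(\<And>i. i \<in> S \<Longrightarrow> g i \<in> V k) \<Longrightarrow> sum g S \<in> V k"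
  by (induction S rule: infinite_finite_induct) (auto intro: V_0 V_add)

lemma V_mono: "k \<le> l \<Longrightarrow> V k \<subseteq> V l"
  by (auto elim!: VE intro!: VI intro: order_trans)

lemma V_subset_\<Lambda>: "V k \<subseteq> \<Lambda>"
  by (auto simp: V_def \<Lambda>_eq_comb)

lemma V_top: "V t = \<Lambda>"
  using lev by (auto simp: V_def \<Lambda>_eq_comb)

lemma V_bot: "V 0 = {0}"
proof -
  have "comb f = 0" if "\<forall>i\<in>{1..r}. f i \<noteq> 0 \<longrightarrow> lev i \<le> 0" for f
    unfolding comb_def
  proof (rule sum.neutral, rule ballI)
    fix i assume i: "i \<in> {1..r}"
    then have "f i = 0"
      using that lev[OF i] by force
    then show "ev (f i) * lam i = 0"
      by simp
  qed
  then have "V 0 \<subseteq> {0}"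
    unfolding V_def by blast
  then show ?thesis
    using V_0 by blast
qed

lemma lam_V: "i \<in> {1..r} \<Longrightarrow> lam i \<in> V (lev i)"
  by (subst comb_lam[symmetric]) (auto intro!: VI split: if_splits)

lemma lam_U: "i \<in> {1..r} \<Longrightarrow> lam i \<in> U (lev i)"
  by (subst comb_lam[symmetric]) (auto intro!: UI split: if_splits)

lemma U_0: "0 \<in> U k"
  using UI[of "\<lambda>_. 0"] by (simp add: comb_0)

lemma U_add: "x \<in> U k \<Longrightarrow> y \<in> U k \<Longrightarrow> x + y \<in> U k"
proof (elim UE)
  fix f g assume x: "x = comb f" and y: "y = comb g"
    and f: "\<And>i. i \<in> {1..r} \<Longrightarrow> f i \<noteq> 0 \<Longrightarrow> lev i < k \<or> lev i = k \<and> degree (f i) = 0"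
    and g: "\<And>i. i \<in> {1..r} \<Longrightarrow> g i \<noteq> 0 \<Longrightarrow> lev i < k \<or> lev i = k \<and> degree (g i) = 0"
  show "x + y \<in> U k"
    unfolding x y comb_add
  proof (rule UI)
    fix i assume i: "i \<in> {1..r}" "f i + g i \<noteq> 0"
    have "degree (f i + g i) = 0" if "degree (f i) = 0" "degree (g i) = 0"
      using degree_add_le[of "f i" 0 "g i"] that by simp
    then show "lev i < k \<or> lev i = k \<and> degree (f i + g i) = 0"
      using f[OF i(1)] g[OF i(1)] i(2) by (cases "f i = 0"; cases "g i = 0") auto
  qed
qed

lemma U_\<kappa>: "x \<in> U k \<Longrightarrow> \<kappa> c * x \<in> U k"
proof (elim UE)
  fix f assume x: "x = comb f"
    and f: "\<And>i. i \<in> {1..r} \<Longrightarrow> f i \<noteq> 0 \<Longrightarrow> lev i < k \<or> lev i = k \<and> degree (f i) = 0"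
  show "\<kappa> c * x \<in> U k"
    unfolding x ev_const[symmetric] comb_ev
  proof (rule UI)
    fix i assume i: "i \<in> {1..r}" "[:c:] * f i \<noteq> 0"
    then show "lev i < k \<or> lev i = k \<and> degree ([:c:] * f i) = 0"
      using f[OF i(1)] by (auto simp: degree_smult_eq)
  qed
qed

lemma U_sum: "(\<And>i. i \<in> S \<Longrightarrow> g i \<in> U k) \<Longrightarrow> sum g S \<in> U k"
  by (induction S rule: infinite_finite_induct) (auto intro: U_0 U_add)

lemma U_subset_V: "U k \<subseteq> V k"
  by (auto elim!: UE intro!: VI)

lemma V_subset_U: "1 \<le> k \<Longrightarrow> V (k - 1) \<subseteq> U k"
  by (fastforce elim!: VE intro!: UI)

text \<open>Isometry and orthogonality give \<open>|a| * |lam j| \<le> |lam i|\<close> for the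
  coefficient \<open>a\<close> of \<open>lam j\<close> in the image. So \<open>a\<close> vanishes on
  later packets and is constant on the same packet.\<close>

lemma \<sigma>_lam:
  assumes i: "i \<in> {1..r}"
  shows "\<sigma> (lam i) \<in> U (lev i)"
proof -
  have "\<sigma> (lam i) \<in> \<Lambda>"
    using \<sigma>_\<Lambda> lam_in[OF i] by blast
  then obtain g where g: "\<sigma> (lam i) = comb g"
    by (auto simp: \<Lambda>_eq_comb)
  show ?thesis
    unfolding g
  proof (rule UI)
    fix j assume j: "j \<in> {1..r}" "g j \<noteq> 0"
    have "absv (ev (g j)) * absv (lam j) \<le> absv (lam i)"
      using orthogonal[OF j(1), of g] by (simp add: absv_mult \<sigma>_simps flip: g)
    moreover have "1 * absv (lam j) \<le> absv (ev (g j)) * absv (lam j)"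
      using absv_ev_ge[OF j(2)] by (intro mult_right_mono) auto
    ultimately have "absv (lam j) \<le> absv (lam i)"
      by simp
    then have "lev j \<le> lev i"
      using lev_less[OF i j(1)] by (auto simp: not_less[symmetric])
    moreover have "degree (g j) = 0" if "lev j = lev i"
    proof (rule ccontr)
      assume "degree (g j) \<noteq> 0"
      then have "1 < absv (ev (g j))"
        unfolding absv_ev[OF j(2)] by (intro one_less_power card_a_gt1) simp
      moreover have "0 < absv (lam j)"
        using lam_nonzero[OF j(1)] by simp
      ultimately have "1 * absv (lam j) < absv (ev (g j)) * absv (lam j)"
        by (intro mult_strict_right_mono)
      then have "absv (lam j) < absv (lam i)"
        using \<open>absv (ev (g j)) * absv (lam j) \<le> absv (lam i)\<close> by simp
      then show False
        using lev_less[OF j(1) i] that by simp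
    qed
    ultimately show "lev j < lev i \<or> lev j = lev i \<and> degree (g j) = 0"
      by auto
  qed
qed

lemma \<sigma>_comb: "\<sigma> (comb f) = (\<Sum>i=1..r. ev (f i) * \<sigma> (lam i))"
  by (simp add: comb_def \<sigma>_sum \<sigma>_simps)

lemma \<sigma>_V: "x \<in> V k \<Longrightarrow> \<sigma> x \<in> V k"
proof (elim VE)
  fix f assume x: "x = comb f" and f: "\<And>i. i \<in> {1..r} \<Longrightarrow> f i \<noteq> 0 \<Longrightarrow> lev i \<le> k"
  show "\<sigma> x \<in> V k"
    unfolding x \<sigma>_comb
  proof (rule V_sum)
    fix i assume i: "i \<in> {1..r}"
    show "ev (f i) * \<sigma> (lam i) \<in> V k"
    proof (cases "f i = 0")
      case True
      then show ?thesis
        by (simp add: V_0)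
    next
      case False
      then show ?thesis
        using \<sigma>_lam[OF i] U_subset_V V_mono[OF f[OF i False]] by (intro V_ev) blast
    qed
  qed
qed

lemma \<sigma>_U:
  assumes "1 \<le> k"
  shows "x \<in> U k \<Longrightarrow> \<sigma> x \<in> U k"
proof (elim UE)
  fix f assume x: "x = comb f"
    and f: "\<And>i. i \<in> {1..r} \<Longrightarrow> f i \<noteq> 0 \<Longrightarrow> lev i < k \<or> lev i = k \<and> degree (f i) = 0"
  show "\<sigma> x \<in> U k"
    unfolding x \<sigma>_comb
  proof (rule U_sum)
    fix i assume i: "i \<in> {1..r}"
    consider "f i = 0" | "lev i < k" | "lev i = k" "degree (f i) = 0"
      using f[OF i] by metis
    then show "ev (f i) * \<sigma> (lam i) \<in> U k"
    proof cases
      case 1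
      then show ?thesis
        by (simp add: U_0)
    next
      case 2
      then have "\<sigma> (lam i) \<in> V (k - 1)"
        using \<sigma>_lam[OF i] U_subset_V[of "lev i"] V_mono[of "lev i" "k - 1"] by fastforce
      then show ?thesis
        using V_ev V_subset_U[OF assms] by blast
    next
      case 3
      obtain c where "f i = [:c:]"
        using 3(2) by (rule degree_eq_zeroE)
      then show ?thesis
        using \<sigma>_lam[OF i] 3(1) by (simp add: ev_const U_\<kappa>)
    qed
  qed
qed

text \<open>\<open>\<sigma>\<close> maps the finite balls of \<open>V k\<close> injectively to
  themselves, hence onto.\<close>

lemma \<sigma>_surj_V:
  assumes "v \<in> V k"
  obtains w where "w \<in> V k" "\<sigma> w = v"
proof -
  let ?F = "{x \<in> V k. absv x \<le> absv v}"
  have "finite ?F"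
    using finite_ball[of "absv v"] by (rule rev_finite_subset) (use V_subset_\<Lambda> in auto)
  moreover have "\<sigma> ` ?F \<subseteq> ?F"
    using \<sigma>_V by (auto simp: \<sigma>_simps)
  moreover have "inj_on \<sigma> ?F"
    by (auto simp: inj_on_def \<sigma>_simps)
  ultimately have "\<sigma> ` ?F = ?F"
    by (rule endo_inj_surj)
  then have "v \<in> \<sigma> ` ?F"
    using assms by auto
  then show ?thesis
    using that by blast
qed

interpretation S: Modules.module "act \<sigma>"
  by (rule act_module[OF \<sigma>(1) \<sigma>_\<kappa>])

text \<open>\<open>quotient_order_bound\<close> is applied to \<open>U k\<close> modulo
  \<open>V (k - 1)\<close>; the result then spreads from the basis vectors to \<open>V k\<close> by
  A-linearity of \<open>\<sigma>\<close>.\<close>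

lemma block_order:
  assumes k: "k \<in> {1..t}" and nonempty: "\<exists>i\<in>{1..r}. lev i = k"
  obtains n where "1 \<le> n" "n \<le> CARD('a) ^ card {i\<in>{1..r}. lev i = k} - 1"
    "\<And>v. v \<in> V k \<Longrightarrow> act \<sigma> (monom 1 n - 1) v \<in> V (k - 1)"
proof -
  let ?I = "{i\<in>{1..r}. lev i = k}"
  define N where "N = CARD('a) ^ card ?I"
  define rep where "rep = (\<lambda>c. \<Sum>i\<in>?I. \<kappa> (c i) * lam i)"
  let ?C = "?I \<rightarrow>\<^sub>E (UNIV :: 'a set)"
  have I: "finite ?I" "?I \<noteq> {}"
    using nonempty by auto
  \<comment> \<open>Orthogonality separates the constant combinations, so there are exactly
    \<open>N\<close> of them.\<close>
  have "inj_on rep ?C"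
  proof (rule inj_onI)
    fix c c' assume c: "c \<in> ?C" "c' \<in> ?C" "rep c = rep c'"
    let ?f = "\<lambda>i. if i \<in> ?I then [:c i - c' i:] else 0"
    have "comb ?f = (\<Sum>i\<in>?I. ev [:c i - c' i:] * lam i)"
      unfolding comb_def by (intro sum.mono_neutral_cong_right) auto
    also have "\<dots> = rep c - rep c'"
      by (simp add: rep_def ev_const \<kappa>_diff left_diff_distrib sum_subtractf)
    finally have "comb ?f = 0"
      using c(3) by simp
    have "c i - c' i = 0" if i: "i \<in> ?I" for i
    proof -
      have "absv (\<kappa> (c i - c' i) * lam i) \<le> 0"
        using orthogonal[of i ?f] i \<open>comb ?f = 0\<close> by (simp add: ev_const)
      then show ?thesis
        using lam_nonzero[of i] i order_antisym[OF _ absv_nonneg] absv_eq_0_iff by fastforce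
    qed
    then show "c = c'"
      using c(1,2) by (intro PiE_ext[of c ?I "\<lambda>_. UNIV" c']) auto
  qed
  then have "card (rep ` ?C) = card ?C"
    by (rule card_image)
  also have "\<dots> = N"
    using I(1) by (simp add: card_PiE N_def)
  finally have card: "card (rep ` ?C) = N" .
  have U_sub: "S.subspace (U k)" and V_sub: "S.subspace (V (k - 1))"
    using k by (auto intro!: act_subspace \<sigma>(1) \<sigma>_\<kappa> \<sigma>_U U_\<kappa> U_add U_0 \<sigma>_V V_\<kappa> V_add V_0)
  obtain n where n: "1 \<le> n" "n \<le> N - 1"
    "\<And>u. u \<in> U k \<Longrightarrow> act \<sigma> (monom 1 n - 1) u \<in> V (k - 1)"
  proof (rule quotient_order_bound[OF S.module_axioms U_sub V_sub _ card])
    show "finite (rep ` ?C)"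
      using I(1) by (intro finite_imageI finite_PiE) auto
    show "2 \<le> N"
    proof -
      have "CARD('a) ^ 1 \<le> N"
        unfolding N_def using I card_a_ge2 by (intro power_increasing) (auto simp: Suc_le_eq card_gt_0_iff)
      then show ?thesis
        using card_a_ge2 by simp
    qed
    show "0 \<in> rep ` ?C"
      by (intro image_eqI[of _ _ "\<lambda>i\<in>?I. 0"]) (auto simp: rep_def)
    show "\<exists>r\<in>rep ` ?C. u - r \<in> V (k - 1)" if u: "u \<in> U k" for u
    proof -
      obtain f where f: "u = comb f"
        "\<And>i. i \<in> {1..r} \<Longrightarrow> f i \<noteq> 0 \<Longrightarrow> lev i < k \<or> lev i = k \<and> degree (f i) = 0"
        using UE[OF u] by metis
      define c where "c = (\<lambda>i\<in>?I. coeff (f i) 0)"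
      have fc: "ev (f i) = \<kappa> (c i)" if i: "i \<in> ?I" for i
      proof -
        have "degree (f i) = 0"
          using f(2)[of i] i by (cases "f i = 0") auto
        then obtain d where "f i = [:d:]"
          by (rule degree_eq_zeroE)
        then show ?thesis
          using i by (simp add: c_def ev_const)
      qed
      have "u - rep c = (\<Sum>i\<in>{1..r} - ?I. ev (f i) * lam i)"
      proof -
        have "u = (\<Sum>i\<in>{1..r} - ?I. ev (f i) * lam i) + (\<Sum>i\<in>?I. ev (f i) * lam i)"
          unfolding f(1) comb_def by (rule sum.subset_diff) auto
        moreover have "(\<Sum>i\<in>?I. ev (f i) * lam i) = rep c"
          unfolding rep_def using fc by (intro sum.cong) auto
        ultimately show ?thesis
          by simp
      qed
      also have "\<dots> \<in> V (k - 1)"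
      proof (rule V_sum)
        fix i assume i: "i \<in> {1..r} - ?I"
        show "ev (f i) * lam i \<in> V (k - 1)"
        proof (cases "f i = 0")
          case True
          then show ?thesis
            by (simp add: V_0)
        next
          case False
          then have "lev i \<le> k - 1"
            using f(2)[of i] i by auto
          then show ?thesis
            using lam_V[of i] V_mono i by (intro V_ev) auto
        qed
      qed
      finally have "u - rep c \<in> V (k - 1)" .
      moreover have "c \<in> ?C"
        unfolding c_def restrict_PiE_iff by simp
      ultimately show ?thesis
        by blast
    qed
    \<comment> \<open>Since \<open>\<sigma>\<close> is onto on \<open>V (k - 1)\<close>, an image in
      that submodule has a preimage in it, which is \<open>u\<close> by injectivity.\<close>
    show "u \<in> V (k - 1)" if u: "u \<in> U k" "act \<sigma> [:0, 1:] u \<in> V (k - 1)" for u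
    proof -
      have "act \<sigma> [:0, 1:] u = \<sigma> u"
        using act_monom[of \<sigma> 1 u] by (simp add: monom_altdef)
      then obtain w where "w \<in> V (k - 1)" "\<sigma> w = \<sigma> u"
        using \<sigma>_surj_V u(2) by metis
      then show ?thesis
        by (simp add: \<sigma>_simps)
    qed
  qed blast
  have act: "act \<sigma> (monom 1 n - 1) v = (\<sigma> ^^ n) v - v" for v
    using S.scale_left_diff_distrib[of "monom 1 n" 1 v] by (simp add: act_monom)
  \<comment> \<open>Powers of \<open>\<sigma>\<close> are A-linear; this takes the congruence from
    \<open>U k\<close> to \<open>V k\<close>.\<close>
  have ev: "(\<sigma> ^^ n) (ev a * v) = ev a * (\<sigma> ^^ n) v" for a v
    by (induction n) (simp_all add: \<sigma>_simps)
  have "act \<sigma> (monom 1 n - 1) v \<in> V (k - 1)" if v: "v \<in> V k" for v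
  proof -
    obtain f where f: "v = comb f" "\<And>i. i \<in> {1..r} \<Longrightarrow> f i \<noteq> 0 \<Longrightarrow> lev i \<le> k"
      using VE[OF v] by metis
    have "act \<sigma> (monom 1 n - 1) v = (\<Sum>i=1..r. act \<sigma> (monom 1 n - 1) (ev (f i) * lam i))"
      unfolding f(1) comb_def by (rule S.scale_sum_right)
    also have "\<dots> = (\<Sum>i=1..r. ev (f i) * act \<sigma> (monom 1 n - 1) (lam i))"
      by (simp add: act ev right_diff_distrib)
    also have "\<dots> \<in> V (k - 1)"
    proof (rule V_sum)
      fix i assume i: "i \<in> {1..r}"
      consider "f i = 0" | "lev i = k" | "lev i \<le> k - 1"
        using f(2)[OF i] by fastforce
      then show "ev (f i) * act \<sigma> (monom 1 n - 1) (lam i) \<in> V (k - 1)"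
      proof cases
        case 1
        then show ?thesis
          by (simp add: V_0)
      next
        case 2
        then show ?thesis
          using n(3) lam_U[OF i] by (intro V_ev) auto
      next
        case 3
        then have "lam i \<in> V (k - 1)"
          using lam_V[OF i] V_mono by blast
        then show ?thesis
          by (intro V_ev S.subspace_scale[OF V_sub])
      qed
    qed
    finally show ?thesis .
  qed
  then show ?thesis
    by (rule that[OF n(1) n(2)[unfolded N_def]])
qed

text \<open>\<open>P\<close> acts as \<open>\<sigma>^N - 1\<close>. As \<open>N\<close> is a
  multiple of every block exponent, \<open>P\<close> lowers each filtration step, so
  \<open>P ^ t\<close> kills the lattice; a \<open>p\<close>-power of \<open>P\<close> then has the
  form \<open>x^m - 1\<close>.\<close>

lemma lattice_automorphism_order:
  assumes nonempty: "\<And>k. k \<in> {1..t} \<Longrightarrow> \<exists>i\<in>{1..r}. lev i = k" and t: "1 \<le> t"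
  obtains m where "1 \<le> m"
    "m \<le> (\<Prod>k=1..t. CARD('a) ^ card {i\<in>{1..r}. lev i = k} - 1) * CHAR('a) ^ (t - 1)"
    "\<And>x. x \<in> \<Lambda> \<Longrightarrow> (\<sigma> ^^ m) x = x"
proof -
  have "\<exists>n. 1 \<le> n \<and> n \<le> CARD('a) ^ card {i\<in>{1..r}. lev i = k} - 1 \<and>
      (\<forall>v\<in>V k. act \<sigma> (monom 1 n - 1) v \<in> V (k - 1))" if k: "k \<in> {1..t}" for k
    by (rule block_order[OF k nonempty[OF k]]) blast
  then have "\<exists>n. \<forall>k\<in>{1..t}. 1 \<le> n k \<and> n k \<le> CARD('a) ^ card {i\<in>{1..r}. lev i = k} - 1 \<and>
      (\<forall>v\<in>V k. act \<sigma> (monom 1 (n k) - 1) v \<in> V (k - 1))"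
    by (intro bchoice ballI)
  then obtain n where n: "\<And>k. k \<in> {1..t} \<Longrightarrow> 1 \<le> n k"
    "\<And>k. k \<in> {1..t} \<Longrightarrow> n k \<le> CARD('a) ^ card {i\<in>{1..r}. lev i = k} - 1"
    "\<And>k v. k \<in> {1..t} \<Longrightarrow> v \<in> V k \<Longrightarrow> act \<sigma> (monom 1 (n k) - 1) v \<in> V (k - 1)"
    by blast
  define N where "N = (\<Prod>k=1..t. n k)"
  define P where "P = (monom 1 N - 1 :: 'a poly)"
  have V_sub: "S.subspace (V k)" for k
    by (auto intro!: act_subspace \<sigma>(1) \<sigma>_\<kappa> \<sigma>_V V_\<kappa> V_add V_0)
  have step: "act \<sigma> P v \<in> V (k - 1)" if k: "k \<in> {1..t}" and v: "v \<in> V k" for k v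
  proof -
    have "n k dvd N"
      unfolding N_def using k by (intro dvd_prodI) auto
    then obtain j where j: "N = n k * j"
      by blast
    have "(monom 1 N :: 'a poly) = monom 1 (n k) ^ j"
      by (simp add: j monom_power)
    then have "monom 1 (n k) - 1 dvd P"
      unfolding P_def using power_diff_1_eq[of "monom 1 (n k) :: 'a poly" j] by simp
    then obtain h where "P = h * (monom 1 (n k) - 1)"
      by (metis dvdE mult.commute)
    then have "act \<sigma> P v = act \<sigma> h (act \<sigma> (monom 1 (n k) - 1) v)"
      by (simp only: S.scale_scale)
    then show ?thesis
      using n(3)[OF k v] S.subspace_scale[OF V_sub] by metis
  qed
  have nilpotent: "act \<sigma> (P ^ k) v = 0" if "k \<le> t" "v \<in> V k" for k v
    using that
  proof (induction k arbitrary: v)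
    case 0
    then show ?case
      by (simp add: V_bot)
  next
    case (Suc k)
    have "act \<sigma> (P ^ Suc k) v = act \<sigma> (P ^ k) (act \<sigma> P v)"
      by (simp add: power_commutes)
    also have "\<dots> = 0"
      using step[of "Suc k" v] Suc by (intro Suc.IH) auto
    finally show ?case .
  qed
  define p where "p = CHAR('a)"
  have p: "prime p"
    unfolding p_def by (rule prime_CHAR_a)
  \<comment> \<open>The exponent \<open>p ^ (t - 1)\<close> must reach the nilpotency bound
    \<open>t\<close>; the worst prime is 2.\<close>
  have "t - 1 < 2 ^ (t - 1)"
    by (rule less_exp)
  also have "\<dots> \<le> p ^ (t - 1)"
    using prime_ge_2_nat[OF p] by (intro power_mono) auto
  finally have "t \<le> p ^ (t - 1)"
    by simp
  then obtain j where j: "p ^ (t - 1) = j + t"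
    by (metis add.commute le_Suc_ex)
  define m where "m = N * p ^ (t - 1)"
  have "P ^ (p ^ (t - 1)) = monom 1 m - 1"
  proof -
    \<comment> \<open>Here \<open>P + 1\<close> is a monomial, and raising to a
      \<open>p\<close>-power is additive on polynomials over F.\<close>
    have "(P + 1) ^ (p ^ (t - 1)) = P ^ (p ^ (t - 1)) + 1 ^ (p ^ (t - 1))"
      by (rule freshmans_dream') (simp_all add: CHAR_poly prime_CHAR_a p_def)
    moreover have "(P + 1) ^ (p ^ (t - 1)) = monom 1 m"
      by (simp add: P_def m_def monom_power)
    ultimately show ?thesis
      by (metis add_diff_cancel_right' power_one)
  qed
  moreover have "act \<sigma> (P ^ (p ^ (t - 1))) x = 0" if "x \<in> \<Lambda>" for x
  proof -
    have "act \<sigma> (P ^ (p ^ (t - 1))) x = act \<sigma> (P ^ j) (act \<sigma> (P ^ t) x)"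
      unfolding j power_add by (simp only: S.scale_scale)
    then show ?thesis
      using nilpotent[of t x] that V_top by simp
  qed
  ultimately have "(\<sigma> ^^ m) x - x = 0" if "x \<in> \<Lambda>" for x
    using that S.scale_left_diff_distrib[of "monom 1 m" 1 x] by (simp add: act_monom)
  moreover have "1 \<le> m"
  proof -
    have "N \<ge> 1"
      unfolding N_def using n(1) by (intro prod_ge_1)
    then show ?thesis
      using prime_gt_0_nat[OF p] by (simp add: m_def Suc_le_eq)
  qed
  moreover have "m \<le> (\<Prod>k=1..t. CARD('a) ^ card {i\<in>{1..r}. lev i = k} - 1) * CHAR('a) ^ (t - 1)"
    unfolding m_def N_def p_def using n(2) by (intro mult_right_mono prod_mono) auto
  ultimately show ?thesis
    using that by simp
qed

end

end

section \<open>The exponential function of the lattice\<close>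

context completed_algebraic_closure
begin

text \<open>In an ultrametric field errors do not accumulate: a product of elements within
  \<open>\<epsilon>\<close> of 1 stays within \<open>\<epsilon>\<close>.\<close>

lemma prod_one_minus_close:
  fixes y :: "'b \<Rightarrow> 'c"
  assumes "finite F" "\<And>x. x \<in> F \<Longrightarrow> absv (y x) \<le> \<epsilon>" "0 \<le> \<epsilon>" "\<epsilon> \<le> 1"
  shows "absv ((\<Prod>x\<in>F. 1 - y x) - 1) \<le> \<epsilon>"
  using assms(1,2)
proof (induction F rule: finite_induct)
  case empty
  then show ?case
    using assms(3) by simp
next
  case (insert a F)
  let ?p = "\<Prod>x\<in>F. 1 - y x"
  have IH: "absv (?p - 1) \<le> \<epsilon>"
    using insert by auto
  have "absv (1 + (?p - 1)) \<le> 1"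
    using IH assms(4) by (intro absv_add_le) auto
  then have "absv (y a) * absv ?p \<le> \<epsilon> * 1"
    using insert.prems assms(3) by (intro mult_mono) auto
  then have "absv ((?p - 1) - y a * ?p) \<le> \<epsilon>"
    using IH absv_diff_le[of "?p - 1" "y a * ?p"] by (simp add: absv_mult)
  then show ?case
    using insert.hyps by (simp add: algebra_simps)
qed

end

text \<open>Finiteness of balls is the form of discreteness from which convergence of the product
  follows.\<close>

locale discrete_lattice = completed_algebraic_closure \<iota>
  for \<iota> :: "'a::{field,finite} fls \<Rightarrow> 'c::{field,complete_space}" +
  fixes \<Lambda> :: "'c set"
  assumes finite_ball: "finite {x \<in> \<Lambda>. absv x \<le> R}"
begin

abbreviation partial_exp :: "'c \<Rightarrow> 'c set \<Rightarrow> 'c" where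
  "partial_exp z F \<equiv> z * (\<Prod>x\<in>F. 1 - z / x)"

text \<open>The factors outside \<open>G\<close> are within \<open>\<epsilon>\<close> of 1, so
  enlarging \<open>G\<close> causes a relative error of at most \<open>\<epsilon>\<close>.\<close>

lemma partial_exp_close:
  assumes F: "finite F" "F \<subseteq> \<Lambda> - {0}" "G \<subseteq> F"
    and \<epsilon>: "0 \<le> \<epsilon>" "\<epsilon> \<le> 1" and far: "\<And>x. x \<in> F - G \<Longrightarrow> absv z \<le> \<epsilon> * absv x"
  shows "absv (partial_exp z F - partial_exp z G) \<le> \<epsilon> * absv (partial_exp z G)"
proof -
  have "absv (z / x) \<le> \<epsilon>" if "x \<in> F - G" for x
    using far[OF that] F(2) that by (auto simp: absv_divide divide_le_eq)
  then have "absv ((\<Prod>x\<in>F - G. 1 - z / x) - 1) \<le> \<epsilon>"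
    using F(1) \<epsilon> by (intro prod_one_minus_close) auto
  then have "absv (partial_exp z G) * absv ((\<Prod>x\<in>F - G. 1 - z / x) - 1) \<le> absv (partial_exp z G) * \<epsilon>"
    by (intro mult_left_mono) auto
  moreover have "(\<Prod>x\<in>F. 1 - z / x) = (\<Prod>x\<in>F - G. 1 - z / x) * (\<Prod>x\<in>G. 1 - z / x)"
    by (rule prod.subset_diff[OF F(3,1)])
  then have "partial_exp z F - partial_exp z G = partial_exp z G * ((\<Prod>x\<in>F - G. 1 - z / x) - 1)"
    by (simp add: algebra_simps)
  ultimately show ?thesis
    by (simp only: absv_mult mult_ac)
qed

lemma far_away:
  assumes "0 < \<epsilon>"
  shows "\<exists>G. finite G \<and> G \<subseteq> \<Lambda> - {0} \<and> (\<forall>x\<in>\<Lambda> - {0} - G. absv z \<le> \<epsilon> * absv x)"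
proof (intro exI conjI ballI)
  let ?G = "{x \<in> \<Lambda>. absv x \<le> absv z / \<epsilon>} - {0}"
  show "finite ?G" "?G \<subseteq> \<Lambda> - {0}"
    using finite_ball by auto
  fix x assume "x \<in> \<Lambda> - {0} - ?G"
  then have "\<not> absv x \<le> absv z / \<epsilon>"
    by blast
  then have "absv z / \<epsilon> < absv x"
    by (simp only: not_le)
  then have "absv z < absv x * \<epsilon>"
    using assms by (simp only: pos_divide_less_eq)
  then show "absv z \<le> \<epsilon> * absv x"
    by (simp only: mult.commute less_imp_le)
qed

text \<open>The net is Cauchy: beyond \<open>G1\<close> the partial products are bounded by
  \<open>M\<close>, which turns small relative errors into small absolute ones. Hence the
  \<open>Lim\<close> in \<open>lattice_exp\<close> is a genuine limit.\<close>

lemma partial_exp_tendsto: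
  "(partial_exp z \<longlongrightarrow> lattice_exp \<Lambda> z) (finite_subsets_at_top (\<Lambda> - {0}))"
proof -
  let ?F = "finite_subsets_at_top (\<Lambda> - {0})"
  obtain G1 where G1: "finite G1" "G1 \<subseteq> \<Lambda> - {0}"
    "\<forall>x\<in>\<Lambda> - {0} - G1. absv z \<le> 1 * absv x"
    using far_away[OF zero_less_one, of z] by (elim exE conjE) (rule that)
  \<comment> \<open>The summand 1 keeps \<open>M\<close> positive even if the partial product
    vanishes.\<close>
  define M where "M = absv (partial_exp z G1) + 1"
  have M: "M > 0"
    unfolding M_def using absv_nonneg[of "partial_exp z G1"] by linarith
  have M_bound: "absv (partial_exp z F) \<le> M" if "finite F" "F \<subseteq> \<Lambda> - {0}" "G1 \<subseteq> F" for F
  proof -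
    have "absv (partial_exp z F - partial_exp z G1) \<le> 1 * absv (partial_exp z G1)"
      using that G1(3) by (intro partial_exp_close) auto
    then have "absv (partial_exp z F - partial_exp z G1 + partial_exp z G1) \<le> absv (partial_exp z G1)"
      by (intro absv_add_le) auto
    then show ?thesis
      by (simp add: M_def)
  qed
  have cauchy: "\<exists>G. finite G \<and> G \<subseteq> \<Lambda> - {0} \<and>
      (\<forall>F. finite F \<and> G \<subseteq> F \<and> F \<subseteq> \<Lambda> - {0} \<longrightarrow> absv (partial_exp z F - partial_exp z G) < e)"
    if e: "e > 0" for e
  proof -
    define \<epsilon> where "\<epsilon> = min 1 (e / (2 * M))"
    have \<epsilon>: "0 < \<epsilon>" "\<epsilon> \<le> 1" "\<epsilon> * M < e"
      using e M by (auto simp: \<epsilon>_def min_def field_simps)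
    obtain G2 where G2: "finite G2" "G2 \<subseteq> \<Lambda> - {0}"
      "\<forall>x\<in>\<Lambda> - {0} - G2. absv z \<le> \<epsilon> * absv x"
      using far_away[OF \<epsilon>(1), of z] by (elim exE conjE) (rule that)
    have "absv (partial_exp z F - partial_exp z (G1 \<union> G2)) < e"
      if "finite F" "G1 \<union> G2 \<subseteq> F" "F \<subseteq> \<Lambda> - {0}" for F
    proof -
      have "absv (partial_exp z F - partial_exp z (G1 \<union> G2)) \<le> \<epsilon> * absv (partial_exp z (G1 \<union> G2))"
        using that G2(3) \<epsilon> by (intro partial_exp_close) auto
      also have "\<dots> \<le> \<epsilon> * M"
        using G1 G2 \<epsilon> by (intro mult_left_mono M_bound) auto
      finally show ?thesis
        using \<epsilon>(3) by simp
    qed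
    then show ?thesis
      using G1 G2 by (intro exI[of _ "G1 \<union> G2"]) auto
  qed
  have "cauchy_filter (filtermap (partial_exp z) ?F)"
    unfolding cauchy_filter_metric_filtermap
  proof (intro allI impI)
    fix e :: real assume "e > 0"
    then obtain G where G: "finite G" "G \<subseteq> \<Lambda> - {0}"
      "\<And>F. finite F \<Longrightarrow> G \<subseteq> F \<Longrightarrow> F \<subseteq> \<Lambda> - {0} \<Longrightarrow> absv (partial_exp z F - partial_exp z G) < e"
      using cauchy by meson
    let ?P = "\<lambda>F. finite F \<and> G \<subseteq> F \<and> F \<subseteq> \<Lambda> - {0}"
    have "eventually ?P ?F"
      unfolding eventually_finite_subsets_at_top using G(1,2) by blast
    moreover have "dist (partial_exp z F) (partial_exp z F') < e" if "?P F" "?P F'" for F F'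
    proof -
      have "absv ((partial_exp z F - partial_exp z G) - (partial_exp z F' - partial_exp z G)) < e"
        using that by (intro absv_diff_less G(3)) auto
      then show ?thesis
        by (simp add: dist_absv)
    qed
    ultimately show "\<exists>P. eventually P ?F \<and>
        (\<forall>x y. P x \<and> P y \<longrightarrow> dist (partial_exp z x) (partial_exp z y) < e)"
      by (intro exI[of _ ?P] conjI allI impI) (simp_all only:)
  qed
  moreover have "filtermap (partial_exp z) ?F \<noteq> bot"
    by (simp add: filtermap_bot_iff)
  ultimately obtain c where "filtermap (partial_exp z) ?F \<le> nhds c"
    using cauchy_filter_complete_converges[OF _ complete_UNIV] by auto
  then have "(partial_exp z \<longlongrightarrow> c) ?F"
    by (simp add: filterlim_def)
  moreover from this have "lattice_exp \<Lambda> z = c"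
    unfolding lattice_exp_def by (intro tendsto_Lim) simp_all
  ultimately show ?thesis
    by simp
qed

lemma lattice_exp_close:
  assumes G: "finite G" "G \<subseteq> \<Lambda> - {0}"
    and \<epsilon>: "0 \<le> \<epsilon>" "\<epsilon> \<le> 1" and far: "\<And>x. x \<in> \<Lambda> - {0} - G \<Longrightarrow> absv z \<le> \<epsilon> * absv x"
  shows "absv (lattice_exp \<Lambda> z - partial_exp z G) \<le> \<epsilon> * absv (partial_exp z G)"
proof -
  let ?F = "finite_subsets_at_top (\<Lambda> - {0})"
  have "((\<lambda>F. absv (partial_exp z F - partial_exp z G)) \<longlongrightarrow> absv (lattice_exp \<Lambda> z - partial_exp z G)) ?F"
    unfolding absv_def by (intro tendsto_dist tendsto_diffC partial_exp_tendsto tendsto_const)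
  moreover have "eventually (\<lambda>F. finite F \<and> G \<subseteq> F \<and> F \<subseteq> \<Lambda> - {0}) ?F"
    unfolding eventually_finite_subsets_at_top using G by blast
  then have "eventually (\<lambda>F. absv (partial_exp z F - partial_exp z G) \<le> \<epsilon> * absv (partial_exp z G)) ?F"
    by eventually_elim (use \<epsilon> far in \<open>auto intro!: partial_exp_close\<close>)
  ultimately show ?thesis
    by (rule tendsto_upperbound) simp
qed

text \<open>For \<open>z\<close> in the lattice, almost all partial products contain a zero factor
  or \<open>z = 0\<close>. Otherwise the limit is within relative error 1/2 of a nonzero partial
  product.\<close>

lemma lattice_exp_eq_0_iff: "0 \<in> \<Lambda> \<Longrightarrow> lattice_exp \<Lambda> z = 0 \<longleftrightarrow> z \<in> \<Lambda>"
proof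
  assume z: "z \<in> \<Lambda>"
  have "eventually (\<lambda>F. partial_exp z F = 0) (finite_subsets_at_top (\<Lambda> - {0}))"
  proof (cases "z = 0")
    case False
    then have "eventually (\<lambda>F. finite F \<and> {z} \<subseteq> F \<and> F \<subseteq> \<Lambda> - {0}) (finite_subsets_at_top (\<Lambda> - {0}))"
      unfolding eventually_finite_subsets_at_top using z by blast
    then show ?thesis
      by eventually_elim (use False in auto)
  qed simp
  then have "(partial_exp z \<longlongrightarrow> 0) (finite_subsets_at_top (\<Lambda> - {0}))"
    by (rule tendsto_eventually)
  then show "lattice_exp \<Lambda> z = 0"
    using tendsto_unique[OF _ partial_exp_tendsto] by auto
next
  assume "0 \<in> \<Lambda>" and zero: "lattice_exp \<Lambda> z = 0"
  show "z \<in> \<Lambda>"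
  proof (rule ccontr)
    assume z: "z \<notin> \<Lambda>"
    obtain G where G: "finite G" "G \<subseteq> \<Lambda> - {0}"
      "\<forall>x\<in>\<Lambda> - {0} - G. absv z \<le> (1 / 2) * absv x"
      using far_away[OF half_gt_zero[OF zero_less_one], of z] by (elim exE conjE) (rule that)
    have "absv (partial_exp z G) \<le> (1 / 2) * absv (partial_exp z G)"
      using lattice_exp_close[OF G(1,2) _ _ G(3)[rule_format]] zero by simp
    then have "absv (partial_exp z G) \<le> 0"
      by linarith
    then have "partial_exp z G = 0"
      using order_antisym[OF _ absv_nonneg] absv_eq_0_iff by blast
    then show False
      using z \<open>0 \<in> \<Lambda>\<close> G(1,2) by (auto simp: prod_zero_iff)
  qed
qed

text \<open>Comparison with the empty partial product, which is \<open>z\<close>: if no nonzero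
  lattice element is shorter than \<open>\<delta>\<close>, the relative error is at most
  \<open>|z| / \<delta>\<close>.\<close>

lemma lattice_exp_near_0:
  obtains \<delta> where "0 < \<delta>"
    "\<And>z. absv z \<le> \<delta> \<Longrightarrow> absv (lattice_exp \<Lambda> z - z) \<le> absv z ^ 2 / \<delta>"
proof -
  \<comment> \<open>Only the finite unit ball is searched; inserting 1 makes the set nonempty and
    accounts for all longer lattice elements.\<close>
  define \<delta> where "\<delta> = Min (insert 1 (absv ` ({x \<in> \<Lambda>. absv x \<le> 1} - {0})))"
  have \<delta>: "0 < \<delta>"
    unfolding \<delta>_def using finite_ball by (subst Min_gr_iff) auto
  have \<delta>_le: "\<delta> \<le> absv x" if "x \<in> \<Lambda> - {0}" for x
  proof (cases "absv x \<le> 1")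
    case True
    then show ?thesis
      unfolding \<delta>_def using finite_ball that by (intro Min_le) auto
  next
    case False
    moreover have "\<delta> \<le> 1"
      unfolding \<delta>_def using finite_ball by (intro Min_le) auto
    ultimately show ?thesis
      by simp
  qed
  have "absv (lattice_exp \<Lambda> z - z) \<le> absv z ^ 2 / \<delta>" if "absv z \<le> \<delta>" for z
  proof -
    have "absv z \<le> (absv z / \<delta>) * absv x" if "x \<in> \<Lambda> - {0}" for x
    proof -
      have "absv z * \<delta> \<le> absv z * absv x"
        using \<delta>_le[OF that] by (intro mult_left_mono) auto
      then show ?thesis
        using \<delta> by (simp add: field_simps)
    qed
    then show ?thesis
      using lattice_exp_close[of "{}" "absv z / \<delta>" z] \<delta> that
      by (simp add: power2_eq_square)
  qed
  with \<delta> show ?thesis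
    using that by blast
qed

end

section \<open>The Drinfeld polynomial and its iterates near 0\<close>

context completed_algebraic_closure
begin

lemma drinfeld_poly_eval:
  assumes "drinfeld_module \<iota> L r \<Phi>"
  obtains g where "\<And>i. i \<in> {1..r} \<Longrightarrow> g i \<in> L"
    "\<And>x. poly \<Phi> x = \<iota> fls_X_inv * x + (\<Sum>i=1..r. g i * x ^ (CARD('a) ^ i))"
proof -
  obtain g where "\<forall>i\<in>{1..r}. g i \<in> L"
    "\<Phi> = monom (\<iota> fls_X_inv) 1 + (\<Sum>i=1..r. monom (g i) (CARD('a) ^ i))"
    using assms unfolding drinfeld_module_def by blast
  then show ?thesis
    using that[of g] by (simp add: poly_monom poly_sum)
qed

lemma drinfeld_diff:
  assumes "drinfeld_module \<iota> L r \<Phi>"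
  shows "poly \<Phi> (x - y) = poly \<Phi> x - poly \<Phi> y"
proof -
  obtain g where g: "\<And>x. poly \<Phi> x = \<iota> fls_X_inv * x + (\<Sum>i=1..r. g i * x ^ (CARD('a) ^ i))"
    using drinfeld_poly_eval[OF assms] by metis
  show ?thesis
    unfolding g by (simp add: frobenius_diff right_diff_distrib sum_subtractf)
qed

text \<open>Every nonlinear term has exponent at least 2, so for \<open>|x| \<le> 1 / M\<close> it
  is at most \<open>|x|\<close>, and the linear term sets the bound.\<close>

lemma drinfeld_small:
  assumes "drinfeld_module \<iota> L r \<Phi>"
  obtains \<eta> where "0 < \<eta>" "\<And>x. absv x \<le> \<eta> \<Longrightarrow> absv (poly \<Phi> x) \<le> real CARD('a) * absv x"
proof -
  obtain g where g: "\<And>x. poly \<Phi> x = \<iota> fls_X_inv * x + (\<Sum>i=1..r. g i * x ^ (CARD('a) ^ i))"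
    using drinfeld_poly_eval[OF assms] by metis
  define M where "M = Max (insert 1 ((\<lambda>i. absv (g i)) ` {1..r}))"
  have M1: "1 \<le> M"
    unfolding M_def by (intro Max_ge) auto
  have M: "absv (g i) \<le> M" if "i \<in> {1..r}" for i
    unfolding M_def using that by (intro Max_ge) auto
  have "absv (poly \<Phi> x) \<le> real CARD('a) * absv x" if x: "absv x \<le> 1 / M" for x
    unfolding g
  proof (intro absv_add_le absv_sum_le)
    show "absv (\<iota> fls_X_inv * x) \<le> real CARD('a) * absv x"
      by (simp add: absv_mult absv_T)
    fix i assume i: "i \<in> {1..r}"
    have "2 \<le> CARD('a) ^ i"
      using card_a_ge2 self_le_power[of "CARD('a)" i] i by auto
    \<comment> \<open>Of the factors \<open>|x|\<close>, one is kept, one cancels the coefficient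
      bound \<open>M\<close>, and the remaining \<open>k\<close> are at most 1.\<close>
    then obtain k where k: "CARD('a) ^ i = Suc (Suc k)"
      by (metis add_2_eq_Suc le_Suc_ex)
    have "absv x \<le> 1"
    proof -
      have "1 / M \<le> 1"
        using M1 by simp
      with x show ?thesis
        by linarith
    qed
    then have "absv x ^ k \<le> 1"
      by (intro power_le_one) auto
    have "absv (g i * x ^ (CARD('a) ^ i)) = absv (g i) * (absv x * (absv x ^ k * absv x))"
      by (simp add: absv_mult absv_power k mult_ac)
    also have "\<dots> \<le> M * (absv x * (1 * (1 / M)))"
      using M[OF i] x \<open>absv x ^ k \<le> 1\<close> M1 by (intro mult_mono) auto
    also have "\<dots> = 1 * absv x"
      using M1 by simp
    also have "\<dots> \<le> real CARD('a) * absv x"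
      using card_a_gt1 by (intro mult_right_mono) auto
    finally show "absv (g i * x ^ (CARD('a) ^ i)) \<le> real CARD('a) * absv x" .
  qed (simp_all add: mult_nonneg_nonneg)
  then show ?thesis
    using that[of "1 / M"] M1 by simp
qed

text \<open>The bound on \<open>q^n * |x|\<close> keeps all intermediate iterates in the disc where
  one step expands by at most q.\<close>

lemma drinfeld_iterate_small:
  assumes "drinfeld_module \<iota> L r \<Phi>"
  obtains \<eta> where "0 < \<eta>"
    "\<And>n x. real CARD('a) ^ n * absv x \<le> \<eta> \<Longrightarrow>
      absv ((poly \<Phi> ^^ n) x) \<le> real CARD('a) ^ n * absv x"
proof -
  let ?q = "real CARD('a)"
  obtain \<eta> where \<eta>: "0 < \<eta>" "\<And>x. absv x \<le> \<eta> \<Longrightarrow> absv (poly \<Phi> x) \<le> ?q * absv x"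
    using drinfeld_small[OF assms] by blast
  have "absv ((poly \<Phi> ^^ n) x) \<le> ?q ^ n * absv x" if "?q ^ n * absv x \<le> \<eta>" for n x
    using that
  proof (induction n)
    case (Suc n)
    have "?q ^ n * absv x \<le> ?q ^ Suc n * absv x"
      using card_a_gt1 by (intro mult_right_mono power_increasing) auto
    then have le: "?q ^ n * absv x \<le> \<eta>"
      using Suc.prems by linarith
    have IH: "absv ((poly \<Phi> ^^ n) x) \<le> ?q ^ n * absv x"
      by (rule Suc.IH[OF le])
    then have "absv (poly \<Phi> ((poly \<Phi> ^^ n) x)) \<le> ?q * absv ((poly \<Phi> ^^ n) x)"
      using le by (intro \<eta>(2)) linarith
    also have "\<dots> \<le> ?q * (?q ^ n * absv x)"
      using IH by (intro mult_left_mono) auto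
    finally show ?case
      by (simp add: mult.assoc)
  qed simp
  with \<eta>(1) show ?thesis
    using that by blast
qed

end

context discrete_lattice
begin

text \<open>
  Since \<open>e(z) = \<phi>\<^sub>T\<^sup>n (e(z / T\<^sup>n))\<close>, the exponential function, and thus the lattice, is
  determined by \<open>\<phi>\<^sub>T\<close> alone.
\<close>

lemma lattice_exp_limit:
  assumes \<Phi>: "drinfeld_module \<iota> L r \<Phi>"
    and eq: "\<And>z. lattice_exp \<Lambda> (\<iota> fls_X_inv * z) = poly \<Phi> (lattice_exp \<Lambda> z)"
  shows "(\<lambda>n. (poly \<Phi> ^^ n) (z / \<iota> fls_X_inv ^ n)) \<longlonglongrightarrow> lattice_exp \<Lambda> z"
proof -
  let ?q = "real CARD('a)" and ?T = "\<iota> fls_X_inv"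
  let ?e = "lattice_exp \<Lambda>"
  obtain \<eta> where \<eta>: "0 < \<eta>"
    "\<And>n x. ?q ^ n * absv x \<le> \<eta> \<Longrightarrow> absv ((poly \<Phi> ^^ n) x) \<le> ?q ^ n * absv x"
    using drinfeld_iterate_small[OF \<Phi>] by blast
  obtain \<delta> where \<delta>: "0 < \<delta>" "\<And>z. absv z \<le> \<delta> \<Longrightarrow> absv (?e z - z) \<le> absv z ^ 2 / \<delta>"
    using lattice_exp_near_0 by blast
  have T: "?T \<noteq> 0"
    by simp
  have q0: "0 < ?q"
    by simp
  have iterate: "(poly \<Phi> ^^ n) (?e (z / ?T ^ n)) = ?e z" for n
  proof (induction n)
    case (Suc n)
    have "poly \<Phi> (?e (z / ?T ^ Suc n)) = ?e (z / ?T ^ n)"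
      by (simp flip: eq)
    then show ?case
      using Suc by (simp add: funpow_swap1)
  qed simp
  have diff: "(poly \<Phi> ^^ n) x - (poly \<Phi> ^^ n) y = (poly \<Phi> ^^ n) (x - y)" for n x y
    by (induction n) (simp_all flip: drinfeld_diff[OF \<Phi>])
  have lim0: "(\<lambda>n. absv z / ?q ^ n) \<longlonglongrightarrow> 0"
    using tendsto_mult[OF tendsto_const[of "absv z"] LIMSEQ_inverse_realpow_zero[OF card_a_gt1]]
    by (simp add: divide_inverse)
  \<comment> \<open>For \<open>w = z / T^n\<close> the error of the exponential is
    \<open>|w|^2 / \<delta>\<close>. Applying \<open>n\<close> steps of \<open>\<Phi>\<close> costs
    a factor \<open>q^n\<close>, which leaves \<open>C / q^n\<close>: the quadratic error
    wins.\<close>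
  define C where "C = absv z ^ 2 / \<delta>"
  have lim: "(\<lambda>n. C / ?q ^ n) \<longlonglongrightarrow> 0"
    using tendsto_mult[OF tendsto_const[of C] LIMSEQ_inverse_realpow_zero[OF card_a_gt1]]
    by (simp add: divide_inverse)
  show ?thesis
  proof (rule tendsto_absvI[OF lim])
    have "\<forall>\<^sub>F n in sequentially. absv z / ?q ^ n < \<delta>" "\<forall>\<^sub>F n in sequentially. C / ?q ^ n < \<eta>"
      using order_tendstoD(2)[OF lim0 \<delta>(1)] order_tendstoD(2)[OF lim \<eta>(1)] .
    then show "\<forall>\<^sub>F n in sequentially. absv ((poly \<Phi> ^^ n) (z / ?T ^ n) - ?e z) \<le> C / ?q ^ n"
    proof eventually_elim
      case (elim n)
      let ?w = "z / ?T ^ n"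
      have w: "absv ?w = absv z / ?q ^ n"
        by (simp add: absv_divide absv_power absv_T)
      have "?q ^ n * absv (?w - ?e ?w) \<le> ?q ^ n * (absv ?w ^ 2 / \<delta>)"
        using \<delta>(2)[of ?w] elim(1) w by (intro mult_left_mono) (auto simp: absv_minus_commute)
      also have "\<dots> = C / ?q ^ n"
        unfolding w C_def by (simp add: power_divide power2_eq_square)
      finally have *: "?q ^ n * absv (?w - ?e ?w) \<le> C / ?q ^ n" .
      have "(poly \<Phi> ^^ n) ?w - ?e z = (poly \<Phi> ^^ n) (?w - ?e ?w)"
        using diff[of n ?w "?e ?w"] iterate[of n] by simp
      moreover have "?q ^ n * absv (?w - ?e ?w) \<le> \<eta>"
        using * elim(2) by linarith
      ultimately show ?case
        using \<eta>(2)[of n "?w - ?e ?w"] * order_trans by simp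
    qed
  qed
qed

text \<open>\<open>\<sigma>\<close> fixes \<open>T\<close> and the coefficients of
  \<open>\<Phi>\<close> and is continuous, so the limit formula lets it commute with the
  exponential, whose zeros form the lattice.\<close>

lemma isometric_hom_lattice:
  assumes \<Phi>: "drinfeld_module \<iota> L r \<Phi>"
    and eq: "\<And>z. lattice_exp \<Lambda> (\<iota> fls_X_inv * z) = poly \<Phi> (lattice_exp \<Lambda> z)"
    and \<sigma>: "isometric_hom \<sigma>" "\<And>a. \<sigma> (\<iota> a) = \<iota> a" "\<And>x. x \<in> L \<Longrightarrow> \<sigma> x = x"
    and "0 \<in> \<Lambda>" "z \<in> \<Lambda>"
  shows "\<sigma> z \<in> \<Lambda>"
proof -
  let ?T = "\<iota> fls_X_inv"
  note s = isometric_homD[OF \<sigma>(1)] isometric_hom_simps[OF \<sigma>(1)]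
  obtain g where g: "\<And>i. i \<in> {1..r} \<Longrightarrow> g i \<in> L"
    "\<And>x. poly \<Phi> x = ?T * x + (\<Sum>i=1..r. g i * x ^ (CARD('a) ^ i))"
    using drinfeld_poly_eval[OF \<Phi>] by metis
  have sum: "\<sigma> (\<Sum>i\<in>S. f i) = (\<Sum>i\<in>S. \<sigma> (f i))" for S and f :: "nat \<Rightarrow> 'c"
    by (induction S rule: infinite_finite_induct) (simp_all add: s)
  have \<sigma>_\<Phi>: "\<sigma> (poly \<Phi> x) = poly \<Phi> (\<sigma> x)" for x
    unfolding g(2) using g(1) \<sigma>(3) by (simp add: s \<sigma>(2) sum)
  have "\<sigma> ((poly \<Phi> ^^ n) x) = (poly \<Phi> ^^ n) (\<sigma> x)" for n x
    by (induction n) (simp_all add: \<sigma>_\<Phi>)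
  then have "\<sigma> ((poly \<Phi> ^^ n) (z / ?T ^ n)) = (poly \<Phi> ^^ n) (\<sigma> z / ?T ^ n)" for n
    by (simp add: divide_inverse s \<sigma>(2))
  moreover have "(\<lambda>n. \<sigma> ((poly \<Phi> ^^ n) (z / ?T ^ n))) \<longlonglongrightarrow> \<sigma> (lattice_exp \<Lambda> z)"
    by (rule isometric_hom_tendsto[OF \<sigma>(1) lattice_exp_limit[OF \<Phi> eq]])
  ultimately have "(\<lambda>n. (poly \<Phi> ^^ n) (\<sigma> z / ?T ^ n)) \<longlonglongrightarrow> 0"
    using lattice_exp_eq_0_iff[OF \<open>0 \<in> \<Lambda>\<close>, of z] \<open>z \<in> \<Lambda>\<close> by (simp add: s)
  then have "lattice_exp \<Lambda> (\<sigma> z) = 0"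
    using lattice_exp_limit[OF \<Phi> eq, of "\<sigma> z"] LIMSEQ_unique by blast
  then show ?thesis
    using lattice_exp_eq_0_iff[OF \<open>0 \<in> \<Lambda>\<close>] by simp
qed

end

section \<open>The residue class degree\<close>

text \<open>Coordinates give \<open>card K ^ n\<close> elements in dimension \<open>n\<close>, and
  \<open>card K > 1\<close> allows the exponents to be compared.\<close>

lemma (in field) finite_dimension_card_bound:
  assumes K: "subfield K R" and fin: "finite (carrier R)" and card: "card (carrier R) \<le> card K ^ m"
  shows "finite_dimension K (carrier R)" "dim K (carrier R) \<le> m"
proof -
  obtain Us where Us: "set Us = carrier R"
    using finite_list[OF fin] by blast
  have "Span K Us = carrier R"
  proof
    show "Span K Us \<subseteq> carrier R"
      using Span_in_carrier[OF subfieldE(3)[OF K]] Us by simp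
    show "carrier R \<subseteq> Span K Us"
      using Span_base_incl[OF K, of Us] Us by simp
  qed
  then show fd: "finite_dimension K (carrier R)"
    using Span_finite_dimension[OF K, of Us] Us by simp
  then obtain n where n: "dimension n K (carrier R)"
    unfolding finite_dimension_def by (rule exE)
  obtain Vs where Vs: "set Vs \<subseteq> carrier R" "independent K Vs" "length Vs = n" "Span K Vs = carrier R"
    using exists_base[OF K n] by (elim exE conjE) (rule that)
  let ?L = "{Ks. set Ks \<subseteq> K \<and> length Ks = n}"
  have KR: "K \<subseteq> carrier R"
    by (rule subfieldE(3)[OF K])
  have "inj_on (\<lambda>Ks. combine Ks Vs) ?L"
  proof (rule inj_onI)
    fix Ks Ks' assume Ks: "Ks \<in> ?L" "Ks' \<in> ?L" "combine Ks Vs = combine Ks' Vs"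
    have "combine Ks Vs \<in> Span K Vs"
      using Ks(1) Vs(3) by (intro Span_mem_iff_length_version[OF K Vs(1), THEN iffD2] exI[of _ Ks]) simp
    from unique_decomposition[OF K Vs(2) this] obtain Z
      where "set Z \<subseteq> K \<and> length Z = length Vs \<and> combine Ks Vs = combine Z Vs"
        and Z: "\<forall>Y. set Y \<subseteq> K \<and> length Y = length Vs \<and> combine Ks Vs = combine Y Vs \<longrightarrow> Y = Z"
      by (rule ex1E)
    have "Ks = Z" "Ks' = Z"
      using Ks Vs(3) by (auto intro!: Z[rule_format])
    then show "Ks = Ks'"
      by simp
  qed
  then have "card ((\<lambda>Ks. combine Ks Vs) ` ?L) = card K ^ n"
    using card_lists_length_eq[OF finite_subset[OF KR fin], of n] by (simp add: card_image)
  moreover have "(\<lambda>Ks. combine Ks Vs) ` ?L \<subseteq> carrier R"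
    using KR Vs(1) by (auto intro!: combine_in_carrier)
  ultimately have "card K ^ n \<le> card (carrier R)"
    using card_mono[OF fin] by metis
  also note card
  finally have le: "card K ^ n \<le> card K ^ m" .
  have "{\<zero>, \<one>} \<subseteq> K"
    using subringE(2,3)[OF subfieldE(1)[OF K]] by simp
  then have "card {\<zero>, \<one>} \<le> card K"
    using finite_subset[OF KR fin] by (intro card_mono)
  then have "1 < card K"
    by simp
  with le have "n \<le> m"
    by (rule power_le_imp_le_exp[rotated])
  then show "dim K (carrier R) \<le> m"
    using dimI[OF K n] by (simp add: over_def)
qed

section \<open>Valuation rings and residue classes of intermediate fields\<close>

context finite_extension_field
begin

interpretation C: field "ring_of_type_algebra :: 'c ring"
  by (rule field_from_type_algebra)

lemma uminus_ring_of_type_algebra: "\<ominus>\<^bsub>ring_of_type_algebra\<^esub> (x::'c) = - x"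
  by (rule C.minus_equality) (simp_all add: ring_of_type_algebra_def)

lemma inv_ring_of_type_algebra: "(x::'c) \<noteq> 0 \<Longrightarrow> inv\<^bsub>ring_of_type_algebra\<^esub> x = inverse x"
  by (rule C.inv_unique'[symmetric]) (simp_all add: ring_of_type_algebra_def)

text \<open>As \<open>inverse 0 = 0\<close>, closure under \<open>inverse\<close> can be asked of
  every element.\<close>

definition subfield_set :: "'c set \<Rightarrow> bool" where
  "subfield_set M \<longleftrightarrow> 1 \<in> M \<and> (\<forall>x\<in>M. - x \<in> M \<and> inverse x \<in> M) \<and> (\<forall>x\<in>M. \<forall>y\<in>M. x + y \<in> M \<and> x * y \<in> M)"

lemma subfield_set_adjoin: "subfield_set (adjoin L S)"
  unfolding subfield_set_def
proof (intro conjI ballI)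
  let ?R = "ring_of_type_algebra :: 'c ring"
  show "1 \<in> adjoin L S"
    using generate_field.one[of ?R "L \<union> S"] by (simp add: adjoin_def ring_of_type_algebra_def)
  fix x assume x: "x \<in> adjoin L S"
  show m: "- x \<in> adjoin L S"
    using generate_field.a_inv[of x ?R "L \<union> S"] x by (simp add: adjoin_def uminus_ring_of_type_algebra)
  show "inverse x \<in> adjoin L S"
    using generate_field.m_inv[of x ?R "L \<union> S"] x
    by (cases "x = 0") (simp_all add: adjoin_def inv_ring_of_type_algebra, simp add: ring_of_type_algebra_def)
  fix y assume y: "y \<in> adjoin L S"
  show "x + y \<in> adjoin L S" "x * y \<in> adjoin L S"
    using generate_field.eng_add[of x ?R "L \<union> S" y] generate_field.eng_mult[of x ?R "L \<union> S" y] x y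
    by (simp_all add: adjoin_def ring_of_type_algebra_def)
qed

lemma adjoin_fixed:
  assumes "isometric_hom \<sigma>" "\<And>x. x \<in> L \<union> S \<Longrightarrow> (\<sigma> ^^ m) x = x" "x \<in> adjoin L S"
  shows "(\<sigma> ^^ m) x = x"
proof -
  note s = isometric_homD[OF assms(1)] isometric_hom_simps[OF assms(1)]
  have hom: "(\<sigma> ^^ m) (x + y) = (\<sigma> ^^ m) x + (\<sigma> ^^ m) y" "(\<sigma> ^^ m) (x * y) = (\<sigma> ^^ m) x * (\<sigma> ^^ m) y"
    "(\<sigma> ^^ m) 1 = 1" "(\<sigma> ^^ m) (- x) = - (\<sigma> ^^ m) x" "(\<sigma> ^^ m) (inverse x) = inverse ((\<sigma> ^^ m) x)" for x y
    by (induction m) (simp_all add: s)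
  show ?thesis
    using assms(3) unfolding adjoin_def
  proof (induction rule: generate_field.induct)
    case (m_inv h)
    then have "h \<noteq> 0"
      by (simp add: ring_of_type_algebra_def)
    then show ?case
      using m_inv by (simp add: inv_ring_of_type_algebra hom)
  next
    case (a_inv h)
    then show ?case
      by (simp add: uminus_ring_of_type_algebra hom)
  qed (use assms(2) in \<open>simp_all add: hom ring_of_type_algebra_def\<close>)
qed

lemma subfield_set_L: "subfield_set L"
  unfolding subfield_set_def
proof (intro conjI ballI)
  fix x assume x: "x \<in> L"
  show "inverse x \<in> L"
  proof (cases "x = 0")
    case False
    then show ?thesis
      using C.subfield_m_inv(1)[OF subfield_L, of x] x
      by (simp add: inv_ring_of_type_algebra) (simp add: ring_of_type_algebra_def)
  qed (use x in simp)
qed (auto intro: L_1 L_uminus L_add L_mult)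

lemma subfield_setD:
  assumes "subfield_set M"
  shows "1 \<in> M" "0 \<in> M" "x \<in> M \<Longrightarrow> - x \<in> M" "x \<in> M \<Longrightarrow> inverse x \<in> M"
    "x \<in> M \<Longrightarrow> y \<in> M \<Longrightarrow> x + y \<in> M" "x \<in> M \<Longrightarrow> y \<in> M \<Longrightarrow> x * y \<in> M"
    "x \<in> M \<Longrightarrow> y \<in> M \<Longrightarrow> x - y \<in> M"
proof -
  have *: "1 \<in> M" "- x \<in> M" "x + y \<in> M" if "x \<in> M" "y \<in> M" for x y
    using assms that by (auto simp: subfield_set_def)
  show "0 \<in> M"
    using *(3)[of 1 "- 1"] *(2)[of 1 1] assms by (simp add: subfield_set_def)
  show "x - y \<in> M" if "x \<in> M" "y \<in> M"
    using *(3)[of x "- y"] *(2)[of y y] that by simp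
qed (use assms in \<open>auto simp: subfield_set_def\<close>)

context
  fixes M :: "'c set"
  assumes M: "subfield_set M" and LM: "L \<subseteq> M"
begin

lemma integers_closed:
  "1 \<in> integers_of M" "0 \<in> integers_of M" "x \<in> integers_of M \<Longrightarrow> - x \<in> integers_of M"
  "x \<in> integers_of M \<Longrightarrow> y \<in> integers_of M \<Longrightarrow> x + y \<in> integers_of M"
  "x \<in> integers_of M \<Longrightarrow> y \<in> integers_of M \<Longrightarrow> x * y \<in> integers_of M"
  using subfield_setD[OF M]
  by (auto simp: integers_of_def absv_mult intro: absv_add_le mult_le_one)

lemma cring_integer_ring: "cring (integer_ring M)"
proof -
  have "subring (integers_of M) (ring_of_type_algebra :: 'c ring)"
    by (rule C.subringI)
       (use integers_closed in \<open>simp_all add: uminus_ring_of_type_algebra\<close>, simp_all add: ring_of_type_algebra_def)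
  then show ?thesis
    unfolding integer_ring_def
    using C.subcringI' C.subcring_iff[of "integers_of M"] by (simp add: ring_of_type_algebra_def)
qed

lemma integer_ring_simps:
  "carrier (integer_ring M) = integers_of M" "\<zero>\<^bsub>integer_ring M\<^esub> = 0" "\<one>\<^bsub>integer_ring M\<^esub> = 1"
  "x \<oplus>\<^bsub>integer_ring M\<^esub> y = x + y" "x \<otimes>\<^bsub>integer_ring M\<^esub> y = x * y"
  by (simp_all add: integer_ring_def ring_of_type_algebra_def)

interpretation O: cring "integer_ring M"
  by (rule cring_integer_ring)

lemma uminus_integer_ring: "x \<in> integers_of M \<Longrightarrow> \<ominus>\<^bsub>integer_ring M\<^esub> x = - x"
  by (rule O.minus_equality) (auto simp: integer_ring_simps integers_closed)

lemma ideal_maximal_ideal: "ideal (maximal_ideal_of M) (integer_ring M)"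
proof (rule idealI[OF O.ring_axioms])
  show "subgroup (maximal_ideal_of M) (add_monoid (integer_ring M))"
  proof (rule O.add.subgroupI)
    show "maximal_ideal_of M \<subseteq> carrier (integer_ring M)"
      by (auto simp: integer_ring_simps maximal_ideal_of_def integers_of_def)
    show "maximal_ideal_of M \<noteq> {}"
      using subfield_setD(2)[OF M] by (auto simp: maximal_ideal_of_def intro: exI[of _ 0])
    show "\<ominus>\<^bsub>integer_ring M\<^esub> a \<in> maximal_ideal_of M" if "a \<in> maximal_ideal_of M" for a
      using that uminus_integer_ring[of a] subfield_setD(3)[OF M]
      by (auto simp: maximal_ideal_of_def integers_of_def)
    show "a \<oplus>\<^bsub>integer_ring M\<^esub> b \<in> maximal_ideal_of M"
      if "a \<in> maximal_ideal_of M" "b \<in> maximal_ideal_of M" for a b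
      using that subfield_setD(5)[OF M]
      by (auto simp: maximal_ideal_of_def integer_ring_simps intro: absv_add_less)
  qed
  have *: "absv a * absv x < 1" if "absv a < 1" "absv x \<le> 1" for a x :: 'c
    using that mult_right_le_one_le[of "absv a" "absv x"] by simp
  fix a x assume "a \<in> maximal_ideal_of M" "x \<in> carrier (integer_ring M)"
  then show "x \<otimes>\<^bsub>integer_ring M\<^esub> a \<in> maximal_ideal_of M" "a \<otimes>\<^bsub>integer_ring M\<^esub> x \<in> maximal_ideal_of M"
    using * subfield_setD(6)[OF M]
    by (auto simp: maximal_ideal_of_def integers_of_def integer_ring_simps absv_mult mult.commute[of "absv x"])
qed

text \<open>An integer outside the maximal ideal has absolute value 1, so its inverse is an integer
  too.\<close>

lemma maximalideal_maximal_ideal: "maximalideal (maximal_ideal_of M) (integer_ring M)"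
proof (rule maximalidealI[OF ideal_maximal_ideal])
  show "carrier (integer_ring M) \<noteq> maximal_ideal_of M"
    using integers_closed(1) by (auto simp: integer_ring_simps maximal_ideal_of_def)
  fix J assume J: "ideal J (integer_ring M)" "maximal_ideal_of M \<subseteq> J" "J \<subseteq> carrier (integer_ring M)"
  interpret J: ideal J "integer_ring M"
    by fact
  show "J = maximal_ideal_of M \<or> J = carrier (integer_ring M)"
  proof (rule ccontr)
    assume neg: "\<not> (J = maximal_ideal_of M \<or> J = carrier (integer_ring M))"
    then obtain x where x: "x \<in> J" "x \<notin> maximal_ideal_of M"
      using J(2) by blast
    then have "x \<in> M" "absv x = 1"
      using J(3) by (auto simp: integer_ring_simps maximal_ideal_of_def integers_of_def)
    then have "inverse x \<in> carrier (integer_ring M)" "x \<noteq> 0"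
      using subfield_setD(4)[OF M] by (auto simp: integer_ring_simps integers_of_def absv_inverse)
    then have "\<one>\<^bsub>integer_ring M\<^esub> \<in> J"
      using J.I_r_closed[OF x(1), of "inverse x"] by (simp add: integer_ring_simps)
    then show False
      using J.one_imp_carrier neg by blast
  qed
qed

lemma field_residue_field: "field (residue_field M)"
  unfolding residue_field_def
  by (rule maximalideal.quotient_is_field[OF maximalideal_maximal_ideal cring_integer_ring])

abbreviation cls :: "'c \<Rightarrow> 'c set" where
  "cls x \<equiv> maximal_ideal_of M +>\<^bsub>integer_ring M\<^esub> x"

lemma cls_eq:
  assumes x: "x \<in> M"
  shows "cls x = {y \<in> M. absv (y - x) < 1}"
proof (intro Set.set_eqI iffI)
  fix y assume "y \<in> cls x"
  then obtain h where "h \<in> maximal_ideal_of M" "y = h + x"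
    by (auto simp: a_r_coset_def' integer_ring_simps)
  then show "y \<in> {y \<in> M. absv (y - x) < 1}"
    using x subfield_setD(5)[OF M] by (auto simp: maximal_ideal_of_def)
next
  fix y assume "y \<in> {y \<in> M. absv (y - x) < 1}"
  then have "y - x \<in> maximal_ideal_of M"
    using x subfield_setD(7)[OF M] by (auto simp: maximal_ideal_of_def)
  then show "y \<in> cls x"
    unfolding a_r_coset_def' integer_ring_simps by (intro UN_I[of "y - x"]) auto
qed

text \<open>Names a residue class of \<open>M\<close> by its representative in \<open>Fbar\<close>,
  which need not belong to \<open>M\<close>; a coset \<open>cls z\<close> would then not lie in
  \<open>M\<close>.\<close>

definition near :: "'c \<Rightarrow> 'c set" where
  "near z = {y \<in> M. absv (y - z) < 1}"

lemma cls_near: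
  assumes "c \<in> M" "absv (c - z) < 1"
  shows "cls c = near z"
  unfolding cls_eq[OF assms(1)] near_def
proof (intro Collect_cong conj_cong refl iffI)
  fix y assume "absv (y - c) < 1"
  from absv_add_less[OF this assms(2)] show "absv (y - z) < 1"
    by simp
next
  fix y assume "absv (y - z) < 1"
  from absv_diff_less[OF this assms(2)] show "absv (y - c) < 1"
    by simp
qed

lemma inj_near: "inj_on near (residues M)"
proof (rule inj_onI)
  fix z w assume zw: "z \<in> residues M" "w \<in> residues M" "near z = near w"
  then obtain c where "c \<in> M" "absv (c - z) < 1"
    by (auto simp: residues_def)
  then have "c \<in> near w"
    unfolding zw(3)[symmetric] by (simp add: near_def)
  then have "absv ((c - w) - (c - z)) < 1"
    using \<open>absv (c - z) < 1\<close> by (intro absv_diff_less[of "c - w" 1 "c - z"]) (simp_all add: near_def)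
  then show "z = w"
    using zw(1,2) by (intro Fbar_eqI) (auto simp: residues_def)
qed

text \<open>Together with \<open>inj_near\<close> this identifies residue classes with elements of
  \<open>Fbar\<close>, so that cardinalities can be computed there.\<close>

lemma cls_image:
  assumes "N \<subseteq> M"
  shows "cls ` integers_of N = near ` residues N"
proof (intro antisym subsetI)
  fix y assume "y \<in> cls ` integers_of N"
  then obtain c where c: "c \<in> N" "absv c \<le> 1" "y = cls c"
    by (auto simp: integers_of_def)
  obtain z where z: "z \<in> Fbar" "absv (c - z) < 1"
    using residue_exists[OF c(2)] by blast
  then have "z \<in> residues N"
    using c(1) by (auto simp: residues_def)
  then show "y \<in> near ` residues N"
    using cls_near[of c z] c z assms by auto
next
  fix y assume "y \<in> near ` residues N"
  then obtain z c where z: "z \<in> Fbar" "c \<in> N" "absv (c - z) < 1" "y = near z"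
    by (auto simp: residues_def)
  have "absv (c - z + z) \<le> 1"
    using z(3) absv_Fbar_le[OF z(1)] absv_add_le[of "c - z" 1 z] by simp
  then have "c \<in> integers_of N"
    using z(2) by (simp add: integers_of_def)
  then show "y \<in> cls ` integers_of N"
    using cls_near[of c z] z assms by auto
qed

lemma carrier_residue_field: "carrier (residue_field M) = near ` residues M"
proof -
  have "carrier (residue_field M) = cls ` integers_of M"
    by (auto simp: residue_field_def FactRing_def A_RCOSETS_def' integer_ring_simps)
  then show ?thesis
    using cls_image[of M] by simp
qed

lemma residue_subfield_eq: "residue_subfield M L = near ` residues L"
  unfolding residue_subfield_def by (rule cls_image[OF LM])

interpretation maximal: maximalideal "maximal_ideal_of M" "integer_ring M"
  by (rule maximalideal_maximal_ideal)

interpretation k: field "residue_field M"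
  by (rule field_residue_field)

interpretation cls: ring_hom_ring "integer_ring M" "residue_field M" cls
  unfolding residue_field_def by (rule maximal.rcos_ring_hom_ring)

lemma subfield_residue_subfield: "subfield (residue_subfield M L) (residue_field M)"
proof (rule k.subfieldI')
  have "subring (integers_of L) (integer_ring M)"
  proof (rule O.subringI)
    show sub: "integers_of L \<subseteq> carrier (integer_ring M)"
      using LM by (auto simp: integers_of_def integer_ring_simps)
    show "\<ominus>\<^bsub>integer_ring M\<^esub> h \<in> integers_of L" if "h \<in> integers_of L" for h
    proof -
      have "\<ominus>\<^bsub>integer_ring M\<^esub> h = - h"
        using sub that by (intro uminus_integer_ring) (auto simp: integer_ring_simps)
      then show ?thesis
        using that by (simp add: integers_of_def L_uminus)
    qed
  qed (auto simp: integers_of_def integer_ring_simps absv_mult intro: L_1 L_add L_mult absv_add_le mult_le_one)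
  then show "subring (residue_subfield M L) (residue_field M)"
    unfolding residue_subfield_def by (rule cls.img_is_subring)
  fix y assume "y \<in> residue_subfield M L - {\<zero>\<^bsub>residue_field M\<^esub>}"
  then obtain c where c: "c \<in> L" "absv c \<le> 1" "y = cls c" "cls c \<noteq> \<zero>\<^bsub>residue_field M\<^esub>"
    by (auto simp: residue_subfield_def integers_of_def)
  have "\<zero>\<^bsub>residue_field M\<^esub> = cls 0"
    using cls.hom_zero by (simp add: integer_ring_simps)
  then have "absv c = 1"
    using c LM cls_near[of c 0] cls_near[of 0 0] subfield_setD(2)[OF M] by force
  then have c': "inverse c \<in> integers_of L" "c \<noteq> 0"
    using subfield_setD(4)[OF subfield_set_L c(1)] by (auto simp: integers_of_def absv_inverse)
  have in_O: "c \<in> carrier (integer_ring M)" "inverse c \<in> carrier (integer_ring M)"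
    using c(1,2) c' LM by (auto simp: integers_of_def integer_ring_simps)
  have "cls c \<otimes>\<^bsub>residue_field M\<^esub> cls (inverse c) = \<one>\<^bsub>residue_field M\<^esub>"
    using cls.hom_mult[OF in_O] cls.hom_one c'(2) by (simp add: integer_ring_simps)
  then have "inv\<^bsub>residue_field M\<^esub> y = cls (inverse c)"
    unfolding c(3) using in_O by (intro k.comm_inv_char) auto
  then show "inv\<^bsub>residue_field M\<^esub> y \<in> residue_subfield M L"
    using c'(1) by (simp add: residue_subfield_def)
qed

text \<open>
  The order of Frobenius may depend on the residue considered; a generator of the multiplicative
  group of the residue field makes the bound uniform.
\<close>

lemma residue_degree_bound:
  assumes bound: "\<And>z. z \<in> residues M \<Longrightarrow> \<exists>m. 1 \<le> m \<and> m \<le> D \<and> z ^ (Q ^ m) = z"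
  shows "residue_degree M L \<le> enat D"
proof -
  have card_L: "card (residue_subfield M L) = Q"
  proof -
    have "residues L \<subseteq> residues M"
      using LM by (auto simp: residues_def)
    then show ?thesis
      unfolding residue_subfield_eq Q_def by (intro card_image inj_on_subset[OF inj_near])
  qed
  have Q1: "1 < Q"
  proof -
    have "{0, 1} \<subseteq> residues L"
      using residues_0 Fbar_1 L_1 by (auto simp: residues_def intro: bexI[of _ 1])
    then have "card {0, 1 :: 'c} \<le> Q"
      unfolding Q_def by (rule card_mono[OF finite_residues_L])
    then show ?thesis
      by simp
  qed
  have roots: "finite {z :: 'c. z ^ (Q ^ m) = z} \<and> card {z :: 'c. z ^ (Q ^ m) = z} \<le> Q ^ m"
    if m: "1 \<le> m" for m
  proof -
    let ?p = "monom 1 (Q ^ m) - monom 1 1 :: 'c poly"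
    have Qm: "1 < Q ^ m"
      using Q1 m by (intro one_less_power) auto
    have "coeff ?p (Q ^ m) = 1"
      using Qm by simp
    then have p0: "?p \<noteq> 0"
      by (metis coeff_0 zero_neq_one)
    have "degree ?p \<le> Q ^ m"
      using Qm by (intro degree_diff_le) (auto intro: order_trans[OF degree_monom_le])
    moreover have "{z. poly ?p z = 0} = {z. z ^ (Q ^ m) = z}"
      by (simp add: poly_monom)
    ultimately show ?thesis
      using poly_roots_finite[OF p0] card_poly_roots_bound[OF p0] by simp
  qed
  \<comment> \<open>The uniform bound \<open>D\<close> makes the residue field finite; this must be
    known before a generator of its multiplicative group can be taken.\<close>
  have "residues M \<subseteq> (\<Union>m\<in>{1..D}. {z. z ^ (Q ^ m) = z})"
    using bound by fastforce
  then have "finite (residues M)"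
    by (rule finite_subset) (use roots in auto)
  then have fin: "finite (carrier (residue_field M))"
    by (simp add: carrier_residue_field)
  obtain g where g: "g \<in> carrier (residue_field M)"
    "carrier (mult_of (residue_field M)) = {g [^]\<^bsub>residue_field M\<^esub> i | i::nat. i \<in> UNIV}"
    using k.finite_field_mult_group_has_gen[OF fin] by auto
  then obtain z where z: "z \<in> residues M" "g = near z"
    by (auto simp: carrier_residue_field)
  then obtain c where c: "c \<in> M" "absv (c - z) < 1" "z \<in> Fbar"
    by (auto simp: residues_def)
  have c_le: "absv c \<le> 1"
    using c(2) absv_Fbar_le[OF c(3)] absv_add_le[of "c - z" 1 z] by simp
  then have c_O: "c \<in> carrier (integer_ring M)"
    using c(1) by (simp add: integer_ring_simps integers_of_def)
  obtain m where m: "1 \<le> m" "m \<le> D" "z ^ (Q ^ m) = z"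
    using bound[OF z(1)] by blast
  have "w ^ (Q ^ m) = w" if w: "w \<in> residues M" for w
  proof (cases "near w = \<zero>\<^bsub>residue_field M\<^esub>")
    case True
    have "\<zero>\<^bsub>residue_field M\<^esub> = near 0"
      using cls.hom_zero cls_near[of 0 0] subfield_setD(2)[OF M] by (simp add: integer_ring_simps)
    moreover have "0 \<in> residues M"
      using Fbar_0 subfield_setD(2)[OF M] by (auto simp: residues_def intro: bexI[of _ 0])
    ultimately have "w = 0"
      using True w inj_near by (auto dest: inj_onD)
    then show ?thesis
      using Q1 by (simp add: power_0_left)
  next
    case False
    then have "near w \<in> carrier (mult_of (residue_field M))"
      using w by (simp add: carrier_residue_field)
    then obtain i :: nat where i: "near w = near z [^]\<^bsub>residue_field M\<^esub> i"
      using g(2) z(2) by auto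
    have "near z = cls c"
      using cls_near[OF c(1,2)] by simp
    have "cls c [^]\<^bsub>residue_field M\<^esub> i = cls (c ^ i)" for i :: nat
    proof (induction i)
      case 0
      then show ?case
        using cls.hom_one by (simp add: integer_ring_simps)
    next
      case (Suc i)
      have "c ^ i \<in> carrier (integer_ring M)"
        by (induction i) (use c_O integers_closed in \<open>auto simp: integer_ring_simps\<close>)
      then show ?case
        using Suc cls.hom_mult[of "c ^ i" c] c_O by (simp add: integer_ring_simps mult.commute)
    qed
    then have "near w = cls (c ^ i)"
      using i \<open>near z = cls c\<close> by simp
    \<comment> \<open>Powers of the generating class are followed through the integer
      \<open>c\<close> of \<open>M\<close> back to powers of \<open>z\<close>, where the fixed point
      equation is available.\<close>
    moreover have "c ^ i \<in> M \<and> absv (c ^ i - z ^ i) < 1"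
    proof (induction i)
      case 0
      then show ?case
        using subfield_setD(1)[OF M] by simp
    next
      case (Suc i)
      have "absv (c * (c ^ i - z ^ i)) < 1" "absv ((c - z) * z ^ i) < 1"
        using Suc c(2) c_le absv_Fbar_le[OF Fbar_power[OF c(3), of i]] unfolding absv_mult
        by (auto intro: le_less_trans[OF mult_left_le_one_le] le_less_trans[OF mult_right_le_one_le])
      from absv_add_less[OF this] have "absv (c ^ Suc i - z ^ Suc i) < 1"
        by (simp add: algebra_simps)
      then show ?case
        using Suc subfield_setD(6)[OF M c(1)] by simp
    qed
    ultimately have "near w = near (z ^ i)" "z ^ i \<in> residues M"
      using cls_near[of "c ^ i" "z ^ i"] Fbar_power[OF c(3), of i] by (auto simp: residues_def)
    then have "w = z ^ i"
      using w inj_near by (auto dest: inj_onD)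
    then show ?thesis
      using m(3) by (metis power_commutes power_mult mult.commute)
  qed
  then have "residues M \<subseteq> {z. z ^ (Q ^ m) = z}"
    by blast
  then have "card (residues M) \<le> Q ^ m"
    using roots[OF m(1)] card_mono order_trans by blast
  then have "card (carrier (residue_field M)) \<le> card (residue_subfield M L) ^ m"
    unfolding card_L carrier_residue_field card_image[OF inj_near] .
  from k.finite_dimension_card_bound[OF subfield_residue_subfield fin this]
  show ?thesis
    using m(2) by (simp add: residue_degree_def Let_def over_def)
qed

end

text \<open>\<open>z\<close> is congruent to some \<open>c\<close> in \<open>M\<close>. As
  \<open>\<sigma>^m\<close> is isometric and fixes \<open>c\<close>, the image
  \<open>z ^ (Q ^ m)\<close> is congruent to \<open>c\<close> as well, and representatives in
  \<open>Fbar\<close> are unique.\<close>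

lemma residues_fixed:
  assumes \<sigma>: "isometric_hom \<sigma>" "\<sigma> z = z ^ Q" and z: "z \<in> residues M"
    and fixed: "\<And>x. x \<in> M \<Longrightarrow> (\<sigma> ^^ m) x = x"
  shows "z ^ (Q ^ m) = z"
proof -
  note s = isometric_homD[OF \<sigma>(1)] isometric_hom_simps[OF \<sigma>(1)]
  obtain c where c: "c \<in> M" "absv (c - z) < 1" "z \<in> Fbar"
    using z by (auto simp: residues_def)
  have pow: "(\<sigma> ^^ i) z = z ^ (Q ^ i)" for i
    by (induction i) (simp_all add: s \<sigma>(2) flip: power_mult)
  have "absv ((\<sigma> ^^ m) c - (\<sigma> ^^ m) z) = absv (c - z)"
    by (induction m) (simp_all add: s flip: s(7))
  then have "absv (c - z ^ (Q ^ m)) < 1"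
    using c fixed pow by simp
  from absv_diff_less[OF c(2) this] have "absv (z ^ (Q ^ m) - z) < 1"
    by (simp add: algebra_simps)
  then show ?thesis
    by (rule Fbar_eqI[OF Fbar_power[OF c(3)] c(3)])
qed

end

theorem theorem4p1:
  fixes \<iota> :: "'a::{field,finite} fls \<Rightarrow> 'c::{field,complete_space}"
    and L \<Lambda> :: "'c set"
    and \<Phi> :: "'c poly"
    and lam :: "nat \<Rightarrow> 'c"
    and B :: "nat \<Rightarrow> 'c set"
    and \<rho> :: "nat \<Rightarrow> nat"
    and r t :: nat
  assumes "completed_algebraic_closure \<iota>"
    and "finite_extension \<iota> L"
    and "r \<ge> 2"
    and "drinfeld_module \<iota> L r \<Phi>"
    and "period_lattice \<iota> r \<Phi> \<Lambda>"
    and "successive_minimum_basis \<iota> \<Lambda> r lam"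
    and "packets r lam t B"
    and "\<forall>\<tau>\<in>{1..t}. card (B \<tau>) = \<rho> \<tau>"
    and "(\<Sum>\<tau>=1..t. \<rho> \<tau>) = r"
  shows "residue_degree (adjoin L \<Lambda>) L
           \<le> enat ((\<Prod>\<tau>=1..t. CARD('a) ^ \<rho> \<tau> - 1) * CHAR('a) ^ (t - 1))"
proof -
  interpret finite_extension_field \<iota> L
    by (intro finite_extension_field.intro finite_extension_field_axioms.intro assms)
  interpret successive_minima \<iota> \<Lambda> r lam
    by (intro successive_minima.intro successive_minima_axioms.intro assms)
  interpret discrete_lattice \<iota> \<Lambda>
    by unfold_locales (rule finite_ball)
  let ?D = "(\<Prod>\<tau>=1..t. CARD('a) ^ \<rho> \<tau> - 1) * CHAR('a) ^ (t - 1)"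
  have exp: "lattice_exp \<Lambda> (\<iota> fls_X_inv * z) = poly \<Phi> (lattice_exp \<Lambda> z)" for z
    using assms(5) by (simp add: period_lattice_def)
  have "0 \<in> \<Lambda>"
    using A.span_zero by (simp flip: span_lam)
  have packet: "packet r lam (B \<tau>)" if "\<tau> \<in> {1..t}" for \<tau>
    using assms(7) that by (auto simp: packets_def bij_betw_def)
  have ordered: "absv x < absv y" if "\<sigma> \<in> {1..t}" "\<tau> \<in> {1..t}" "\<sigma> < \<tau>" "x \<in> B \<sigma>" "y \<in> B \<tau>" for \<sigma> \<tau> x y
    using assms(7) that unfolding packets_def by blast
  have B_sub: "B \<tau> \<subseteq> lam ` {1..r}" and B_ne: "B \<tau> \<noteq> {}"
    and B_const: "\<And>x y. x \<in> B \<tau> \<Longrightarrow> y \<in> B \<tau> \<Longrightarrow> absv x = absv y" if \<tau>: "\<tau> \<in> {1..t}" for \<tau>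
  proof -
    obtain a b where ab: "1 \<le> a" "a \<le> b" "b \<le> r" "B \<tau> = lam ` {a..b}"
      "\<forall>i\<in>{a..b}. absv (lam i) = absv (lam a)"
      using packet[OF \<tau>] unfolding packet_def by (elim exE conjE) (rule that)
    show "B \<tau> \<subseteq> lam ` {1..r}"
      unfolding ab(4) using ab(1,3) by (intro image_mono) auto
    show "B \<tau> \<noteq> {}"
      unfolding ab(4) using ab(2) by simp
    show "absv x = absv y" if xy: "x \<in> B \<tau>" "y \<in> B \<tau>" for x y
    proof -
      obtain i j where "i \<in> {a..b}" "x = lam i" "j \<in> {a..b}" "y = lam j"
        using xy unfolding ab(4) by blast
      then show ?thesis
        using bspec[OF ab(5)] by metis
    qed
  qed
  have B_fin: "finite (B \<tau>)" if "\<tau> \<in> {1..t}" for \<tau>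
    using finite_subset[OF B_sub[OF that]] by simp
  have disj: "B \<sigma> \<inter> B \<tau> = {}" if "\<sigma> \<in> {1..t}" "\<tau> \<in> {1..t}" "\<sigma> \<noteq> \<tau>" for \<sigma> \<tau>
  proof -
    consider "\<sigma> < \<tau>" | "\<tau> < \<sigma>"
      using \<open>\<sigma> \<noteq> \<tau>\<close> by linarith
    then show ?thesis
      using ordered[of \<sigma> \<tau>] ordered[of \<tau> \<sigma>] that(1,2) by cases (fastforce simp: disjoint_iff)+
  qed
  \<comment> \<open>The packets are disjoint subsets of the basis whose sizes sum to
    \<open>r\<close>, so they exhaust it.\<close>
  have cover: "(\<Union>\<tau>\<in>{1..t}. B \<tau>) = lam ` {1..r}"
  proof (rule card_subset_eq)
    have "card (\<Union>\<tau>\<in>{1..t}. B \<tau>) = (\<Sum>\<tau>=1..t. card (B \<tau>))"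
      using B_fin disj by (intro card_UN_disjoint) auto
    also have "\<dots> = r"
      using assms(8,9) by simp
    finally show "card (\<Union>\<tau>\<in>{1..t}. B \<tau>) = card (lam ` {1..r})"
      using card_image[OF inj_lam] by simp
    show "(\<Union>\<tau>\<in>{1..t}. B \<tau>) \<subseteq> lam ` {1..r}"
      using B_sub by blast
  qed simp
  have "\<exists>\<tau>. \<tau> \<in> {1..t} \<and> lam i \<in> B \<tau>" if "i \<in> {1..r}" for i
    using that cover by blast
  then obtain lev where lev: "\<And>i. i \<in> {1..r} \<Longrightarrow> lev i \<in> {1..t}"
    "\<And>i. i \<in> {1..r} \<Longrightarrow> lam i \<in> B (lev i)"
    by metis
  have lev_less: "lev i < lev j \<longleftrightarrow> absv (lam i) < absv (lam j)" if "i \<in> {1..r}" "j \<in> {1..r}" for i j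
    using ordered[of "lev i" "lev j" "lam i" "lam j"] ordered[of "lev j" "lev i" "lam j" "lam i"]
      B_const[of "lev i" "lam i" "lam j"] lev[OF that(1)] lev[OF that(2)]
    by (metis less_asym less_irrefl linorder_neqE_nat)
  have block: "lam ` {i\<in>{1..r}. lev i = k} = B k" if k: "k \<in> {1..t}" for k
  proof
    show "lam ` {i\<in>{1..r}. lev i = k} \<subseteq> B k"
      using lev by auto
    show "B k \<subseteq> lam ` {i\<in>{1..r}. lev i = k}"
    proof
      fix x assume x: "x \<in> B k"
      then obtain i where i: "i \<in> {1..r}" "x = lam i"
        using B_sub[OF k] by blast
      then have "lev i = k"
        using disj[of "lev i" k] lev[OF i(1)] x k by blast
      with i show "x \<in> lam ` {i\<in>{1..r}. lev i = k}"
        by blast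
    qed
  qed
  have card_block: "card {i\<in>{1..r}. lev i = k} = \<rho> k" if "k \<in> {1..t}" for k
  proof -
    have "inj_on lam {i\<in>{1..r}. lev i = k}"
      by (rule inj_on_subset[OF inj_lam]) blast
    then have "card {i\<in>{1..r}. lev i = k} = card (B k)"
      unfolding block[OF that, symmetric] by (rule card_image[symmetric])
    also have "\<dots> = \<rho> k"
      using assms(8) that by blast
    finally show ?thesis .
  qed
  have nonempty: "\<exists>i\<in>{1..r}. lev i = k" if "k \<in> {1..t}" for k
    using block[OF that] B_ne[OF that] by blast
  have t: "1 \<le> t"
    using assms(3,9) by (cases t) auto
  let ?M = "adjoin L \<Lambda>"
  have L\<Lambda>: "L \<union> \<Lambda> \<subseteq> ?M"
    by (auto simp: adjoin_def intro: generate_field.incl)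
  \<comment> \<open>\<open>\<sigma>\<close>, and with it \<open>m\<close>, depends on
    \<open>z\<close>; the bound \<open>?D\<close> is common to all \<open>z\<close>.\<close>
  have "\<exists>m. 1 \<le> m \<and> m \<le> ?D \<and> z ^ (Q ^ m) = z" if z: "z \<in> residues ?M" for z
  proof -
    have "z \<in> Fbar"
      using z by (simp add: residues_def)
    then obtain \<sigma> where \<sigma>: "isometric_hom \<sigma>" "\<And>x. x \<in> L \<Longrightarrow> \<sigma> x = x" "\<sigma> z = z ^ Q"
      using frobenius_hom_exists by blast
    have \<sigma>\<iota>: "\<sigma> (\<iota> a) = \<iota> a" for a
      using \<sigma>(2) L_\<iota> by simp
    have \<sigma>\<Lambda>: "\<sigma> x \<in> \<Lambda>" if "x \<in> \<Lambda>" for x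
      by (rule isometric_hom_lattice[OF assms(4) exp \<sigma>(1) \<sigma>\<iota> \<sigma>(2) \<open>0 \<in> \<Lambda>\<close> that])
    obtain m where m: "1 \<le> m"
      "m \<le> (\<Prod>k=1..t. CARD('a) ^ card {i\<in>{1..r}. lev i = k} - 1) * CHAR('a) ^ (t - 1)"
      "\<And>x. x \<in> \<Lambda> \<Longrightarrow> (\<sigma> ^^ m) x = x"
      using lattice_automorphism_order[OF \<sigma>(1) \<sigma>\<iota> \<sigma>\<Lambda> lev(1) lev_less nonempty t] by blast
    have "(\<sigma> ^^ m) x = x" if "x \<in> L" for x
      by (induction m) (simp_all add: \<sigma>(2) that)
    then have "(\<sigma> ^^ m) x = x" if "x \<in> ?M" for x
      using adjoin_fixed[OF \<sigma>(1) _ that] m(3) by blast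
    then have "z ^ (Q ^ m) = z"
      by (rule residues_fixed[OF \<sigma>(1,3) z])
    moreover have "m \<le> ?D"
      using m(2) card_block by simp
    ultimately show ?thesis
      using m(1) by blast
  qed
  then show ?thesis
    using L\<Lambda> by (intro residue_degree_bound[OF subfield_set_adjoin]) auto
qed

end
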